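(* Assume that the problem is unforced ($\widetilde{\mathbf f}=\mathbf 0$ and $\widetilde{\mathbf g}_N=\mathbf 0$) and the Dirichlet boundary conditions are static ($\dot{\mathbf g}_D=\mathbf 0$). Then: (1) any solution of the HDG-semidiscrete equations with flux defined by $\widehat{\boldsymbol\sigma}_h(t)\mathbf n:=\widetilde{\boldsymbol\sigma}_h(t)\mathbf n\pm\boldsymbol\tau(\mathbf P_M\dot{\mathbf u}_h(t)-\dot{\widehat{\mathbf u}}_h(t))$ satisfies (with the corresponding sign) $$\frac{\mathrm d}{\mathrm dt}\Big(\tfrac12\|\widetilde{\boldsymbol\sigma}_h(t)\|_{\mathcal A}^2+\tfrac12\|\dot{\mathbf u}_h(t)\|_\rho^2\Big)=\pm\|\mathbf P_M\dot{\mathbf u}_h(t)-\dot{\widehat{\mathbf u}}_h(t)\|_\tau^2\qquad\forall t;$$ (2) any solution of the HDG-semidiscrete equations with flux defined by $\widehat{\boldsymbol\sigma}_h(t)\mathbf n:=\widetilde{\boldsymbol\sigma}_h(t)\mathbf n-\boldsymbol\tau(\mathbf P_M\mathbf u_h(t)-\widehat{\mathbf u}_h(t))$ satisfies $$\frac{\mathrm d}{\mathrm dt}\Big(\tfrac12\|\widetilde{\boldsymbol\sigma}_h(t)\|_{\mathcal A}^2+\tfrac12\|\dot{\mathbf u}_h(t)\|_\rho^2+\tfrac12\|\mathbf P_M\mathbf u_h(t)-\widehat{\mathbf u}_h(t)\|_\tau^2\Big)=0\qquad\forall t.$$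
   Context: $\Omega\subset\mathbb R^3$ is a polyhedron with Lipschitz boundary $\Gamma$, split into non-overlapping $\Gamma_D,\Gamma_N$, each made of full faces of $\Gamma$. $\mathcal T_h$ is a conforming tetrahedrization of $\Omega$; $h_K$ is the diameter of $K\in\mathcal T_h$, $\mathcal E(K)$ its set of faces, $\mathcal E_h$ the set of all faces. All functions here are real-valued. Brackets: $(\mathbf u,\mathbf v)_K=\int_K\mathbf u\cdot\mathbf v$, $(\boldsymbol\xi,\boldsymbol\chi)_K=\int_K\boldsymbol\xi:\boldsymbol\chi$ with $\boldsymbol\xi:\boldsymbol\chi=\mathrm{trace}(\boldsymbol\chi^\top\boldsymbol\xi)$, $(\cdot,\cdot)_{\mathcal T_h}=\sum_K(\cdot,\cdot)_K$, $\langle\mathbf u,\mathbf v\rangle_{\partial\mathcal T_h}=\sum_K\int_{\partial K}\mathbf u\cdot\mathbf v$, $\langle\mathbf u,\mathbf v\rangle_{\partial\mathcal T_h\setminus\Gamma_D}=\sum_K\int_{\partial K\setminus\Gamma_D}\mathbf u\cdot\mathbf v$. Divergence acts on rows. For a.e. $\mathbf x\in\Omega$, $\mathcal C(\mathbf x)$ is a linear operator on $\mathbb R^{3\times3}_{\rm sym}$, symmetric with respect to $:$, uniformly positive definite and with $L^\infty(\Omega)$ components; $\mathcal A=\mathcal C^{-1}$ pointwise. $\rho:\Omega\to\mathbb R$ is bounded, and bounded below by a positive constant. $\|\boldsymbol\xi\|_{\mathcal A}^2=(\mathcal A\boldsymbol\xi,\boldsymbol\xi)_\Omega$, $\|\mathbf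 v\|_\rho^2=(\rho\mathbf v,\mathbf v)_\Omega$. Discrete spaces ($k\ge0$): $\mathbb V_h=\{\boldsymbol\xi:\boldsymbol\xi|_K\in\mathcal P_k(K;\mathbb R^{3\times3}_{\rm sym})\ \forall K\}$, $\mathbf W_h=\{\mathbf w:\mathbf w|_K\in\mathcal P_{k+1}(K;\mathbb R^3)\ \forall K\}$, $\mathbf M_h=\{\boldsymbol\mu:\mathcal E_h\to\mathbb R^3:\boldsymbol\mu|_F\in\mathcal P_k(F;\mathbb R^3)\ \forall F\in\mathcal E_h\}$. $\mathbf P_M$ is the $L^2$-orthogonal projection, on each $\partial K$, onto $\prod_{F\in\mathcal E(K)}\mathcal P_k(F;\mathbb R^3)$. For each $K$, $\boldsymbol\tau_K:\partial K\to\mathbb R^{3\times3}_{\rm sym}$ is constant on each face and, for fixed positive constants $c_\tau,c_\tau'$, $c_\tau h_K^{-1}\|\boldsymbol\mu\|_{\partial K}^2\le\langle\boldsymbol\tau_K\boldsymbol\mu,\boldsymbol\mu\rangle_{\partial K}\le c'_\tau h_K^{-1}\|\boldsymbol\mu\|^2_{\partial K}$ for all $\boldsymbol\mu\in L^2(\partial K;\mathbb R^3)$; $\boldsymbol\tau$ denotes the collection (it may be double-valued on interior faces) and $\|\boldsymbol\mu\|_\tau=\langle\boldsymbol\tau\boldsymbol\mu,\boldsymbol\mu\rangle_{\partial\mathcal T_h}^{1/2}$. Data: $\widetilde{\mathbf f}:[0,\infty)\to L^2(\Omega;\mathbb R^3)$, $\mathbf g_D:[0,\infty)\to H^{1/2}(\Gamma_D;\mathbb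 R^3)$, $\widetilde{\mathbf g}_N:[0,\infty)\to L^2(\Gamma_N;\mathbb R^3)$. The HDG-semidiscrete equations (for the elastic wave system $\mathcal A\widetilde{\boldsymbol\sigma}=\boldsymbol\varepsilon(\mathbf u)$, $\nabla\cdot\widetilde{\boldsymbol\sigma}-\rho\ddot{\mathbf u}=\widetilde{\mathbf f}$) look for functions of time, sufficiently differentiable so that all expressions make sense, $\widetilde{\boldsymbol\sigma}_h:[0,\infty)\to\mathbb V_h$, $\mathbf u_h:[0,\infty)\to\mathbf W_h$, $\widehat{\mathbf u}_h:[0,\infty)\to\mathbf M_h$ satisfying, for all $(\boldsymbol\xi,\mathbf w,\boldsymbol\mu)\in\mathbb V_h\times\mathbf W_h\times\mathbf M_h$ and $t\ge0$ ($\mathbf n$ the outward unit normal on each $\partial K$), $$(\mathcal A\widetilde{\boldsymbol\sigma}_h(t),\boldsymbol\xi)_{\mathcal T_h}+(\mathbf u_h(t),\nabla\cdot\boldsymbol\xi)_{\mathcal T_h}-\langle\widehat{\mathbf u}_h(t),\boldsymbol\xi\mathbf n\rangle_{\partial\mathcal T_h}=0,$$ $$(\widetilde{\boldsymbol\sigma}_h(t),\nabla\mathbf w)_{\mathcal T_h}-\langle\widehat{\boldsymbol\sigma}_h(t)\mathbf n,\mathbf w\rangle_{\partial\mathcal T_h}+(\rho\ddot{\mathbf u}_h(t),\mathbf w)_{\mathcal T_h}=-(\widetilde{\mathbf f}(t),\mathbf w)_{\mathcal T_h},$$ $$\langle\widehat{\boldsymbol\sigma}_h(t)\mathbf n,\boldsymbol\mu\rangle_{\partial\mathcal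 T_h\setminus\Gamma_D}=\langle\widetilde{\mathbf g}_N(t),\boldsymbol\mu\rangle_{\Gamma_N},\qquad\langle\widehat{\mathbf u}_h(t),\boldsymbol\mu\rangle_{\Gamma_D}=\langle\mathbf g_D(t),\boldsymbol\mu\rangle_{\Gamma_D},$$ where the flux $\widehat{\boldsymbol\sigma}_h(t)\mathbf n$ is one of those specified in the claim. *)

theory Defs
  imports "HOL-Analysis.Analysis"
begin

section \<open>Matrices and polynomials\<close>

definition Sym :: "(real^3^3) set" where
  "Sym = {\<xi>. transpose \<xi> = \<xi>}"

definition frob :: "real^3^3 \<Rightarrow> real^3^3 \<Rightarrow> real" where
  "frob \<xi> \<eta> = trace (transpose \<eta> ** \<xi>)"

text \<open>
  \<open>Pk k S V\<close> is \<open>P\<^sub>k(S; V)\<close>: restrictions to \<open>S\<close> of polynomials in three variables, of total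
  degree at most \<open>k\<close>, with coefficients in \<open>V\<close>. Values outside \<open>S\<close> are unconstrained. When \<open>S\<close>
  lies in a plane these are the polynomials of degree at most \<open>k\<close> in two tangential variables.
\<close>
definition Pk :: "nat \<Rightarrow> (real^3) set \<Rightarrow> 'b::real_vector set \<Rightarrow> (real^3 \<Rightarrow> 'b) set" where
  "Pk k S V = {p. \<exists>c. (\<forall>i j l. c i j l \<in> V) \<and>
     (\<forall>x\<in>S. p x = (\<Sum>(i, j, l)\<in>{(i, j, l). i + j + l \<le> k}.
                   (x$1 ^ i * x$2 ^ j * x$3 ^ l) *\<^sub>R c i j l))}"

definition row_div :: "(real^3 \<Rightarrow> real^3^3) \<Rightarrow> real^3 \<Rightarrow> real^3" where
  "row_div \<xi> x = (\<chi> i. trace (jacobian (\<lambda>y. \<xi> y $ i) (at x)))"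

section \<open>Domain, boundary splitting and mesh\<close>

text \<open>
  \<open>\<Omega>\<close> is locally the set above the graph of a Lipschitz function \<open>\<phi>\<close> defined on the plane
  through the origin orthogonal to the unit vector \<open>d\<close>.
\<close>
definition lipschitz_boundary :: "(real^3) set \<Rightarrow> bool" where
  "lipschitz_boundary \<Omega> \<longleftrightarrow>
     (\<forall>x\<in>frontier \<Omega>. \<exists>r>0. \<exists>d L. \<exists>\<phi> :: real^3 \<Rightarrow> real.
        norm d = 1 \<and> L-lipschitz_on {y. d \<bullet> y = 0} \<phi> \<and>
        \<Omega> \<inter> ball x r = {y \<in> ball x r. \<phi> (y - (d \<bullet> y) *\<^sub>R d) < d \<bullet> y})"

text \<open>The library's \<^const>\<open>polyhedron\<close> is always convex, hence finite unions of polytopes here.\<close>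
definition lipschitz_polyhedron :: "(real^3) set \<Rightarrow> bool" where
  "lipschitz_polyhedron \<Omega> \<longleftrightarrow>
     open \<Omega> \<and> (\<exists>\<P>. finite \<P> \<and> (\<forall>P\<in>\<P>. polytope P) \<and> closure \<Omega> = \<Union>\<P>) \<and>
     lipschitz_boundary \<Omega>"

text \<open>
  The faces of a (not necessarily convex) polyhedral surface \<open>\<Gamma>\<close> are the closures of the
  connected components of the set of points near which \<open>\<Gamma>\<close> coincides with a plane.
\<close>
definition flat_points :: "(real^3) set \<Rightarrow> (real^3) set" where
  "flat_points \<Gamma> = {x \<in> \<Gamma>. \<exists>r>0. \<exists>a b. a \<noteq> 0 \<and> \<Gamma> \<inter> ball x r = {y. a \<bullet> y = b} \<inter> ball x r}"

definition surface_faces :: "(real^3) set \<Rightarrow> (real^3) set set" where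
  "surface_faces \<Gamma> = closure ` components (flat_points \<Gamma>)"

definition face_splitting :: "(real^3) set \<Rightarrow> (real^3) set \<Rightarrow> (real^3) set \<Rightarrow> bool" where
  "face_splitting \<Gamma> \<Gamma>D \<Gamma>N \<longleftrightarrow>
     (\<exists>\<F> \<subseteq> surface_faces \<Gamma>. \<Gamma>D = \<Union>\<F> \<and> \<Gamma>N = \<Union>(surface_faces \<Gamma> - \<F>))"

definition conforming_tetrahedrization :: "(real^3) set set \<Rightarrow> (real^3) set \<Rightarrow> bool" where
  "conforming_tetrahedrization T \<Omega> \<longleftrightarrow>
     triangulation T \<and> (\<forall>K\<in>T. 3 simplex K) \<and> \<Union>T = closure \<Omega>"

definition elt_faces :: "(real^3) set \<Rightarrow> (real^3) set set" where
  "elt_faces K = {F. F facet_of K}"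

definition mesh_faces :: "(real^3) set set \<Rightarrow> (real^3) set set" where
  "mesh_faces T = (\<Union>K\<in>T. elt_faces K)"

definition normal :: "(real^3) set \<Rightarrow> (real^3) set \<Rightarrow> real^3" where
  "normal K F = (THE n. norm n = 1 \<and> (\<forall>x\<in>F. \<forall>y\<in>K. n \<bullet> (y - x) \<le> 0))"

section \<open>Surface measure on triangles\<close>

definition ref_triangle :: "(real \<times> real) set" where
  "ref_triangle = {(s, t). 0 \<le> s \<and> 0 \<le> t \<and> s + t \<le> 1}"

definition tri_param :: "real^3 \<Rightarrow> real^3 \<Rightarrow> real^3 \<Rightarrow> real \<times> real \<Rightarrow> real^3" where
  "tri_param a b c = (\<lambda>(s, t). a + s *\<^sub>R (b - a) + t *\<^sub>R (c - a))"

text \<open>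
  Surface measure of the triangle with vertices \<open>a, b, c\<close> (completed): the image of
  Lebesgue measure on the reference triangle, weighted by the surface element
  \<open>|\<partial>\<^sub>s X \<times> \<partial>\<^sub>t X|\<close> of the parametrization \<open>X = tri_param a b c\<close>.
\<close>
definition tri_measure :: "real^3 \<Rightarrow> real^3 \<Rightarrow> real^3 \<Rightarrow> (real^3) measure" where
  "tri_measure a b c = completion (distr
     (density lborel (\<lambda>p. ennreal (norm (cross3 (b - a) (c - a))) * indicator ref_triangle p))
     borel (tri_param a b c))"

text \<open>
  For a nondegenerate triangle \<open>F\<close> the choice below only fixes the order of its three vertices,
  on which \<^const>\<open>tri_measure\<close> does not depend.
\<close>
definition surface_measure :: "(real^3) set \<Rightarrow> (real^3) measure" where
  "surface_measure F =
     (let (a, b, c) = (SOME (a, b, c). F = convex hull {a, b, c}) in tri_measure a b c)"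

section \<open>Brackets\<close>

text \<open>
  Discontinuous functions are given by their pieces. A function on the elements of a mesh is a
  family indexed by \<open>K\<close>, the \<open>K\<close>-th member being used on \<open>K\<close> and (as trace) on its boundary;
  a function on the boundary of \<open>K\<close> is a family indexed by the faces \<open>F\<close> of \<open>K\<close>; a (possibly
  double-valued) function on the boundaries of all elements is indexed by \<open>K\<close> and \<open>F\<close>.
\<close>
type_synonym 'b elt_fun = "(real^3) set \<Rightarrow> real^3 \<Rightarrow> 'b"
type_synonym face_fun = "(real^3) set \<Rightarrow> real^3 \<Rightarrow> real^3"
type_synonym bdry_fun = "(real^3) set \<Rightarrow> (real^3) set \<Rightarrow> real^3 \<Rightarrow> real^3"

definition vec_inner :: "(real^3) set set \<Rightarrow> (real^3) elt_fun \<Rightarrow> (real^3) elt_fun \<Rightarrow> real" where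
  "vec_inner T u v = (\<Sum>K\<in>T. LINT x:K|lebesgue. u K x \<bullet> v K x)"

definition mat_inner :: "(real^3) set set \<Rightarrow> (real^3^3) elt_fun \<Rightarrow> (real^3^3) elt_fun \<Rightarrow> real" where
  "mat_inner T \<xi> \<eta> = (\<Sum>K\<in>T. LINT x:K|lebesgue. frob (\<xi> K x) (\<eta> K x))"

text \<open>\<open>bdK_inner K S\<close> is the bracket on \<open>\<partial>K - S\<close>.\<close>
definition bdK_inner :: "(real^3) set \<Rightarrow> (real^3) set \<Rightarrow> face_fun \<Rightarrow> face_fun \<Rightarrow> real" where
  "bdK_inner K S u v = (\<Sum>F\<in>elt_faces K. LINT x:(F - S)|surface_measure F. u F x \<bullet> v F x)"

definition bd_inner :: "(real^3) set set \<Rightarrow> (real^3) set \<Rightarrow> bdry_fun \<Rightarrow> bdry_fun \<Rightarrow> real" where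
  "bd_inner T S u v = (\<Sum>K\<in>T. bdK_inner K S (u K) (v K))"

text \<open>
  The bracket on a part \<open>S\<close> of the boundary of the domain. Faces interior to the domain
  contribute nothing, as they meet \<open>S\<close> in a null set.
\<close>
definition part_inner :: "(real^3) set set \<Rightarrow> (real^3) set \<Rightarrow> face_fun \<Rightarrow> face_fun \<Rightarrow> real" where
  "part_inner T S u v = (\<Sum>F\<in>mesh_faces T. LINT x:(F \<inter> S)|surface_measure F. u F x \<bullet> v F x)"

section \<open>Function spaces for the data\<close>

definition L2 :: "'a measure \<Rightarrow> ('a \<Rightarrow> real^3) set" where
  "L2 M = {f \<in> borel_measurable M. integrable M (\<lambda>x. (norm (f x))\<^sup>2)}"

definition L2_part :: "(real^3) set set \<Rightarrow> (real^3) set \<Rightarrow> (real^3 \<Rightarrow> real^3) set" where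
  "L2_part T S = {g. \<forall>F\<in>mesh_faces T. (\<lambda>x. indicator S x *\<^sub>R g x) \<in> L2 (surface_measure F)}"

text \<open>Squared Sobolev--Slobodeckij norm of \<open>H\<^sup>1\<^sup>/\<^sup>2(\<Gamma>)\<close>, \<open>\<Gamma>\<close> being two-dimensional.\<close>
definition slobodeckij_sq :: "(real^3) set set \<Rightarrow> (real^3) set \<Rightarrow> (real^3 \<Rightarrow> real^3) \<Rightarrow> ennreal" where
  "slobodeckij_sq T \<Gamma> G =
     (\<Sum>F\<in>mesh_faces T. \<integral>\<^sup>+x\<in>\<Gamma>. ennreal ((norm (G x))\<^sup>2) \<partial>surface_measure F) +
     (\<Sum>F\<in>mesh_faces T. \<Sum>F'\<in>mesh_faces T.
        \<integral>\<^sup>+x\<in>\<Gamma>. (\<integral>\<^sup>+y\<in>\<Gamma>. ennreal ((norm (G x - G y))\<^sup>2 / (norm (x - y)) ^ 3)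
                \<partial>surface_measure F') \<partial>surface_measure F)"

text \<open>
  \<open>H\<^sup>1\<^sup>/\<^sup>2(\<Gamma>D)\<close> consists of the restrictions to \<open>\<Gamma>D\<close> of elements of \<open>H\<^sup>1\<^sup>/\<^sup>2(\<Gamma>)\<close>, with the
  quotient norm: the infimum of the norms of all extensions (infinite if there is none).
\<close>
definition H12_norm_sq ::
  "(real^3) set set \<Rightarrow> (real^3) set \<Rightarrow> (real^3) set \<Rightarrow> (real^3 \<Rightarrow> real^3) \<Rightarrow> ennreal" where
  "H12_norm_sq T \<Gamma> \<Gamma>D g =
     (INF G\<in>{G. \<forall>F\<in>mesh_faces T. G \<in> borel_measurable (surface_measure F) \<and>
                (AE x in surface_measure F. x \<in> \<Gamma>D \<longrightarrow> G x = g x)}.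
        slobodeckij_sq T \<Gamma> G)"

definition H12 :: "(real^3) set set \<Rightarrow> (real^3) set \<Rightarrow> (real^3) set \<Rightarrow> (real^3 \<Rightarrow> real^3) set" where
  "H12 T \<Gamma> \<Gamma>D = {g. H12_norm_sq T \<Gamma> \<Gamma>D g < \<infinity>}"

text \<open>
  The derivative of \<open>g : [0,\<infinity>) \<rightarrow> H\<^sup>1\<^sup>/\<^sup>2(\<Gamma>D)\<close> exists and vanishes: the squared norm of
  \<open>(g(s) - g(t)) / (s - t)\<close> tends to zero as \<open>s \<rightarrow> t\<close>.
\<close>
definition H12_static ::
  "(real^3) set set \<Rightarrow> (real^3) set \<Rightarrow> (real^3) set \<Rightarrow> (real \<Rightarrow> real^3 \<Rightarrow> real^3) \<Rightarrow> bool" where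
  "H12_static T \<Gamma> \<Gamma>D g \<longleftrightarrow>
     (\<forall>t\<ge>0. ((\<lambda>s. H12_norm_sq T \<Gamma> \<Gamma>D (\<lambda>x. (g s x - g t x) /\<^sub>R (s - t))) \<longlongrightarrow> 0)
              (at t within {0..}))"

section \<open>Coefficients\<close>

definition Linfty :: "(real^3) set \<Rightarrow> (real^3 \<Rightarrow> real) set" where
  "Linfty \<Omega> = {f \<in> borel_measurable (lebesgue_on \<Omega>). \<exists>B. AE x in lebesgue_on \<Omega>. \<bar>f x\<bar> \<le> B}"

text \<open>
  Only the action of \<open>\<C> x\<close> on \<^const>\<open>Sym\<close> matters. Its components are the functions
  \<open>x \<mapsto> \<C> x \<xi> : \<eta>\<close> with \<open>\<xi>\<close>, \<open>\<eta>\<close> fixed (it is equivalent to let them run over a basis).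
\<close>
definition stiffness :: "(real^3) set \<Rightarrow> (real^3 \<Rightarrow> real^3^3 \<Rightarrow> real^3^3) \<Rightarrow> bool" where
  "stiffness \<Omega> \<C> \<longleftrightarrow>
     (AE x in lebesgue_on \<Omega>.
        (\<forall>\<xi>\<in>Sym. \<C> x \<xi> \<in> Sym) \<and>
        (\<forall>\<xi>\<in>Sym. \<forall>\<eta>\<in>Sym. \<C> x (\<xi> + \<eta>) = \<C> x \<xi> + \<C> x \<eta>) \<and>
        (\<forall>a. \<forall>\<xi>\<in>Sym. \<C> x (a *\<^sub>R \<xi>) = a *\<^sub>R \<C> x \<xi>) \<and>
        (\<forall>\<xi>\<in>Sym. \<forall>\<eta>\<in>Sym. frob (\<C> x \<xi>) \<eta> = frob \<xi> (\<C> x \<eta>))) \<and>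
     (\<exists>c>0. AE x in lebesgue_on \<Omega>. \<forall>\<xi>\<in>Sym. c * frob \<xi> \<xi> \<le> frob (\<C> x \<xi>) \<xi>) \<and>
     (\<forall>\<xi>\<in>Sym. \<forall>\<eta>\<in>Sym. (\<lambda>x. frob (\<C> x \<xi>) \<eta>) \<in> Linfty \<Omega>)"

definition compliance :: "(real^3 \<Rightarrow> real^3^3 \<Rightarrow> real^3^3) \<Rightarrow> real^3 \<Rightarrow> real^3^3 \<Rightarrow> real^3^3" where
  "compliance \<C> x = inv_into Sym (\<C> x)"

definition mass_density :: "(real^3) set \<Rightarrow> (real^3 \<Rightarrow> real) \<Rightarrow> bool" where
  "mass_density \<Omega> \<rho> \<longleftrightarrow> \<rho> \<in> borel_measurable (lebesgue_on \<Omega>) \<and>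
     (\<exists>r0>0. \<exists>r1. \<forall>x\<in>\<Omega>. r0 \<le> \<rho> x \<and> \<rho> x \<le> r1)"

text \<open>\<open>\<tau> K F\<close> is the constant value of \<open>\<tau>\<^sub>K\<close> on the face \<open>F\<close> of \<open>K\<close>.\<close>
type_synonym stab = "(real^3) set \<Rightarrow> (real^3) set \<Rightarrow> real^3^3"

definition stabilization :: "(real^3) set set \<Rightarrow> stab \<Rightarrow> real \<Rightarrow> real \<Rightarrow> bool" where
  "stabilization T \<tau> c c' \<longleftrightarrow>
     (\<forall>K\<in>T. (\<forall>F\<in>elt_faces K. \<tau> K F \<in> Sym) \<and>
        (\<forall>\<mu>. (\<forall>F\<in>elt_faces K. \<mu> F \<in> L2 (surface_measure F)) \<longrightarrow>
           c / diameter K * bdK_inner K {} \<mu> \<mu> \<le> bdK_inner K {} (\<lambda>F x. \<tau> K F *v \<mu> F x) \<mu> \<and>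
           bdK_inner K {} (\<lambda>F x. \<tau> K F *v \<mu> F x) \<mu> \<le> c' / diameter K * bdK_inner K {} \<mu> \<mu>))"

section \<open>Norms\<close>

definition norm_A :: "(real^3) set set \<Rightarrow> (real^3 \<Rightarrow> real^3^3 \<Rightarrow> real^3^3) \<Rightarrow> (real^3^3) elt_fun \<Rightarrow> real" where
  "norm_A T \<A> \<xi> = sqrt (mat_inner T (\<lambda>K x. \<A> x (\<xi> K x)) \<xi>)"

definition norm_rho :: "(real^3) set set \<Rightarrow> (real^3 \<Rightarrow> real) \<Rightarrow> (real^3) elt_fun \<Rightarrow> real" where
  "norm_rho T \<rho> v = sqrt (vec_inner T (\<lambda>K x. \<rho> x *\<^sub>R v K x) v)"

definition norm_tau :: "(real^3) set set \<Rightarrow> stab \<Rightarrow> bdry_fun \<Rightarrow> real" where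
  "norm_tau T \<tau> \<mu> = sqrt (bd_inner T {} (\<lambda>K F x. \<tau> K F *v \<mu> K F x) \<mu>)"

section \<open>Discrete spaces and projection\<close>

definition Vh :: "(real^3) set set \<Rightarrow> nat \<Rightarrow> (real^3^3) elt_fun set" where
  "Vh T k = {\<xi>. \<forall>K\<in>T. \<xi> K \<in> Pk k K Sym}"

definition Wh :: "(real^3) set set \<Rightarrow> nat \<Rightarrow> (real^3) elt_fun set" where
  "Wh T k = {w. \<forall>K\<in>T. w K \<in> Pk (k + 1) K UNIV}"

definition Mh :: "(real^3) set set \<Rightarrow> nat \<Rightarrow> face_fun set" where
  "Mh T k = {\<mu>. \<forall>F\<in>mesh_faces T. \<mu> F \<in> Pk k F UNIV}"

text \<open>
  \<open>L\<^sup>2(\<partial>K)\<close>-orthogonal projection of \<open>v\<close>. It is unique as a function on each face of \<open>K\<close>; the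
  choice only concerns irrelevant values off the faces.
\<close>
definition PM :: "nat \<Rightarrow> (real^3) set \<Rightarrow> face_fun \<Rightarrow> face_fun" where
  "PM k K v = (SOME w. (\<forall>F\<in>elt_faces K. w F \<in> Pk k F UNIV) \<and>
     (\<forall>\<mu>. (\<forall>F\<in>elt_faces K. \<mu> F \<in> Pk k F UNIV) \<longrightarrow> bdK_inner K {} w \<mu> = bdK_inner K {} v \<mu>))"

definition PM_jump :: "nat \<Rightarrow> (real^3) elt_fun \<Rightarrow> face_fun \<Rightarrow> bdry_fun" where
  "PM_jump k u uhat = (\<lambda>K F x. PM k K (\<lambda>F. u K) F x - uhat F x)"

section \<open>Semidiscrete equations\<close>

text \<open>
  Time derivatives on \<open>[0,\<infinity>)\<close> (one-sided at \<open>0\<close>) are taken pointwise in space. For functions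
  with values in the finite-dimensional discrete spaces this is the same as differentiation in
  any norm of the space.
\<close>
definition time_deriv ::
  "(real \<Rightarrow> (real^3) set \<Rightarrow> real^3 \<Rightarrow> 'b::real_normed_vector) \<Rightarrow> real \<Rightarrow> (real^3) set \<Rightarrow> real^3 \<Rightarrow> 'b" where
  "time_deriv u t = (\<lambda>K x. vector_derivative (\<lambda>s. u s K x) (at t within {0..}))"

definition time_differentiable ::
  "(real^3) set set \<Rightarrow> (real \<Rightarrow> (real^3) set \<Rightarrow> real^3 \<Rightarrow> 'b::real_normed_vector) \<Rightarrow> bool" where
  "time_differentiable \<S> u \<longleftrightarrow>
     (\<forall>t\<ge>0. \<forall>K\<in>\<S>. \<forall>x\<in>K. (\<lambda>s. u s K x) differentiable (at t within {0..}))"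

text \<open>
  \<open>q t K F x\<close> is the numerical flux \<open>\<sigma>\<^sub>h(t) n\<close> on the face \<open>F\<close> of \<open>K\<close>. In the volume terms the
  space derivatives are taken in the interior of each \<open>K\<close>; its boundary is a null set.
\<close>
definition hdg_solution ::
  "(real^3) set set \<Rightarrow> nat \<Rightarrow> (real^3) set \<Rightarrow> (real^3) set \<Rightarrow>
   (real^3 \<Rightarrow> real^3^3 \<Rightarrow> real^3^3) \<Rightarrow> (real^3 \<Rightarrow> real) \<Rightarrow>
   (real \<Rightarrow> real^3 \<Rightarrow> real^3) \<Rightarrow> (real \<Rightarrow> real^3 \<Rightarrow> real^3) \<Rightarrow> (real \<Rightarrow> real^3 \<Rightarrow> real^3) \<Rightarrow>
   (real \<Rightarrow> bdry_fun) \<Rightarrow>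
   (real \<Rightarrow> (real^3^3) elt_fun) \<Rightarrow> (real \<Rightarrow> (real^3) elt_fun) \<Rightarrow> (real \<Rightarrow> face_fun) \<Rightarrow> bool" where
  "hdg_solution T k \<Gamma>D \<Gamma>N \<A> \<rho> f gD gN q \<sigma> u uhat \<longleftrightarrow>
     (\<forall>t\<ge>0. \<sigma> t \<in> Vh T k \<and> u t \<in> Wh T k \<and> uhat t \<in> Mh T k) \<and>
     time_differentiable T \<sigma> \<and>
     time_differentiable T u \<and> time_differentiable T (time_deriv u) \<and>
     time_differentiable (mesh_faces T) uhat \<and>
     (\<forall>t\<ge>0. \<forall>\<xi>\<in>Vh T k. \<forall>w\<in>Wh T k. \<forall>\<mu>\<in>Mh T k.
        mat_inner T (\<lambda>K x. \<A> x (\<sigma> t K x)) \<xi>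
          + vec_inner T (u t) (\<lambda>K. row_div (\<xi> K))
          - bd_inner T {} (\<lambda>K. uhat t) (\<lambda>K F x. \<xi> K x *v normal K F) = 0 \<and>
        mat_inner T (\<sigma> t) (\<lambda>K x. jacobian (w K) (at x))
          - bd_inner T {} (q t) (\<lambda>K F. w K)
          + vec_inner T (\<lambda>K x. \<rho> x *\<^sub>R time_deriv (time_deriv u) t K x) w
          = - vec_inner T (\<lambda>K. f t) w \<and>
        bd_inner T \<Gamma>D (q t) (\<lambda>K. \<mu>) = part_inner T \<Gamma>N (\<lambda>F. gN t) \<mu> \<and>
        part_inner T \<Gamma>D (uhat t) \<mu> = part_inner T \<Gamma>D (\<lambda>F. gD t) \<mu>)"

text \<open>The flux \<open>\<sigma> n + s \<tau> (P\<^sub>M v - vhat)\<close> with sign \<open>s\<close>.\<close>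
definition flux ::
  "nat \<Rightarrow> stab \<Rightarrow> real \<Rightarrow> (real^3^3) elt_fun \<Rightarrow> (real^3) elt_fun \<Rightarrow> face_fun \<Rightarrow> bdry_fun" where
  "flux k \<tau> s \<sigma> v vhat =
     (\<lambda>K F x. \<sigma> K x *v normal K F + s *\<^sub>R (\<tau> K F *v PM_jump k v vhat K F x))"

end

theory Submission
  imports Defs
begin

text \<open>
  The energy laws come from testing the semidiscrete equations with the solution. Write
  \<open>(a, b)\<close> for brackets over elements and \<open>\<langle>a, b\<rangle>\<close> for brackets over element boundaries, and a
  prime for the time derivative. Differentiating the constitutive equation in time and testing it
  with \<open>\<sigma>\<close>, and testing the momentum equation with \<open>u'\<close>, gives after addition
  \<open>(A \<sigma>', \<sigma>) + (\<rho> u'', u') + (u', div \<sigma>) + (\<sigma>, \<nabla>u') = \<langle>uhat', \<sigma> n\<rangle> + \<langle>q, u'\<rangle>\<close> for the flux \<open>q\<close>.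
  The first two terms are the derivative of the energy, because \<open>A\<close> is symmetric; the next two
  are \<open>\<langle>\<sigma> n, u'\<rangle>\<close> by integration by parts on each tetrahedron. Finally \<open>\<langle>q, uhat'\<rangle> = 0\<close>: off the
  Dirichlet boundary this is the transmission condition without traction, and on it \<open>uhat'\<close>
  vanishes, since static Dirichlet data make the time derivative of the projected trace zero.
  With \<open>q = \<sigma> n + s \<tau> J\<close> everything cancels except \<open>s \<langle>\<tau> J, u' - uhat'\<rangle>\<close>
  (\<open>energy_derivative\<close>). As \<open>\<tau> J\<close> is a polynomial of degree \<open>k\<close> on each face, \<open>u'\<close> may be
  replaced here by its projection. If \<open>J\<close> is the jump of the velocities, this is \<open>s\<close> times the
  squared norm of \<open>J\<close> (\<open>derivative_flux_energy\<close>). If \<open>J\<close> is the jump of the displacements and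
  \<open>s = -1\<close>, it is minus the time derivative of half that squared norm
  (\<open>displacement_flux_energy\<close>).

  Four facts carry the analysis behind this computation.

  \<^item> Time derivatives are pointwise in space, whereas brackets are integrals. Polynomials on a set
    have coordinates that are point values (\<open>Pk_coordinates\<close>), so brackets of solutions are
    finite sums of products of differentiable functions and fixed numbers.

  \<^item> The divergence theorem on a tetrahedron (\<open>gauss_simplex\<close>), for the surface measure and the
    normal of the definitions. It is proved along each edge direction by Fubini's theorem and the
    fundamental theorem of calculus; the edges at one vertex span the space.

  \<^item> All integrands are integrable. The elements differ from subsets of \<open>\<Omega>\<close> by null sets, as the
    boundary is locally a Lipschitz graph, and the compliance has bounded measurable components,
    being a pointwise limit of Richardson iterates (\<open>compliance_measurable\<close>).

  \<^item> The Dirichlet part of the boundary is a Borel set, as a flat surface has only countably many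
    faces, and \<open>H\<^sup>1\<^sup>/\<^sup>2\<close>-static data pair with each fixed function to a function of time with zero
    derivative (\<open>H12_static_pairing_derivative\<close>).
\<close>

section \<open>Polynomials and their coordinates\<close>

definition mono3 :: "nat \<times> nat \<times> nat \<Rightarrow> real^3 \<Rightarrow> real" where
  "mono3 = (\<lambda>(i, j, l) x. x$1 ^ i * x$2 ^ j * x$3 ^ l)"

definition exps :: "nat \<Rightarrow> (nat \<times> nat \<times> nat) set" where
  "exps k = {(i, j, l). i + j + l \<le> k}"

lemma finite_exps [simp]: "finite (exps k)"
  by (rule finite_subset[of _ "{..k} \<times> {..k} \<times> {..k}"]) (auto simp: exps_def)

lemma Pk_iff:
  "p \<in> Pk k S V \<longleftrightarrow>
     (\<exists>c. (\<forall>\<alpha>. c \<alpha> \<in> V) \<and> (\<forall>x\<in>S. p x = (\<Sum>\<alpha>\<in>exps k. mono3 \<alpha> x *\<^sub>R c \<alpha>)))"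
proof
  assume "p \<in> Pk k S V"
  then obtain c where c: "\<forall>i j l. c i j l \<in> V"
    "\<forall>x\<in>S. p x = (\<Sum>(i, j, l)\<in>{(i, j, l). i + j + l \<le> k}. (x$1 ^ i * x$2 ^ j * x$3 ^ l) *\<^sub>R c i j l)"
    unfolding Pk_def by blast
  show "\<exists>c. (\<forall>\<alpha>. c \<alpha> \<in> V) \<and> (\<forall>x\<in>S. p x = (\<Sum>\<alpha>\<in>exps k. mono3 \<alpha> x *\<^sub>R c \<alpha>))"
    by (rule exI[of _ "\<lambda>(i, j, l). c i j l"])
      (use c in \<open>auto simp: exps_def mono3_def case_prod_unfold\<close>)
next
  assume "\<exists>c. (\<forall>\<alpha>. c \<alpha> \<in> V) \<and> (\<forall>x\<in>S. p x = (\<Sum>\<alpha>\<in>exps k. mono3 \<alpha> x *\<^sub>R c \<alpha>))"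
  then obtain c where c: "\<forall>\<alpha>. c \<alpha> \<in> V" "\<forall>x\<in>S. p x = (\<Sum>\<alpha>\<in>exps k. mono3 \<alpha> x *\<^sub>R c \<alpha>)" by blast
  show "p \<in> Pk k S V" unfolding Pk_def mem_Collect_eq
    by (rule exI[of _ "\<lambda>i j l. c (i, j, l)"])
      (use c in \<open>auto simp: exps_def mono3_def case_prod_unfold\<close>)
qed

lemma Pk_cong: "p \<in> Pk k S V \<Longrightarrow> (\<And>x. x \<in> S \<Longrightarrow> q x = p x) \<Longrightarrow> q \<in> Pk k S V"
  unfolding Pk_iff by auto

lemma Pk_lincomb:
  assumes V: "subspace V" and p: "p \<in> Pk k S V" and q: "q \<in> Pk k S V"
  shows "(\<lambda>x. a *\<^sub>R p x + b *\<^sub>R q x) \<in> Pk k S V"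
proof -
  obtain c where c: "\<forall>\<alpha>. c \<alpha> \<in> V" "\<forall>x\<in>S. p x = (\<Sum>\<alpha>\<in>exps k. mono3 \<alpha> x *\<^sub>R c \<alpha>)"
    using p[unfolded Pk_iff] by (elim exE conjE)
  obtain d where d: "\<forall>\<alpha>. d \<alpha> \<in> V" "\<forall>x\<in>S. q x = (\<Sum>\<alpha>\<in>exps k. mono3 \<alpha> x *\<^sub>R d \<alpha>)"
    using q[unfolded Pk_iff] by (elim exE conjE)
  show ?thesis unfolding Pk_iff using c d
    by (intro exI[of _ "\<lambda>\<alpha>. a *\<^sub>R c \<alpha> + b *\<^sub>R d \<alpha>"])
      (auto simp: scaleR_right.sum sum.distrib algebra_simps intro!: subspace_add subspace_scale V)
qed

lemma Pk_zero: "subspace V \<Longrightarrow> (\<lambda>x. 0) \<in> Pk k S V"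
  unfolding Pk_iff by (rule exI[of _ "\<lambda>_. 0"]) (auto simp: subspace_0)

lemma Pk_sum:
  assumes V: "subspace V" and p: "\<And>i. i \<in> I \<Longrightarrow> p i \<in> Pk k S V"
  shows "(\<lambda>x. \<Sum>i\<in>I. c i *\<^sub>R p i x) \<in> Pk k S V"
  using p
proof (induction I rule: infinite_finite_induct)
  case (insert i I)
  then have "(\<lambda>x. c i *\<^sub>R p i x + 1 *\<^sub>R (\<Sum>i\<in>I. c i *\<^sub>R p i x)) \<in> Pk k S V"
    by (intro Pk_lincomb V) auto
  then show ?case using insert by simp
qed (auto intro: Pk_zero V)

lemma Pk_linear_image:
  assumes "linear h" and "p \<in> Pk k S V" and "h ` V \<subseteq> W"
  shows "(\<lambda>x. h (p x)) \<in> Pk k S W"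
proof -
  obtain c where "\<forall>\<alpha>. c \<alpha> \<in> V" "\<forall>x\<in>S. p x = (\<Sum>\<alpha>\<in>exps k. mono3 \<alpha> x *\<^sub>R c \<alpha>)"
    using assms(2) unfolding Pk_iff by blast
  then show ?thesis unfolding Pk_iff using assms(1,3)
    by (intro exI[of _ "\<lambda>\<alpha>. h (c \<alpha>)"]) (auto simp: linear_sum linear_scale)
qed

lemma mono3_smooth: "\<exists>D. \<forall>x. (mono3 \<alpha> has_derivative D x) (at x) \<and> (\<forall>v. continuous_on UNIV (\<lambda>x. D x v))"
proof -
  obtain i j l where \<alpha>: "\<alpha> = (i, j, l)" by (cases \<alpha>)
  have nth: "((\<lambda>x::real^3. x $ a) has_derivative (\<lambda>v. v $ a)) (at x)" for a x
    by (rule bounded_linear_imp_has_derivative[OF bounded_linear_vec_nth])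
  have "(mono3 \<alpha> has_derivative (\<lambda>v. x$1 ^ i * x$2 ^ j * (real l * v$3 * x$3 ^ (l - 1))
      + (x$1 ^ i * (real j * v$2 * x$2 ^ (j - 1)) + real i * v$1 * x$1 ^ (i - 1) * x$2 ^ j) * x$3 ^ l)) (at x)" for x
    unfolding mono3_def \<alpha> prod.case
    by (rule derivative_eq_intros nth | rule ext, simp add: algebra_simps)+
  then show ?thesis
    by (intro exI[of _ "\<lambda>x v. x$1 ^ i * x$2 ^ j * (real l * v$3 * x$3 ^ (l - 1))
      + (x$1 ^ i * (real j * v$2 * x$2 ^ (j - 1)) + real i * v$1 * x$1 ^ (i - 1) * x$2 ^ j) * x$3 ^ l"]
        allI conjI continuous_intros) simp_all
qed

lemma Pk_values: "subspace V \<Longrightarrow> p \<in> Pk k S V \<Longrightarrow> x \<in> S \<Longrightarrow> p x \<in> V"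
  unfolding Pk_iff by (auto intro!: subspace_sum subspace_scale)

text \<open>Members of \<^const>\<open>Pk\<close> are arbitrary off \<open>S\<close>, so calculus is done on a polynomial with the same values on \<open>S\<close>.\<close>

lemma Pk_smooth_extension:
  assumes "p \<in> Pk k S (V :: 'b::real_normed_vector set)"
  obtains P D where "\<And>x. x \<in> S \<Longrightarrow> p x = P x"
    and "\<And>x. (P has_derivative D x) (at x)" and "\<And>v. continuous_on UNIV (\<lambda>x. D x v)"
proof -
  obtain c where c: "\<forall>x\<in>S. p x = (\<Sum>\<alpha>\<in>exps k. mono3 \<alpha> x *\<^sub>R c \<alpha>)"
    using assms unfolding Pk_iff by blast
  obtain D where D: "\<And>\<alpha> x. (mono3 \<alpha> has_derivative D \<alpha> x) (at x)"
    "\<And>\<alpha> v. continuous_on UNIV (\<lambda>x. D \<alpha> x v)"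
    using mono3_smooth by metis
  show ?thesis
  proof (rule that)
    show "((\<lambda>x. \<Sum>\<alpha>\<in>exps k. mono3 \<alpha> x *\<^sub>R c \<alpha>) has_derivative
        (\<lambda>v. \<Sum>\<alpha>\<in>exps k. D \<alpha> x v *\<^sub>R c \<alpha>)) (at x)" for x
      by (intro has_derivative_sum has_derivative_scaleR_left D)
    show "continuous_on UNIV (\<lambda>x. \<Sum>\<alpha>\<in>exps k. D \<alpha> x v *\<^sub>R c \<alpha>)" for v
      by (intro continuous_intros D)
  qed (use c in blast)
qed

lemma Pk_continuous_on:
  assumes "p \<in> Pk k S (V :: 'b::real_normed_vector set)"
  shows "continuous_on S p"
proof -
  obtain P D where P: "\<And>x. x \<in> S \<Longrightarrow> p x = P x" "\<And>x. (P has_derivative D x) (at x)"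
    using Pk_smooth_extension[OF assms] by metis
  have "continuous_on S P"
    using P(2) by (intro continuous_at_imp_continuous_on ballI has_derivative_continuous)
  then show ?thesis using P(1) continuous_on_cong by metis
qed

text \<open>
  Lagrange interpolation for an arbitrary finite family of functions on an arbitrary set. A new
  function either is reproduced by the nodes found so far, or its interpolation error is nonzero at
  some point of \<open>S\<close>, which becomes a new node; the error vanishes at the old nodes, so dividing it
  by its value at the new node gives the new dual function.
\<close>

lemma nodal_basis:
  fixes m :: "'i \<Rightarrow> 'x \<Rightarrow> real"
  assumes "finite I"
  shows "\<exists>Y L. finite Y \<and> Y \<subseteq> S \<and> (\<forall>y\<in>Y. \<exists>a. \<forall>x. L y x = (\<Sum>i\<in>I. a i * m i x)) \<and>
     (\<forall>y\<in>Y. \<forall>z\<in>Y. L y z = (if y = z then 1 else 0)) \<and>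
     (\<forall>i\<in>I. \<forall>x\<in>S. m i x = (\<Sum>y\<in>Y. m i y * L y x))"
  using assms
proof induction
  case empty
  show ?case by (intro exI[of _ "{}"]) auto
next
  case (insert n I)
  from insert.IH obtain Y L where Y: "finite Y" "Y \<subseteq> S"
    and span_all: "\<forall>y\<in>Y. \<exists>a. \<forall>x. L y x = (\<Sum>i\<in>I. a i * m i x)"
    and dual_all: "\<forall>y\<in>Y. \<forall>z\<in>Y. L y z = (if y = z then 1 else 0)"
    and repr_all: "\<forall>i\<in>I. \<forall>x\<in>S. m i x = (\<Sum>y\<in>Y. m i y * L y x)"
    by (elim exE conjE)
  note span = span_all[rule_format] and dual = dual_all[rule_format] and repr = repr_all[rule_format]
  have upd: "(\<Sum>i\<in>insert n I. (f(n := c)) i * m i x) = c * m n x + (\<Sum>i\<in>I. f i * m i x)" for f c x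
    using insert.hyps by (auto intro!: sum.cong)
  have span': "\<exists>a. \<forall>x. L y x = (\<Sum>i\<in>insert n I. a i * m i x)" if y: "y \<in> Y" for y
  proof -
    obtain a where "\<forall>x. L y x = (\<Sum>i\<in>I. a i * m i x)" using span[OF y] by blast
    then show ?thesis by (intro exI[of _ "a(n := 0)"]) (simp only: upd, simp)
  qed
  define r where "r x = m n x - (\<Sum>y\<in>Y. m n y * L y x)" for x
  have r_span: "\<exists>a. \<forall>x. r x = (\<Sum>i\<in>insert n I. a i * m i x)"
  proof -
    obtain a where a: "\<forall>y\<in>Y. \<forall>x. L y x = (\<Sum>i\<in>I. a y i * m i x)"
      using bchoice[OF span_all] by (elim exE)
    have "r x = m n x - (\<Sum>i\<in>I. (\<Sum>y\<in>Y. m n y * a y i) * m i x)" for x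
      unfolding r_def using a
      by (simp add: sum_distrib_left sum_distrib_right mult.assoc sum.swap[of _ Y I])
    then show ?thesis
      by (intro exI[of _ "(\<lambda>i. - (\<Sum>y\<in>Y. m n y * a y i))(n := 1)"]) (simp only: upd, simp add: sum_negf)
  qed
  have rY: "r y = 0" if "y \<in> Y" for y
  proof -
    have "(\<Sum>z\<in>Y. m n z * L z y) = (\<Sum>z\<in>Y. if z = y then m n y else 0)"
      using dual that by (intro sum.cong) auto
    then show ?thesis using that Y by (simp add: r_def)
  qed
  show ?case
  proof (cases "\<exists>z\<in>S. r z \<noteq> 0")
    case False
    then show ?thesis using Y span' dual repr
      by (intro exI[of _ Y] exI[of _ L]) (auto simp: r_def)
  next
    case True
    then obtain z where z: "z \<in> S" "r z \<noteq> 0" by blast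
    have zY: "z \<notin> Y" using z rY by blast
    then have neq: "\<And>y. y \<in> Y \<Longrightarrow> y \<noteq> z" by blast
    define L' where "L' y x = (if y = z then r x / r z else L y x - L y z * (r x / r z))" for y x
    show ?thesis
    proof (intro exI[of _ "insert z Y"] exI[of _ L'] conjI ballI)
      obtain b where b: "\<And>x. r x = (\<Sum>i\<in>insert n I. b i * m i x)" using r_span by blast
      fix y assume y: "y \<in> insert z Y"
      show "\<exists>a. \<forall>x. L' y x = (\<Sum>i\<in>insert n I. a i * m i x)"
      proof (cases "y = z")
        case True
        have "L' y x = (\<Sum>i\<in>insert n I. (b i / r z) * m i x)" for x
          using True b[of x] by (simp add: L'_def sum_divide_distrib)
        then show ?thesis by (intro exI[of _ "\<lambda>i. b i / r z"]) auto
      next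
        case False
        then obtain a where a: "\<And>x. L y x = (\<Sum>i\<in>insert n I. a i * m i x)"
          using span' y by blast
        have "L' y x = (\<Sum>i\<in>insert n I. (a i - L y z * (b i / r z)) * m i x)" for x
          unfolding L'_def a[of x] b[of x] using False
          by (simp only: sum_divide_distrib sum_distrib_left sum_subtractf left_diff_distrib if_False
              times_divide_eq_left times_divide_eq_right mult.assoc)
        then show ?thesis by (intro exI[of _ "\<lambda>i. a i - L y z * (b i / r z)"]) auto
      qed
    next
      fix y w assume "y \<in> insert z Y" "w \<in> insert z Y"
      then show "L' y w = (if y = w then 1 else 0)"
        using z rY dual neq by (auto simp: L'_def)
    next
      fix i x assume i: "i \<in> insert n I" and x: "x \<in> S"
      have eq: "(\<Sum>y\<in>insert z Y. m i y * L' y x) =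
          (m i z - (\<Sum>y\<in>Y. m i y * L y z)) * (r x / r z) + (\<Sum>y\<in>Y. m i y * L y x)"
      proof -
        have "(\<Sum>y\<in>Y. m i y * L' y x) = (\<Sum>y\<in>Y. m i y * L y x) - (\<Sum>y\<in>Y. m i y * L y z) * (r x / r z)"
          unfolding sum_distrib_right sum_subtractf[symmetric]
          by (intro sum.cong refl) (simp add: L'_def neq right_diff_distrib mult.assoc)
        moreover have "L' z x = r x / r z" by (simp add: L'_def)
        ultimately show ?thesis using zY Y(1)
          by (simp only: sum.insert[OF Y(1) zY] left_diff_distrib)
      qed
      show "m i x = (\<Sum>y\<in>insert z Y. m i y * L' y x)"
      proof (cases "i = n")
        case True
        have rz: "m n z - (\<Sum>y\<in>Y. m n y * L y z) = r z" by (simp only: r_def)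
        have "(\<Sum>y\<in>insert z Y. m i y * L' y x) = r z * (r x / r z) + (\<Sum>y\<in>Y. m n y * L y x)"
          using eq unfolding True rz .
        also have "r z * (r x / r z) = m n x - (\<Sum>y\<in>Y. m n y * L y x)"
          using z(2) by (simp add: r_def[of x])
        finally show ?thesis by (simp add: True)
      next
        case False
        then have "i \<in> I" using i by blast
        then show ?thesis unfolding eq using repr[OF _ x] repr[OF _ z(1)] by simp
      qed
    qed (use Y z in auto)
  qed
qed

lemma orthonormal_expansion:
  fixes V :: "'b::euclidean_space set"
  assumes V: "subspace V"
  obtains E where "finite E" "E \<subseteq> V" "\<And>v. v \<in> V \<Longrightarrow> v = (\<Sum>e\<in>E. (v \<bullet> e) *\<^sub>R e)"
proof -
  obtain E where E: "E \<subseteq> V" "pairwise orthogonal E" "\<And>e. e \<in> E \<Longrightarrow> norm e = 1"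
      "independent E" "span E = V"
    using orthonormal_basis_subspace[OF V] by metis
  have finE: "finite E" using E(4) by (rule independent_imp_finite)
  have expand: "v = (\<Sum>e\<in>E. (v \<bullet> e) *\<^sub>R e)" if v: "v \<in> V" for v
  proof -
    define w where "w = v - (\<Sum>e\<in>E. (v \<bullet> e) *\<^sub>R e)"
    have "w \<in> span E"
      unfolding w_def using v E by (intro span_diff span_sum span_scale) (auto intro: span_base)
    moreover have "orthogonal w e" if e: "e \<in> E" for e
    proof -
      have "(\<Sum>d\<in>E. (v \<bullet> d) * (d \<bullet> e)) = (\<Sum>d\<in>E. if d = e then v \<bullet> e else 0)"
        using E(2) E(3)[OF e] e
        by (intro sum.cong) (auto simp: pairwise_def orthogonal_def norm_eq_1)
      then show ?thesis
        using e finE by (simp add: w_def orthogonal_def inner_diff_left inner_sum_left)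
    qed
    ultimately have "orthogonal w w" by (rule orthogonal_to_span)
    then have "w = 0" by (simp only: orthogonal_self)
    then show ?thesis by (simp only: w_def right_minus_eq)
  qed
  show ?thesis by (rule that[OF finE E(1) expand])
qed

text \<open>
  The coefficients of a polynomial on \<open>S\<close> are not determined by its values if \<open>S\<close> is flat. The
  coordinates used here are components of point values instead, so that they are well defined and
  inherit whatever is known about the function at each point.
\<close>

lemma Pk_coordinates:
  fixes V :: "'b::euclidean_space set"
  assumes V: "subspace V"
  shows "\<exists>(I :: ((real^3) \<times> 'b) set) \<phi>. finite I \<and> (\<forall>i\<in>I. fst i \<in> S) \<and> (\<forall>i\<in>I. \<phi> i \<in> Pk k S V) \<and>
     (\<forall>p\<in>Pk k S V. \<forall>x\<in>S. p x = (\<Sum>i\<in>I. (p (fst i) \<bullet> snd i) *\<^sub>R \<phi> i x))"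
proof -
  from nodal_basis[OF finite_exps[of k], where S=S and m=mono3] obtain Y L where Y: "finite Y" "Y \<subseteq> S"
    and span: "\<forall>y\<in>Y. \<exists>a. \<forall>x. L y x = (\<Sum>\<alpha>\<in>exps k. a \<alpha> * mono3 \<alpha> x)"
    and "\<forall>y\<in>Y. \<forall>z\<in>Y. L y z = (if y = z then 1 else 0)"
    and repr: "\<forall>\<alpha>\<in>exps k. \<forall>x\<in>S. mono3 \<alpha> x = (\<Sum>y\<in>Y. mono3 \<alpha> y * L y x)"
    by (elim exE conjE)
  obtain E where finE: "finite E" and E: "E \<subseteq> V"
    and expand: "\<And>v. v \<in> V \<Longrightarrow> v = (\<Sum>e\<in>E. (v \<bullet> e) *\<^sub>R e)"
    using orthonormal_expansion[OF V] by blast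
  show ?thesis
  proof (intro exI[of _ "Y \<times> E"] exI[of _ "\<lambda>i x. L (fst i) x *\<^sub>R snd i"] conjI ballI)
    fix i assume i: "i \<in> Y \<times> E"
    then have "fst i \<in> Y" by (simp add: mem_Times_iff)
    with span obtain a where a: "\<forall>x. L (fst i) x = (\<Sum>\<alpha>\<in>exps k. a \<alpha> * mono3 \<alpha> x)"
      by blast
    show "(\<lambda>x. L (fst i) x *\<^sub>R snd i) \<in> Pk k S V"
      unfolding Pk_iff using i E V a
      by (intro exI[of _ "\<lambda>\<alpha>. a \<alpha> *\<^sub>R snd i"])
        (auto simp: scaleR_left.sum mult.commute intro!: subspace_scale)
  next
    fix p x assume p: "p \<in> Pk k S V" and x: "x \<in> S"
    obtain c where c: "\<forall>\<alpha>. c \<alpha> \<in> V" "\<And>x. x \<in> S \<Longrightarrow> p x = (\<Sum>\<alpha>\<in>exps k. mono3 \<alpha> x *\<^sub>R c \<alpha>)"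
      using p[unfolded Pk_iff] by (elim exE conjE) blast
    have pV: "p y \<in> V" if "y \<in> S" for y
      using c V that by (auto intro!: subspace_sum subspace_scale)
    have r: "mono3 \<alpha> x = (\<Sum>y\<in>Y. mono3 \<alpha> y * L y x)" if "\<alpha> \<in> exps k" for \<alpha>
      using repr x that by blast
    have "p x = (\<Sum>\<alpha>\<in>exps k. mono3 \<alpha> x *\<^sub>R c \<alpha>)" by (rule c(2)[OF x])
    also have "\<dots> = (\<Sum>\<alpha>\<in>exps k. \<Sum>y\<in>Y. L y x *\<^sub>R mono3 \<alpha> y *\<^sub>R c \<alpha>)"
      by (rule sum.cong[OF refl]) (simp only: r scaleR_left.sum scaleR_scaleR mult.commute)
    also have "\<dots> = (\<Sum>y\<in>Y. L y x *\<^sub>R (\<Sum>\<alpha>\<in>exps k. mono3 \<alpha> y *\<^sub>R c \<alpha>))"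
      by (subst sum.swap) (simp only: scaleR_right.sum)
    also have "\<dots> = (\<Sum>y\<in>Y. L y x *\<^sub>R p y)"
      by (rule sum.cong[OF refl], subst c(2)) (use Y(2) in auto)
    also have "\<dots> = (\<Sum>y\<in>Y. L y x *\<^sub>R (\<Sum>e\<in>E. (p y \<bullet> e) *\<^sub>R e))"
      by (rule sum.cong[OF refl], rule arg_cong[OF expand], rule pV) (use Y(2) in auto)
    also have "\<dots> = (\<Sum>y\<in>Y. \<Sum>e\<in>E. (p y \<bullet> e) *\<^sub>R L y x *\<^sub>R e)"
      by (simp add: scaleR_right.sum mult.commute)
    also have "\<dots> = (\<Sum>i\<in>Y \<times> E. (p (fst i) \<bullet> snd i) *\<^sub>R L (fst i) x *\<^sub>R snd i)"
      by (simp add: sum.cartesian_product case_prod_unfold)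
    finally show "p x = (\<Sum>i\<in>Y \<times> E. (p (fst i) \<bullet> snd i) *\<^sub>R L (fst i) x *\<^sub>R snd i)" .
  qed (use Y finE in auto)
qed

section \<open>Time derivatives of functionals of polynomials\<close>

text \<open>
  Linearity includes that the value only depends on the restriction to \<open>S\<close>, because members of
  \<^const>\<open>Pk\<close> are arbitrary elsewhere and time derivatives are only controlled on \<open>S\<close>.
\<close>

definition fun_linear :: "('x \<Rightarrow> 'b::real_vector) set \<Rightarrow> 'x set \<Rightarrow> (('x \<Rightarrow> 'b) \<Rightarrow> real) \<Rightarrow> bool" where
  "fun_linear P S l \<longleftrightarrow> (\<forall>a b. \<forall>p\<in>P. \<forall>q\<in>P. \<forall>r\<in>P.
     (\<forall>x\<in>S. r x = a *\<^sub>R p x + b *\<^sub>R q x) \<longrightarrow> l r = a * l p + b * l q)"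

lemma fun_linearD:
  "fun_linear P S l \<Longrightarrow> p \<in> P \<Longrightarrow> q \<in> P \<Longrightarrow> r \<in> P \<Longrightarrow> (\<And>x. x \<in> S \<Longrightarrow> r x = a *\<^sub>R p x + b *\<^sub>R q x)
    \<Longrightarrow> l r = a * l p + b * l q"
  unfolding fun_linear_def by blast

lemma fun_linear_sum:
  assumes V: "subspace V" and l: "fun_linear (Pk k S V) S l"
    and I: "finite I" and \<phi>: "\<And>i. i \<in> I \<Longrightarrow> \<phi> i \<in> Pk k S V" and r: "r \<in> Pk k S V"
    and eq: "\<And>x. x \<in> S \<Longrightarrow> r x = (\<Sum>i\<in>I. c i *\<^sub>R \<phi> i x)"
  shows "l r = (\<Sum>i\<in>I. c i * l (\<phi> i))"
  using I \<phi> r eq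
proof (induction arbitrary: r)
  case empty
  then have "l r = 0 * l r + 0 * l r" by (intro fun_linearD[OF l]) auto
  then show ?case by simp
next
  case (insert i I)
  define q where "q x = (\<Sum>i\<in>I. c i *\<^sub>R \<phi> i x)" for x
  have q: "q \<in> Pk k S V" unfolding q_def using insert by (intro Pk_sum V) auto
  have "l r = c i * l (\<phi> i) + 1 * l q"
    using insert.prems insert.hyps by (intro fun_linearD[OF l _ q]) (auto simp: q_def)
  also have "l q = (\<Sum>i\<in>I. c i * l (\<phi> i))" using insert.prems by (intro insert.IH q) (auto simp: q_def)
  finally show ?case using insert by simp
qed

lemma at_within_Ici_nontrivial: "t \<ge> 0 \<Longrightarrow> at t within {0::real..} \<noteq> bot"
  using at_le[of "{t<..}" "{0..}" t] trivial_limit_at_right_real[of t]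
  by (force simp: bot_unique)

text \<open>
  A curve of polynomials that is differentiable at each point of \<open>S\<close> has differentiable
  coordinates, since these are point values: so its derivative is again such a polynomial, and
  linear functionals may be differentiated under their sign.
\<close>

lemma Pk_curve_derivative:
  fixes V :: "'b::euclidean_space set"
  assumes V: "subspace V" and p: "\<And>r. r \<ge> 0 \<Longrightarrow> p r \<in> Pk k S V" and t: "t \<ge> 0"
    and d: "\<And>x. x \<in> S \<Longrightarrow> ((\<lambda>r. p r x) has_vector_derivative p' x) (at t within {0..})"
  shows "p' \<in> Pk k S V"
    and "fun_linear (Pk k S V) S l \<Longrightarrow>
           ((\<lambda>r. l (p r)) has_real_derivative l p') (at t within {0..})"
proof -
  from Pk_coordinates[OF V, of S k] obtain I :: "((real^3) \<times> 'b) set" and \<phi> where I: "finite I"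
    and node_all: "\<forall>i\<in>I. fst i \<in> S" and \<phi>_all: "\<forall>i\<in>I. \<phi> i \<in> Pk k S V"
    and repr_all: "\<forall>p\<in>Pk k S V. \<forall>x\<in>S. p x = (\<Sum>i\<in>I. (p (fst i) \<bullet> snd i) *\<^sub>R \<phi> i x)"
    by (elim exE conjE)
  note node = node_all[rule_format] and \<phi> = \<phi>_all[rule_format] and repr = repr_all[rule_format]
  have coord: "((\<lambda>r. p r (fst i) \<bullet> snd i) has_real_derivative p' (fst i) \<bullet> snd i) (at t within {0..})"
    if "i \<in> I" for i
    using bounded_linear.has_vector_derivative[OF bounded_linear_inner_left d[OF node[OF that]]]
    by (simp add: has_real_derivative_iff_has_vector_derivative)
  have p'_eq: "p' x = (\<Sum>i\<in>I. (p' (fst i) \<bullet> snd i) *\<^sub>R \<phi> i x)" if x: "x \<in> S" for x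
  proof -
    have "((\<lambda>r. \<Sum>i\<in>I. (p r (fst i) \<bullet> snd i) *\<^sub>R \<phi> i x) has_vector_derivative
        (\<Sum>i\<in>I. (p' (fst i) \<bullet> snd i) *\<^sub>R \<phi> i x)) (at t within {0..})"
      using coord by (intro has_vector_derivative_sum has_vector_derivative_scaleR[where g="\<lambda>_. \<phi> _ x" and g'=0, simplified]) auto
    then have "((\<lambda>r. p r x) has_vector_derivative (\<Sum>i\<in>I. (p' (fst i) \<bullet> snd i) *\<^sub>R \<phi> i x)) (at t within {0..})"
      by (rule has_vector_derivative_transform[OF _ _, rotated -1]) (use t repr p x in auto)
    then show ?thesis using d[OF x] t
      by (intro vector_derivative_unique_within[OF at_within_Ici_nontrivial])
  qed
  show p': "p' \<in> Pk k S V"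
    by (rule Pk_cong[OF Pk_sum[OF V \<phi>]]) (use p'_eq in auto)
  assume l: "fun_linear (Pk k S V) S l"
  have "((\<lambda>r. \<Sum>i\<in>I. (p r (fst i) \<bullet> snd i) * l (\<phi> i)) has_real_derivative
      (\<Sum>i\<in>I. (p' (fst i) \<bullet> snd i) * l (\<phi> i))) (at t within {0..})"
    using coord by (intro DERIV_sum DERIV_cmult_right) auto
  moreover have "l (p r) = (\<Sum>i\<in>I. (p r (fst i) \<bullet> snd i) * l (\<phi> i))" if "r \<ge> 0" for r
    using p[OF that] by (intro fun_linear_sum[OF V l I \<phi>] repr) auto
  moreover have "l p' = (\<Sum>i\<in>I. (p' (fst i) \<bullet> snd i) * l (\<phi> i))"
    using p' by (intro fun_linear_sum[OF V l I \<phi>] p'_eq) auto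
  ultimately show "((\<lambda>r. l (p r)) has_real_derivative l p') (at t within {0..})"
    using t by (auto intro: has_field_derivative_transform_within[where d=1])
qed

lemma Pk_curve_quadratic_derivative:
  fixes V :: "'b::euclidean_space set"
  assumes V: "subspace V" and p: "\<And>r. r \<ge> 0 \<Longrightarrow> p r \<in> Pk k S V" and t: "t \<ge> 0"
    and d: "\<And>x. x \<in> S \<Longrightarrow> ((\<lambda>r. p r x) has_vector_derivative p' x) (at t within {0..})"
    and lin: "\<And>g. g \<in> Pk k S V \<Longrightarrow> fun_linear (Pk k S V) S (\<lambda>f. b f g)"
    and sym: "\<And>f g. f \<in> Pk k S V \<Longrightarrow> g \<in> Pk k S V \<Longrightarrow> b f g = b g f"
  shows "((\<lambda>r. b (p r) (p r)) has_real_derivative 2 * b p' (p t)) (at t within {0..})"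
proof -
  from Pk_coordinates[OF V, of S k] obtain I :: "((real^3) \<times> 'b) set" and \<phi> where I: "finite I"
    and node_all: "\<forall>i\<in>I. fst i \<in> S" and \<phi>_all: "\<forall>i\<in>I. \<phi> i \<in> Pk k S V"
    and repr_all: "\<forall>p\<in>Pk k S V. \<forall>x\<in>S. p x = (\<Sum>i\<in>I. (p (fst i) \<bullet> snd i) *\<^sub>R \<phi> i x)"
    by (elim exE conjE)
  note node = node_all[rule_format] and \<phi> = \<phi>_all[rule_format] and repr = repr_all[rule_format]
  have p': "p' \<in> Pk k S V" using Pk_curve_derivative(1)[OF V p t d] .
  have expand: "b f g = (\<Sum>i\<in>I. (f (fst i) \<bullet> snd i) * b g (\<phi> i))"
    if f: "f \<in> Pk k S V" and g: "g \<in> Pk k S V" for f g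
  proof -
    have "b f g = (\<Sum>i\<in>I. (f (fst i) \<bullet> snd i) * b (\<phi> i) g)"
      using f g by (intro fun_linear_sum[OF V lin I \<phi>] repr) auto
    then show ?thesis using sym[OF \<phi> g] by simp
  qed
  have "((\<lambda>r. \<Sum>i\<in>I. (p r (fst i) \<bullet> snd i) * b (p r) (\<phi> i)) has_real_derivative
      (\<Sum>i\<in>I. (p' (fst i) \<bullet> snd i) * b (p t) (\<phi> i) + (p t (fst i) \<bullet> snd i) * b p' (\<phi> i))) (at t within {0..})"
  proof (intro DERIV_sum)
    fix i assume i: "i \<in> I"
    have "((\<lambda>r. p r (fst i) \<bullet> snd i) has_real_derivative p' (fst i) \<bullet> snd i) (at t within {0..})"
      using bounded_linear.has_vector_derivative[OF bounded_linear_inner_left d[OF node[OF i]]]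
      by (simp add: has_real_derivative_iff_has_vector_derivative)
    from DERIV_mult[OF this Pk_curve_derivative(2)[OF V p t d lin[OF \<phi>[OF i]]]]
    show "((\<lambda>r. (p r (fst i) \<bullet> snd i) * b (p r) (\<phi> i)) has_real_derivative
      (p' (fst i) \<bullet> snd i) * b (p t) (\<phi> i) + (p t (fst i) \<bullet> snd i) * b p' (\<phi> i)) (at t within {0..})"
      by (simp add: algebra_simps)
  qed
  moreover have "b (p r) (p r) = (\<Sum>i\<in>I. (p r (fst i) \<bullet> snd i) * b (p r) (\<phi> i))" if "r \<ge> 0" for r
    using that p by (intro expand) auto
  moreover have "2 * b p' (p t) =
      (\<Sum>i\<in>I. (p' (fst i) \<bullet> snd i) * b (p t) (\<phi> i) + (p t (fst i) \<bullet> snd i) * b p' (\<phi> i))"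
    using expand[OF p' p[OF t]] expand[OF p[OF t] p'] sym[OF p' p[OF t]] by (simp add: sum.distrib)
  ultimately show ?thesis
    using t by (auto intro: has_field_derivative_transform_within[where d=1])
qed

section \<open>Surface measure\<close>

lemma tri_param_measurable [measurable]: "tri_param a b c \<in> borel_measurable borel"
  unfolding tri_param_def case_prod_unfold
  by (intro borel_measurable_continuous_onI continuous_intros)

lemma closed_ref_triangle: "closed ref_triangle"
proof -
  have "ref_triangle = {p. 0 \<le> fst p} \<inter> {p. 0 \<le> snd p} \<inter> {p. fst p + snd p \<le> 1}"
    by (auto simp: ref_triangle_def)
  moreover have "closed \<dots>" by (intro closed_Int closed_Collect_le continuous_intros)
  ultimately show ?thesis by simp
qed

lemma ref_triangle_sets [measurable]: "ref_triangle \<in> sets borel"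
  using closed_ref_triangle by (rule borel_closed)

lemma ref_triangle_finite: "emeasure lborel ref_triangle < \<infinity>"
proof (rule emeasure_bounded_finite)
  have "ref_triangle \<subseteq> cbox (0, 0) (1, 1)" by (auto simp: ref_triangle_def)
  then show "bounded ref_triangle" by (rule bounded_subset[OF bounded_cbox])
qed

definition tri_borel :: "real^3 \<Rightarrow> real^3 \<Rightarrow> real^3 \<Rightarrow> (real^3) measure" where
  "tri_borel a b c = distr
     (density lborel (\<lambda>p. ennreal (norm (cross3 (b - a) (c - a))) * indicator ref_triangle p))
     borel (tri_param a b c)"

lemma tri_measure_eq: "tri_measure a b c = completion (tri_borel a b c)"
  by (simp add: tri_measure_def tri_borel_def)

lemma sets_tri_borel [simp]: "sets (tri_borel a b c) = sets borel"
  by (simp add: tri_borel_def)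

lemma nn_integral_tri_borel:
  assumes [measurable]: "f \<in> borel_measurable borel"
  shows "(\<integral>\<^sup>+x. f x \<partial>tri_borel a b c) =
    ennreal (norm (cross3 (b - a) (c - a))) *
      (\<integral>\<^sup>+p. indicator ref_triangle p * f (tri_param a b c p) \<partial>lborel)"
  unfolding tri_borel_def
  by (simp add: nn_integral_distr nn_integral_density mult.assoc nn_integral_cmult)

lemma finite_measure_tri_borel: "finite_measure (tri_borel a b c)"
proof (rule finite_measureI)
  have "emeasure (tri_borel a b c) (space (tri_borel a b c)) = (\<integral>\<^sup>+x. 1 \<partial>tri_borel a b c)" by simp
  also have "\<dots> = ennreal (norm (cross3 (b - a) (c - a))) * emeasure lborel ref_triangle"
    by (subst nn_integral_tri_borel) simp_all
  also have "\<dots> \<noteq> \<infinity>" using ref_triangle_finite by (simp add: ennreal_mult_eq_top_iff)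
  finally show "emeasure (tri_borel a b c) (space (tri_borel a b c)) \<noteq> \<infinity>" .
qed

lemma integral_tri_measure:
  fixes f :: "real^3 \<Rightarrow> real"
  assumes [measurable]: "f \<in> borel_measurable borel"
  shows "(LINT x|tri_measure a b c. f x) =
    norm (cross3 (b - a) (c - a)) * (LINT p:ref_triangle|lborel. f (tri_param a b c p))"
proof -
  have "(LINT x|tri_measure a b c. f x) = (LINT x|tri_borel a b c. f x)"
    unfolding tri_measure_eq by (rule integral_completion) (simp add: measurable_def[of "tri_borel a b c"] tri_borel_def)
  also have "\<dots> = (LINT p|density lborel (\<lambda>p. ennreal (norm (cross3 (b - a) (c - a)) * indicator ref_triangle p)). f (tri_param a b c p))"
    unfolding tri_borel_def by (subst integral_distr) (auto simp: ennreal_mult'' ennreal_indicator)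
  also have "\<dots> = (LINT p|lborel. (norm (cross3 (b - a) (c - a)) * indicator ref_triangle p) *\<^sub>R f (tri_param a b c p))"
    by (subst integral_density) auto
  finally show ?thesis by (simp add: set_lebesgue_integral_def mult.assoc)
qed

lemma nn_integral_plane:
  fixes g :: "real \<times> real \<Rightarrow> ennreal"
  assumes [measurable]: "g \<in> borel_measurable borel"
  shows "(\<integral>\<^sup>+p. g p \<partial>lborel) = (\<integral>\<^sup>+t. \<integral>\<^sup>+s. g (s, t) \<partial>lborel \<partial>lborel)"
    and "(\<integral>\<^sup>+p. g p \<partial>lborel) = (\<integral>\<^sup>+s. \<integral>\<^sup>+t. g (s, t) \<partial>lborel \<partial>lborel)"
proof -
  have m: "g \<in> borel_measurable (lborel \<Otimes>\<^sub>M lborel)" by (simp add: lborel_prod)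
  show "(\<integral>\<^sup>+p. g p \<partial>lborel) = (\<integral>\<^sup>+t. \<integral>\<^sup>+s. g (s, t) \<partial>lborel \<partial>lborel)"
    using lborel_pair.nn_integral_snd[OF m] by (simp add: lborel_prod)
  show "(\<integral>\<^sup>+p. g p \<partial>lborel) = (\<integral>\<^sup>+s. \<integral>\<^sup>+t. g (s, t) \<partial>lborel \<partial>lborel)"
    using lborel.nn_integral_fst[OF m] by (simp add: lborel_prod)
qed

lemma nn_integral_plane_swap:
  fixes g :: "real \<times> real \<Rightarrow> ennreal"
  assumes [measurable]: "g \<in> borel_measurable borel"
  shows "(\<integral>\<^sup>+p. g (snd p, fst p) \<partial>lborel) = (\<integral>\<^sup>+p. g p \<partial>lborel)"
proof -
  have [measurable]: "(\<lambda>p. g (snd p, fst p)) \<in> borel_measurable borel"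
    by (intro measurable_compose[OF _ assms] borel_measurable_continuous_onI continuous_intros)
  show ?thesis
    using nn_integral_plane(1)[of "\<lambda>p. g (snd p, fst p)"] nn_integral_plane(2)[of g] by simp
qed

lemma nn_integral_plane_reflect:
  fixes g :: "real \<times> real \<Rightarrow> ennreal"
  assumes [measurable]: "g \<in> borel_measurable borel"
  shows "(\<integral>\<^sup>+p. g (1 - fst p - snd p, snd p) \<partial>lborel) = (\<integral>\<^sup>+p. g p \<partial>lborel)"
proof -
  have [measurable]: "(\<lambda>p. g (1 - fst p - snd p, snd p)) \<in> borel_measurable borel"
    by (intro measurable_compose[OF _ assms] borel_measurable_continuous_onI continuous_intros)
  have [measurable]: "(\<lambda>s. g (s, t)) \<in> borel_measurable borel" for t
    by (intro measurable_compose[OF _ assms] borel_measurable_continuous_onI continuous_intros)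
  have "(\<integral>\<^sup>+s. g (1 - s - t, t) \<partial>lborel) = (\<integral>\<^sup>+s. g (s, t) \<partial>lborel)" for t
    using nn_integral_real_affine[of "\<lambda>s. g (s, t)" "-1" "1 - t"] by (simp add: algebra_simps)
  then show ?thesis
    using nn_integral_plane(1)[of "\<lambda>p. g (1 - fst p - snd p, snd p)"] nn_integral_plane(1)[of g] by simp
qed

text \<open>
  Reordering the vertices composes the parametrization with an area-preserving affine map \<open>\<psi>\<close> of
  the reference triangle onto itself. The two transpositions below generate all six reorderings.
\<close>

lemma tri_measure_reparametrize:
  assumes area: "\<And>g :: real \<times> real \<Rightarrow> ennreal. g \<in> borel_measurable borel \<Longrightarrow>
      (\<integral>\<^sup>+p. g (\<psi> p) \<partial>lborel) = (\<integral>\<^sup>+p. g p \<partial>lborel)"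
    and domain: "\<And>p. \<psi> p \<in> ref_triangle \<longleftrightarrow> p \<in> ref_triangle"
    and param: "\<And>p. tri_param a' b' c' p = tri_param a b c (\<psi> p)"
    and weight: "norm (cross3 (b' - a') (c' - a')) = norm (cross3 (b - a) (c - a))"
  shows "tri_measure a' b' c' = tri_measure a b c"
proof -
  have "tri_borel a' b' c' = tri_borel a b c"
  proof (rule measure_eqI)
    fix A assume "A \<in> sets (tri_borel a' b' c')"
    then have [measurable]: "A \<in> sets borel" by simp
    define g where "g p = indicator ref_triangle p * (indicator A (tri_param a b c p) :: ennreal)" for p
    have [measurable]: "g \<in> borel_measurable borel" unfolding g_def by measurable
    have "indicator ref_triangle p * indicator A (tri_param a' b' c' p) = g (\<psi> p)" for p
      by (simp add: g_def param domain indicator_def)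
    then have "emeasure (tri_borel a' b' c') A = ennreal (norm (cross3 (b - a) (c - a))) * (\<integral>\<^sup>+p. g (\<psi> p) \<partial>lborel)"
      using nn_integral_tri_borel[of "indicator A" a' b' c'] by (simp add: weight)
    also have "\<dots> = emeasure (tri_borel a b c) A"
      using nn_integral_tri_borel[of "indicator A" a b c] by (simp add: area flip: g_def)
    finally show "emeasure (tri_borel a' b' c') A = emeasure (tri_borel a b c) A" .
  qed simp
  then show ?thesis by (simp add: tri_measure_eq)
qed

lemma tri_measure_swap: "tri_measure a c b = tri_measure a b c"
proof (rule tri_measure_reparametrize[OF nn_integral_plane_swap])
  show "norm (cross3 (c - a) (b - a)) = norm (cross3 (b - a) (c - a))"
    by (metis cross_skew norm_minus_cancel)
qed (auto simp: ref_triangle_def tri_param_def case_prod_unfold algebra_simps)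

lemma tri_measure_reflect: "tri_measure b a c = tri_measure a b c"
proof (rule tri_measure_reparametrize[OF nn_integral_plane_reflect])
  have "cross3 (a - b) (c - b) = - cross3 (b - a) (c - a)" by (simp add: cross3_simps)
  then show "norm (cross3 (a - b) (c - b)) = norm (cross3 (b - a) (c - a))" by simp
qed (auto simp: ref_triangle_def tri_param_def case_prod_unfold algebra_simps)

lemma surface_measure_is_tri_measure: "\<exists>a b c. surface_measure F = tri_measure a b c"
  unfolding surface_measure_def Let_def case_prod_unfold by blast

text \<open>
  The vertices of a nondegenerate triangle are its extreme points, so the three points selected in
  the definition of the surface measure can only be a reordering of the given ones.
\<close>

lemma surface_measure_triangle:
  assumes ind: "\<not> affine_dependent {a, b, c}" and dist: "a \<noteq> b" "a \<noteq> c" "b \<noteq> c"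
  shows "surface_measure (convex hull {a, b, c}) = tri_measure a b c"
proof -
  define F where "F = convex hull {a, b, c}"
  define v where "v = (SOME (a, b, c). F = convex hull {a, b, c})"
  obtain a' b' c' where v: "v = (a', b', c')" by (cases v)
  have "case v of (a, b, c) \<Rightarrow> F = convex hull {a, b, c}"
    unfolding v_def by (rule someI[of _ "(a, b, c)"]) (simp add: F_def)
  then have hull: "convex hull {a, b, c} = convex hull {a', b', c'}" by (simp add: v F_def)
  have "{a, b, c} \<subseteq> {a', b', c'}"
  proof
    fix x assume "x \<in> {a, b, c}"
    then have "x extreme_point_of (convex hull {a', b', c'})"
      using extreme_point_of_convex_hull_affine_independent[OF ind] unfolding hull by blast
    then show "x \<in> {a', b', c'}" by (rule extreme_point_of_convex_hull)
  qed
  then have "tri_measure a' b' c' = tri_measure a b c"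
    using dist by (auto; metis tri_measure_swap tri_measure_reflect)
  then show ?thesis
    unfolding surface_measure_def F_def[symmetric] v_def[symmetric] by (simp add: v)
qed

lemma space_surface_measure [simp]: "space (surface_measure F) = UNIV"
  using surface_measure_is_tri_measure[of F] by (auto simp: tri_measure_eq tri_borel_def)

lemma borel_subset_surface_measure: "sets borel \<subseteq> sets (surface_measure F)"
proof -
  obtain a b c where "surface_measure F = tri_measure a b c"
    using surface_measure_is_tri_measure by blast
  then show ?thesis using sets_completionI_sets[of _ "tri_borel a b c"] by (auto simp: tri_measure_eq)
qed

lemma borel_measurable_surface_measure:
  "f \<in> measurable borel N \<Longrightarrow> f \<in> measurable (surface_measure F) N"
  using borel_subset_surface_measure[of F] by (auto simp: measurable_def)

lemma finite_measure_surface_measure: "finite_measure (surface_measure F)"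
proof -
  obtain a b c where "surface_measure F = tri_measure a b c"
    using surface_measure_is_tri_measure by blast
  then show ?thesis
    using finite_measure.emeasure_finite[OF finite_measure_tri_borel[of a b c], of UNIV]
    by (intro finite_measureI) (simp add: tri_measure_eq tri_borel_def)
qed

lemma complete_surface_measure: "complete_measure (surface_measure F)"
  using surface_measure_is_tri_measure[of F] completion.complete_measure_axioms
  by (auto simp: tri_measure_eq)

lemma set_integrable_surface_measure:
  fixes f :: "real^3 \<Rightarrow> 'b::{banach, second_countable_topology}"
  assumes F: "compact F" and f: "continuous_on F f" and S: "S \<in> sets borel" "S \<subseteq> F"
  shows "set_integrable (surface_measure F') S f"
proof -
  interpret finite_measure "surface_measure F'" by (rule finite_measure_surface_measure)
  have "(\<lambda>x. indicator F x *\<^sub>R f x) \<in> borel_measurable borel"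
    using F f by (intro borel_measurable_continuous_on_indicator) (auto simp: compact_imp_closed borel_closed)
  then have "(\<lambda>x. indicator S x *\<^sub>R (indicator F x *\<^sub>R f x)) \<in> borel_measurable borel"
    using S(1) by measurable
  then have m: "(\<lambda>x. indicator S x *\<^sub>R f x) \<in> borel_measurable borel"
    by (rule measurable_cong[THEN iffD1, rotated]) (use S in \<open>auto split: split_indicator\<close>)
  have "bounded (f ` F)" by (intro compact_imp_bounded compact_continuous_image F f)
  then obtain B where "\<And>x. x \<in> F \<Longrightarrow> norm (f x) \<le> B" unfolding bounded_iff by auto
  then have "norm (indicator S x *\<^sub>R f x) \<le> \<bar>B\<bar>" for x
    using S(2) by (auto split: split_indicator) (smt (verit) subsetD)
  then show ?thesis unfolding set_integrable_def
    by (intro integrable_const_bound[of _ "\<bar>B\<bar>"] borel_measurable_surface_measure m) auto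
qed

section \<open>The divergence theorem on a tetrahedron\<close>

definition ref_tet :: "(real^3) set" where
  "ref_tet = {x. 0 \<le> x$1 \<and> 0 \<le> x$2 \<and> 0 \<le> x$3 \<and> x$1 + x$2 + x$3 \<le> 1}"

definition tet_linear :: "real^3 \<Rightarrow> real^3 \<Rightarrow> real^3 \<Rightarrow> real^3 \<Rightarrow> real^3 \<Rightarrow> real^3" where
  "tet_linear p q r s x = x$1 *\<^sub>R (q - p) + x$2 *\<^sub>R (r - p) + x$3 *\<^sub>R (s - p)"

definition tet_param :: "real^3 \<Rightarrow> real^3 \<Rightarrow> real^3 \<Rightarrow> real^3 \<Rightarrow> real^3 \<Rightarrow> real^3" where
  "tet_param p q r s x = p + tet_linear p q r s x"

lemma linear_tet_linear: "linear (tet_linear p q r s)"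
  by (rule linearI) (simp_all add: tet_linear_def algebra_simps)

lemma tet_param_has_derivative: "(tet_param p q r s has_derivative tet_linear p q r s) (at x within S)"
proof -
  have "(tet_linear p q r s has_derivative tet_linear p q r s) (at x within S)"
    by (rule linear_imp_has_derivative[OF linear_tet_linear])
  then show ?thesis unfolding tet_param_def[abs_def] by (auto intro!: derivative_eq_intros)
qed

lemma continuous_on_tet_param: "continuous_on S (tet_param p q r s)"
  using tet_param_has_derivative by (intro continuous_at_imp_continuous_on ballI has_derivative_continuous)

lemma det_tet_linear: "det (matrix (tet_linear p q r s)) = cross3 (r - p) (s - p) \<bullet> (q - p)"
  by (simp add: det_3 matrix_def tet_linear_def axis_def cross3_simps)

lemma compact_ref_tet: "compact ref_tet"
proof -
  have "ref_tet = {x. 0 \<le> x$1} \<inter> {x. 0 \<le> x$2} \<inter> {x. 0 \<le> x$3} \<inter> {x. x$1 + x$2 + x$3 \<le> 1}"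
    by (auto simp: ref_tet_def)
  moreover have "closed \<dots>" by (intro closed_Int closed_Collect_le continuous_intros)
  moreover have "ref_tet \<subseteq> cbox 0 (\<chi> i. 1)"
  proof
    fix x :: "real^3" assume "x \<in> ref_tet"
    then have "0 \<le> x $ i \<and> x $ i \<le> 1" for i
      using exhaust_3[of i] by (auto simp: ref_tet_def)
    then show "x \<in> cbox 0 (\<chi> i. 1)" by (simp add: mem_box_cart)
  qed
  ultimately show ?thesis
    using bounded_subset[OF bounded_cbox] by (metis compact_eq_bounded_closed)
qed

locale tetrahedron =
  fixes p q r s :: "real^3"
  assumes indep: "\<not> affine_dependent {p, q, r, s}"
    and distinct: "distinct [p, q, r, s]"
begin

abbreviation "K \<equiv> convex hull {p, q, r, s}"

lemma tet_linear_eq_0: "tet_linear p q r s x = 0 \<Longrightarrow> x = 0"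
proof -
  assume eq: "tet_linear p q r s x = 0"
  define U where "U v = (if v = p then - x$1 - x$2 - x$3 else if v = q then x$1 else if v = r then x$2 else x$3)" for v
  have "sum U {p, q, r, s} = 0" "(\<Sum>v\<in>{p, q, r, s}. U v *\<^sub>R v) = 0"
    using distinct eq by (auto simp: U_def tet_linear_def algebra_simps)
  then have "\<forall>v\<in>{p, q, r, s}. U v = 0"
    using indep unfolding affine_dependent_explicit_finite[of "{p, q, r, s}", simplified] by blast
  then have "x$1 = 0" "x$2 = 0" "x$3 = 0" using distinct by (auto simp: U_def split: if_splits)
  then show "x = 0" by (simp add: vec_eq_iff forall_3)
qed

lemma inj_tet_linear: "inj (tet_linear p q r s)"
  unfolding linear_injective_0[OF linear_tet_linear] using tet_linear_eq_0 by simp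

lemma triple_nonzero: "cross3 (r - p) (s - p) \<bullet> (q - p) \<noteq> 0"
  unfolding det_tet_linear[symmetric] det_nz_iff_inj[OF linear_tet_linear] by (rule inj_tet_linear)

lemma K_parametrized: "K = tet_param p q r s ` ref_tet"
proof
  show "K \<subseteq> tet_param p q r s ` ref_tet"
  proof
    fix y assume "y \<in> K"
    then obtain u where u: "\<forall>v\<in>{p, q, r, s}. 0 \<le> u v" "sum u {p, q, r, s} = 1"
        "(\<Sum>v\<in>{p, q, r, s}. u v *\<^sub>R v) = y"
      using convex_hull_finite[of "{p, q, r, s}"] by auto
    have 1: "u p = 1 - u q - u r - u s" using u(2) distinct by auto
    have "y = tet_param p q r s (vector [u q, u r, u s])"
      using u(3) distinct by (auto simp: tet_param_def tet_linear_def 1 algebra_simps)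
    moreover have "vector [u q, u r, u s] \<in> ref_tet" using u(1) 1 by (simp add: ref_tet_def)
    ultimately show "y \<in> tet_param p q r s ` ref_tet" by blast
  qed
  show "tet_param p q r s ` ref_tet \<subseteq> K"
  proof clarify
    fix x assume x: "x \<in> ref_tet"
    define u where "u v = (if v = p then 1 - x$1 - x$2 - x$3 else if v = q then x$1 else if v = r then x$2 else x$3)" for v
    have "\<forall>v\<in>{p, q, r, s}. 0 \<le> u v" using x by (auto simp: u_def ref_tet_def)
    moreover have "sum u {p, q, r, s} = 1" "(\<Sum>v\<in>{p, q, r, s}. u v *\<^sub>R v) = tet_param p q r s x"
      using distinct by (auto simp: u_def tet_param_def tet_linear_def algebra_simps)
    ultimately show "tet_param p q r s x \<in> K"
      using convex_hull_finite[of "{p, q, r, s}"] by (simp del: sum.insert) (rule exI[of _ u], simp del: sum.insert)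
  qed
qed

text \<open>
  Affine change of variables. The constant is six times the volume of the tetrahedron.
\<close>

lemma integral_K_parametrized:
  fixes f :: "real^3 \<Rightarrow> real"
  assumes f: "continuous_on UNIV f"
  shows "(LINT x:K|lebesgue. f x) = \<bar>cross3 (r - p) (s - p) \<bullet> (q - p)\<bar> *
    (LINT x:ref_tet|lborel. f (tet_param p q r s x))"
proof -
  let ?c = "\<bar>cross3 (r - p) (s - p) \<bullet> (q - p)\<bar>" and ?g = "tet_param p q r s"
  have int: "set_integrable lebesgue S h" if "compact S" "continuous_on S h" for S and h :: "real^3 \<Rightarrow> real"
  proof -
    have "integrable lborel (\<lambda>x. indicator S x *\<^sub>R h x)"
      using borel_integrable_compact[OF that] .
    then show ?thesis
      unfolding set_integrable_def by (subst integrable_completion) auto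
  qed
  have cK: "compact K" by (simp add: finite_imp_compact_convex_hull)
  have fK: "set_integrable lebesgue K f"
    using f by (intro int cK continuous_on_subset[OF f]) auto
  have fg: "continuous_on ref_tet (\<lambda>x. f (?g x))"
    by (rule continuous_on_compose2[OF f continuous_on_tet_param]) auto
  have fR: "set_integrable lebesgue ref_tet (\<lambda>x. f (?g x))"
    using fg by (intro int compact_ref_tet)
  \<comment> \<open>The change of variables formula is applied to the integrand viewed as a map into \<open>real^1\<close>.\<close>
  have vec: "bounded_linear (vec :: real \<Rightarrow> real^1)"
    by (intro linear_conv_bounded_linear[THEN iffD1] linearI) (simp_all add: vec_eq_iff)
  have vK: "(\<lambda>x. vec (f x) :: real^1) absolutely_integrable_on (?g ` ref_tet)"
    using absolutely_integrable_linear[OF fK vec] by (simp add: o_def K_parametrized)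
  have inj: "inj_on ?g ref_tet"
    using inj_tet_linear by (auto simp: inj_on_def tet_param_def)
  have leb: "ref_tet \<in> sets lebesgue" using compact_ref_tet by (simp add: compact_imp_closed borel_closed)
  have "integral ref_tet (\<lambda>x. \<bar>det (matrix (tet_linear p q r s))\<bar> *\<^sub>R (vec (f (?g x)) :: real^1)) =
      integral (?g ` ref_tet) (\<lambda>x. vec (f x))"
    using has_absolute_integral_change_of_variables[OF leb tet_param_has_derivative inj, of "\<lambda>x. vec (f x) :: real^1"
        "integral (?g ` ref_tet) (\<lambda>x. vec (f x))"] vK by blast
  moreover have "integral (?g ` ref_tet) (\<lambda>x. vec (f x) :: real^1) = vec (integral K f)"
    using integral_linear[OF set_lebesgue_integral_eq_integral(1)[OF fK] vec] by (simp add: o_def K_parametrized)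
  moreover have "integral ref_tet (\<lambda>x. \<bar>det (matrix (tet_linear p q r s))\<bar> *\<^sub>R (vec (f (?g x)) :: real^1)) =
      ?c *\<^sub>R vec (integral ref_tet (\<lambda>x. f (?g x)))"
    using integral_linear[OF set_lebesgue_integral_eq_integral(1)[OF fR] vec] by (simp add: o_def det_tet_linear)
  ultimately have "integral K f = ?c * integral ref_tet (\<lambda>x. f (?g x))"
    by (simp add: vec_eq_iff)
  moreover have "(LINT x:ref_tet|lebesgue. f (?g x)) = (LINT x:ref_tet|lborel. f (?g x))"
    unfolding set_lebesgue_integral_def
    using borel_measurable_continuous_on_indicator[OF _ fg] compact_ref_tet
    by (intro integral_completion) (simp add: compact_imp_closed borel_closed)
  ultimately show ?thesis
    using set_lebesgue_integral_eq_integral(2)[OF fK] set_lebesgue_integral_eq_integral(2)[OF fR] by simp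
qed

end

text \<open>The identification of \<open>real^3\<close> with a product, for Fubini's theorem.\<close>

definition vec_of_pair :: "(real \<times> real) \<times> real \<Rightarrow> real^3" where
  "vec_of_pair z = vector [snd z, fst (fst z), snd (fst z)]"

lemma vec_of_pair_nth [simp]:
  "vec_of_pair z $ 1 = snd z" "vec_of_pair z $ 2 = fst (fst z)" "vec_of_pair z $ 3 = snd (fst z)"
  by (simp_all add: vec_of_pair_def)

lemma continuous_vec_of_pair: "continuous_on UNIV vec_of_pair"
proof -
  have "continuous_on UNIV (\<lambda>z :: (real \<times> real) \<times> real. snd z)"
    "continuous_on UNIV (\<lambda>z :: (real \<times> real) \<times> real. fst (fst z))"
    "continuous_on UNIV (\<lambda>z :: (real \<times> real) \<times> real. snd (fst z))"
    by (intro continuous_intros)+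
  then have "continuous_on UNIV (\<lambda>z. vec_of_pair z $ i)" for i
    using exhaust_3[of i] by auto
  then have "continuous_on UNIV (\<lambda>z. \<chi> i. vec_of_pair z $ i)" by (intro continuous_on_vec_lambda)
  then show ?thesis by simp
qed

lemma prod_Basis_cart: "(\<Prod>b\<in>Basis. f b) = (\<Prod>i\<in>UNIV. f (axis i 1 :: real^'n))"
proof -
  have B: "(Basis :: (real^'n) set) = range (\<lambda>i. axis i 1)"
    by (auto simp: Basis_vec_def)
  have "inj (\<lambda>i. axis i 1 :: real^'n)" by (auto simp: inj_on_def axis_eq_axis)
  from prod.reindex[OF this, of f] show ?thesis unfolding B by (simp add: o_def)
qed

lemma lborel_vec_of_pair: "distr lborel borel vec_of_pair = (lborel :: (real^3) measure)"
proof (rule sym, rule lborel_eqI)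
  have [measurable]: "vec_of_pair \<in> borel_measurable borel"
    by (intro borel_measurable_continuous_onI continuous_vec_of_pair)
  fix l u :: "real^3" assume le': "\<And>b. b \<in> Basis \<Longrightarrow> l \<bullet> b \<le> u \<bullet> b"
  have le: "l $ i \<le> u $ i" for i
    using le'[of "axis i 1"] by (simp add: axis_in_Basis_iff flip: cart_eq_inner_axis)
  have "vec_of_pair -` box l u = ({l$2<..<u$2} \<times> {l$3<..<u$3}) \<times> {l$1<..<u$1}"
    by (auto simp: mem_box_cart forall_3)
  then have "emeasure (distr lborel borel vec_of_pair) (box l u) =
      emeasure ((lborel \<Otimes>\<^sub>M lborel) \<Otimes>\<^sub>M lborel) (({l$2<..<u$2} \<times> {l$3<..<u$3}) \<times> {l$1<..<u$1})"
    by (simp add: emeasure_distr lborel_prod)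
  also have "\<dots> = emeasure lborel {l$2<..<u$2} * emeasure lborel {l$3<..<u$3} * emeasure lborel {l$1<..<u$1}"
    by (simp add: lborel_prod lborel.emeasure_pair_measure_Times del: emeasure_lborel_Ioo flip: lborel_prod)
  also have "\<dots> = ennreal (\<Prod>b\<in>Basis. (u - l) \<bullet> b)"
  proof -
    have "(\<Prod>b\<in>Basis. (u - l) \<bullet> b) = (u$2 - l$2) * (u$3 - l$3) * (u$1 - l$1)"
      unfolding prod_Basis_cart UNIV_3 by (simp add: inner_axis)
    moreover have "ennreal ((u$2 - l$2) * (u$3 - l$3) * (u$1 - l$1)) =
        ennreal (u$2 - l$2) * ennreal (u$3 - l$3) * ennreal (u$1 - l$1)"
      using le[of 1] le[of 2] le[of 3] by (subst ennreal_mult; simp)+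
    ultimately show ?thesis by (simp only: emeasure_lborel_Ioo[OF le])
  qed
  finally show "emeasure (distr lborel borel vec_of_pair) (box l u) = (\<Prod>b\<in>Basis. (u - l) \<bullet> b)" .
qed simp

lemma integral_ref_tet:
  fixes G :: "real^3 \<Rightarrow> real"
  assumes G: "continuous_on UNIV G"
  shows "(LINT x:ref_tet|lborel. G x) =
    (LINT z:ref_triangle|lborel. LINT a:{0..1 - fst z - snd z}|lborel. G (vec_of_pair (z, a)))"
proof -
  define g where "g x = indicator ref_tet x * G x" for x
  have v [measurable]: "vec_of_pair \<in> borel_measurable borel"
    by (intro borel_measurable_continuous_onI continuous_vec_of_pair)
  have g: "integrable lborel g"
    using borel_integrable_compact[OF compact_ref_tet continuous_on_subset[OF G]]
    by (simp add: g_def[abs_def])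
  then have gm: "g \<in> borel_measurable borel" by auto
  have "integrable (distr lborel borel vec_of_pair) g" using g by (simp add: lborel_vec_of_pair)
  then have i: "integrable (lborel \<Otimes>\<^sub>M lborel) (\<lambda>z. g (vec_of_pair z))"
    using gm by (subst (asm) integrable_distr_eq) (auto simp: lborel_prod)
  have "(LINT x:ref_tet|lborel. G x) = (LINT x|distr lborel borel vec_of_pair. g x)"
    by (simp add: set_lebesgue_integral_def g_def lborel_vec_of_pair)
  also have "\<dots> = (LINT z|(lborel \<Otimes>\<^sub>M lborel). g (vec_of_pair z))"
    using gm by (subst integral_distr) (auto simp: lborel_prod)
  also have "\<dots> = (LINT z|lborel. LINT a|lborel. g (vec_of_pair (z, a)))"
    by (rule lborel_pair.integral_fst'[OF i, symmetric])
  also have "\<dots> = (LINT z:ref_triangle|lborel. LINT a:{0..1 - fst z - snd z}|lborel. G (vec_of_pair (z, a)))"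
  proof -
    have "g (vec_of_pair (z, a)) = indicator ref_triangle z * (indicator {0..1 - fst z - snd z} a * G (vec_of_pair (z, a)))" for z a
      by (cases z) (auto simp: g_def ref_tet_def ref_triangle_def split: split_indicator)
    then show ?thesis by (simp add: set_lebesgue_integral_def)
  qed
  finally show ?thesis .
qed

text \<open>
  The segments parallel to the edge from \<open>p\<close> to \<open>q\<close> start on the face opposite to \<open>q\<close> and end on
  the face opposite to \<open>p\<close>; both faces are parametrized over the same reference triangle.
\<close>

lemma (in tetrahedron) integral_edge_derivative:
  fixes f :: "real^3 \<Rightarrow> real"
  assumes f: "\<And>x. (f has_derivative D x) (at x)" and D: "\<And>v. continuous_on UNIV (\<lambda>x. D x v)"
  shows "(LINT x:K|lebesgue. D x (q - p)) = \<bar>cross3 (r - p) (s - p) \<bullet> (q - p)\<bar> *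
    (LINT z:ref_triangle|lborel. f (tri_param q r s z) - f (tri_param p r s z))"
proof -
  let ?g = "tet_param p q r s"
  have cont: "continuous_on UNIV (\<lambda>x. D (?g x) (q - p))"
    by (rule continuous_on_compose2[OF D continuous_on_tet_param]) auto
  have inner: "(LINT a:{0..1 - fst z - snd z}|lborel. D (?g (vec_of_pair (z, a))) (q - p)) =
      f (tri_param q r s z) - f (tri_param p r s z)" if z: "z \<in> ref_triangle" for z
  proof -
    define e where "e = 1 - fst z - snd z"
    define h where "h a = p + fst z *\<^sub>R (r - p) + snd z *\<^sub>R (s - p) + a *\<^sub>R (q - p)" for a
    have gh: "?g (vec_of_pair (z, a)) = h a" for a
      by (simp add: tet_param_def tet_linear_def h_def algebra_simps)
    have e: "0 \<le> e" using z by (auto simp: e_def ref_triangle_def)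
    have "(h has_vector_derivative q - p) (at a within {0..e})" for a
      unfolding h_def by (auto intro!: derivative_eq_intros)
    then have "((\<lambda>a. f (h a)) has_vector_derivative D (h a) (q - p)) (at a within {0..e})" for a
      using vector_derivative_diff_chain_within[of h "q - p" a "{0..e}" f "D (h a)"] has_derivative_at_withinI[OF f]
      by (simp add: o_def)
    moreover have "continuous_on {0..e} (\<lambda>a. D (h a) (q - p))"
      by (rule continuous_on_compose2[OF D]) (auto simp: h_def intro!: continuous_intros)
    ultimately have "integral\<^sup>L lborel (\<lambda>a. indicator {0..e} a *\<^sub>R D (h a) (q - p)) = f (h e) - f (h 0)"
      by (intro integral_FTC_atLeastAtMost e)
    moreover have "h e = tri_param q r s z" "h 0 = tri_param p r s z"
      by (cases z; simp add: h_def e_def tri_param_def algebra_simps)+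
    ultimately show ?thesis unfolding gh e_def[symmetric] by (simp add: set_lebesgue_integral_def)
  qed
  have "(LINT x:K|lebesgue. D x (q - p)) = \<bar>cross3 (r - p) (s - p) \<bullet> (q - p)\<bar> *
    (LINT x:ref_tet|lborel. D (?g x) (q - p))" by (rule integral_K_parametrized[OF D])
  also have "(LINT x:ref_tet|lborel. D (?g x) (q - p)) =
    (LINT z:ref_triangle|lborel. LINT a:{0..1 - fst z - snd z}|lborel. D (?g (vec_of_pair (z, a))) (q - p))"
    by (rule integral_ref_tet[OF cont])
  also have "\<dots> = (LINT z:ref_triangle|lborel. f (tri_param q r s z) - f (tri_param p r s z))"
    by (rule set_lebesgue_integral_cong) (auto simp: inner)
  finally show ?thesis .
qed

lemma cross3_along_normal:
  fixes n u v :: "real^3"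
  assumes n: "norm n = 1" and u: "n \<bullet> u = 0" and v: "n \<bullet> v = 0"
  shows "cross3 u v = (cross3 u v \<bullet> n) *\<^sub>R n" and "\<bar>cross3 u v \<bullet> n\<bar> = norm (cross3 u v)"
proof -
  let ?c = "cross3 u v"
  have "cross3 n ?c = 0" using Lagrange[of n u v] u v by simp
  then have sq: "(?c \<bullet> n)\<^sup>2 = (norm ?c)\<^sup>2"
    using norm_cross_dot[of n ?c] n by (simp add: inner_commute)
  then show "\<bar>?c \<bullet> n\<bar> = norm ?c" using sq by (metis abs_norm_cancel real_sqrt_abs)
  have "(w - a *\<^sub>R n) \<bullet> (w - a *\<^sub>R n) = (norm w)\<^sup>2 - 2 * a * (w \<bullet> n) + a\<^sup>2 * (norm n)\<^sup>2" for w a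
    unfolding power2_norm_eq_inner
    by (simp add: inner_diff_left inner_diff_right inner_commute power2_eq_square algebra_simps)
  then have "(?c - (?c \<bullet> n) *\<^sub>R n) \<bullet> (?c - (?c \<bullet> n) *\<^sub>R n) = (norm ?c)\<^sup>2 - (?c \<bullet> n)\<^sup>2"
    by (simp only: n) (simp add: power2_eq_square)
  then have "?c - (?c \<bullet> n) *\<^sub>R n = 0" by (simp only: sq diff_self inner_eq_zero_iff)
  then show "?c = (?c \<bullet> n) *\<^sub>R n" by simp
qed

context tetrahedron begin

lemma triple_opposite: "cross3 (r - q) (s - q) \<bullet> (q - p) = cross3 (r - p) (s - p) \<bullet> (q - p)"
  by (simp add: cross3_simps)

text \<open>
  The outward normal on the face opposite to \<open>p\<close>: the defining inequality, applied on the face in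
  both directions, forces a normal to be orthogonal to the face, hence a multiple of the cross
  product, and the vertex \<open>p\<close> fixes its sign. The last conclusion is base times height, computed in
  two ways.
\<close>

lemma normal_opposite:
  defines "N \<equiv> normal K (convex hull {q, r, s})"
  shows "N \<bullet> (r - q) = 0" and "N \<bullet> (s - q) = 0"
    and "(N \<bullet> (q - p)) * norm (cross3 (r - q) (s - q)) = \<bar>cross3 (r - p) (s - p) \<bullet> (q - p)\<bar>"
proof -
  define c where "c = cross3 (r - q) (s - q)"
  define d where "d = c \<bullet> (q - p)"
  have d0: "d \<noteq> 0" using triple_nonzero triple_opposite by (simp add: d_def c_def)
  then have c0: "c \<noteq> 0" by (auto simp: d_def)
  define P where "P n \<longleftrightarrow> norm n = 1 \<and> (\<forall>x\<in>convex hull {q, r, s}. \<forall>y\<in>K. n \<bullet> (y - x) \<le> 0)" for n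
  have P_imp: "n \<bullet> (r - q) = 0 \<and> n \<bullet> (s - q) = 0 \<and> 0 < n \<bullet> (q - p) \<and> n = (1 / (sgn d * norm c)) *\<^sub>R c
      \<and> norm n = 1" if "P n" for n
  proof -
    have n1: "norm n = 1" and le: "\<And>x y. x \<in> convex hull {q, r, s} \<Longrightarrow> y \<in> K \<Longrightarrow> n \<bullet> (y - x) \<le> 0"
      using that by (auto simp: P_def)
    have "q \<in> convex hull {q, r, s}" "r \<in> convex hull {q, r, s}" "s \<in> convex hull {q, r, s}"
      "p \<in> K" "q \<in> K" "r \<in> K" "s \<in> K" by (auto intro: hull_inc)
    note v = this
    have 1: "n \<bullet> (r - q) = 0" "n \<bullet> (s - q) = 0" "0 \<le> n \<bullet> (q - p)"
      using le[OF v(1) v(6)] le[OF v(2) v(5)] le[OF v(1) v(7)] le[OF v(3) v(5)] le[OF v(1) v(4)]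
      by (auto simp: inner_diff_right)
    note par = cross3_along_normal[OF n1 1(1,2), folded c_def]
    have dn: "d = (c \<bullet> n) * (n \<bullet> (q - p))" using arg_cong[OF par(1), of "\<lambda>z. z \<bullet> (q - p)"] by (simp add: d_def)
    then have pos: "0 < n \<bullet> (q - p)" using 1(3) d0 by (cases "n \<bullet> (q - p) = 0") auto
    have "sgn d = sgn (c \<bullet> n)" using dn pos by (simp add: sgn_mult)
    then have cn: "c \<bullet> n = sgn d * norm c" by (simp only: par(2)[symmetric] sgn_mult_abs)
    then have "c = (sgn d * norm c) *\<^sub>R n" using par(1) by simp
    then have "(1 / (sgn d * norm c)) *\<^sub>R c = (1 / (sgn d * norm c)) *\<^sub>R ((sgn d * norm c) *\<^sub>R n)"
      by (rule arg_cong)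
    also have "\<dots> = n" using d0 c0 by (simp add: sgn_zero_iff)
    finally show ?thesis using 1 pos n1 by simp
  qed
  have "P ((1 / (sgn d * norm c)) *\<^sub>R c)"
  proof -
    define n where "n = (1 / (sgn d * norm c)) *\<^sub>R c"
    have n: "norm n = 1" using d0 c0 by (simp add: n_def abs_sgn_eq abs_mult)
    have z: "n \<bullet> (r - q) = 0" "n \<bullet> (s - q) = 0"
      by (simp_all add: n_def c_def dot_cross_self)
    have "n \<bullet> (q - p) = \<bar>d\<bar> / norm c" using d0
      by (simp add: n_def flip: d_def) (simp add: sgn_if field_simps)
    then have p: "n \<bullet> (q - p) \<ge> 0" by simp
    have "K \<subseteq> {y. n \<bullet> y \<le> n \<bullet> q}"
      using z p by (intro hull_minimal) (auto simp: convex_halfspace_le inner_diff_right)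
    moreover have "convex hull {q, r, s} \<subseteq> {x. n \<bullet> x = n \<bullet> q}"
      using z by (intro hull_minimal) (auto simp: convex_hyperplane inner_diff_right)
    ultimately show ?thesis using n unfolding P_def n_def[symmetric]
      by (fastforce simp: inner_diff_right)
  qed
  then have "\<exists>!n. P n" using P_imp by blast
  then have "P N" unfolding N_def normal_def P_def by (rule theI')
  note N = P_imp[OF this]
  show "N \<bullet> (r - q) = 0" "N \<bullet> (s - q) = 0" using N by auto
  have N': "norm N = 1" "N \<bullet> (r - q) = 0" "N \<bullet> (s - q) = 0" "0 < N \<bullet> (q - p)" using N by auto
  note par = cross3_along_normal[OF N'(1-3), folded c_def]
  have "\<bar>d\<bar> = \<bar>c \<bullet> N\<bar> * (N \<bullet> (q - p))"
    using arg_cong[OF par(1), of "\<lambda>z. z \<bullet> (q - p)"] N'(4) by (simp add: d_def abs_mult)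
  then show "(N \<bullet> (q - p)) * norm (cross3 (r - q) (s - q)) = \<bar>cross3 (r - p) (s - p) \<bullet> (q - p)\<bar>"
    using par(2) triple_opposite by (simp add: d_def c_def)
qed

end

lemma tetrahedron_swap01: "tetrahedron p q r s \<Longrightarrow> tetrahedron q p r s"
  unfolding tetrahedron_def by (auto simp: insert_commute)

lemma tetrahedron_swap12: "tetrahedron p q r s \<Longrightarrow> tetrahedron p r q s"
  unfolding tetrahedron_def by (auto simp: insert_commute)

lemma tetrahedron_swap23: "tetrahedron p q r s \<Longrightarrow> tetrahedron p q s r"
  unfolding tetrahedron_def by (auto simp: insert_commute)

lemma surface_integral_triangle:
  fixes f :: "real^3 \<Rightarrow> real"
  assumes ind: "\<not> affine_dependent {a, b, c}" and dist: "distinct [a, b, c]" and f: "continuous_on UNIV f"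
  shows "(LINT x:convex hull {a, b, c}|surface_measure (convex hull {a, b, c}). f x) =
    norm (cross3 (b - a) (c - a)) * (LINT z:ref_triangle|lborel. f (tri_param a b c z))"
proof -
  let ?F = "convex hull {a, b, c}"
  have sm: "surface_measure ?F = tri_measure a b c"
    using surface_measure_triangle[OF ind] dist by simp
  have "closed ?F" by (simp add: compact_imp_closed finite_imp_compact_convex_hull)
  then have m: "(\<lambda>x. indicator ?F x * f x) \<in> borel_measurable borel"
    using borel_measurable_continuous_on_indicator[of ?F f] continuous_on_subset[OF f]
    by (simp add: borel_closed)
  have in_hull: "tri_param a b c z \<in> ?F" if "z \<in> ref_triangle" for z
  proof -
    have eq: "tri_param a b c z = (1 - fst z - snd z) *\<^sub>R a + fst z *\<^sub>R b + snd z *\<^sub>R c"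
      by (cases z) (simp add: tri_param_def algebra_simps)
    show ?thesis unfolding convex_hull_3 eq mem_Collect_eq
      using that by (intro exI conjI refl) (auto simp: ref_triangle_def)
  qed
  have "(LINT x:?F|surface_measure ?F. f x) =
    norm (cross3 (b - a) (c - a)) * (LINT z:ref_triangle|lborel. indicator ?F (tri_param a b c z) * f (tri_param a b c z))"
    unfolding sm using integral_tri_measure[OF m] by (simp add: set_lebesgue_integral_def)
  also have "(LINT z:ref_triangle|lborel. indicator ?F (tri_param a b c z) * f (tri_param a b c z)) =
    (LINT z:ref_triangle|lborel. f (tri_param a b c z))"
    by (rule set_lebesgue_integral_cong) (auto simp: in_hull)
  finally show ?thesis .
qed

context tetrahedron begin

lemma sum_elt_faces:
  "(\<Sum>F\<in>elt_faces K. g F) = g (convex hull {q, r, s}) + g (convex hull {p, r, s})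
     + g (convex hull {p, q, s}) + g (convex hull {p, q, r})"
proof -
  let ?V = "{p, q, r, s}"
  have ne: "convex hull (?V - {u}) \<noteq> {}" for u
    using distinct by (cases "u = p") (auto simp: convex_hull_eq_empty)
  have "elt_faces K = (\<lambda>u. convex hull (?V - {u})) ` ?V"
    unfolding elt_faces_def facet_of_convex_hull_affine_independent[OF indep]
    using ne by blast
  moreover have "inj_on (\<lambda>u. convex hull (?V - {u})) ?V"
  proof (rule inj_onI, rule ccontr)
    fix u v assume uv: "u \<in> ?V" "v \<in> ?V" "convex hull (?V - {u}) = convex hull (?V - {v})" "u \<noteq> v"
    then have "u \<in> convex hull (?V - {v})" by (intro hull_inc) auto
    then have "u \<in> affine hull (?V - {u})"
      using uv(3) convex_hull_subset_affine_hull by blast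
    then show False using indep uv(1) unfolding affine_dependent_def by blast
  qed
  ultimately have "(\<Sum>F\<in>elt_faces K. g F) = (\<Sum>u\<in>?V. g (convex hull (?V - {u})))"
    by (simp only: sum.reindex o_def)
  also have "?V - {p} = {q, r, s}" "?V - {q} = {p, r, s}" "?V - {r} = {p, q, s}" "?V - {s} = {p, q, r}"
    using distinct by auto
  then have "(\<Sum>u\<in>?V. g (convex hull (?V - {u}))) = g (convex hull {q, r, s}) + g (convex hull {p, r, s})
     + g (convex hull {p, q, s}) + g (convex hull {p, q, r})"
    using distinct by (simp add: add.assoc)
  finally show ?thesis .
qed

lemma indep_opposite: "\<not> affine_dependent {q, r, s}"
  using indep affine_dependent_subset[of "{q, r, s}" "{p, q, r, s}"] by blast

text \<open>
  The two faces containing the edge contribute nothing, as their normals are orthogonal to it. On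
  the other two, area times normal component is plus or minus the same determinant, which matches
  the difference of integrals produced by the fundamental theorem of calculus.
\<close>

lemma gauss_edge:
  fixes f :: "real^3 \<Rightarrow> real"
  assumes f: "\<And>x. (f has_derivative D x) (at x)" and D: "\<And>v. continuous_on UNIV (\<lambda>x. D x v)"
  shows "(LINT x:K|lebesgue. D x (q - p)) =
    (\<Sum>F\<in>elt_faces K. (LINT x:F|surface_measure F. f x) * (normal K F \<bullet> (q - p)))"
proof -
  note T = tetrahedron_axioms
  have Tq: "tetrahedron q p r s" using T by (rule tetrahedron_swap01)
  have Tr: "tetrahedron r p q s" by (rule tetrahedron_swap01[OF tetrahedron_swap12[OF T]])
  have Ts: "tetrahedron s p q r" by (rule tetrahedron_swap01[OF tetrahedron_swap12[OF tetrahedron_swap23[OF T]]])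
  have Kq: "convex hull {q, p, r, s} = K" and Kr: "convex hull {r, p, q, s} = K"
    and Ks: "convex hull {s, p, q, r} = K" by (simp_all add: insert_commute)
  have cf: "continuous_on UNIV f"
    using f by (intro continuous_at_imp_continuous_on ballI has_derivative_continuous)
  let ?d = "\<bar>cross3 (r - p) (s - p) \<bullet> (q - p)\<bar>"
  let ?I = "\<lambda>a b c. LINT z:ref_triangle|lborel. f (tri_param a b c z)"
  have n1: "(normal K (convex hull {q, r, s}) \<bullet> (q - p)) * norm (cross3 (r - q) (s - q)) = ?d"
    by (rule normal_opposite)
  have n2: "(normal K (convex hull {p, r, s}) \<bullet> (q - p)) * norm (cross3 (r - p) (s - p)) = - ?d"
  proof -
    have "cross3 (r - q) (s - q) \<bullet> (p - q) = - (cross3 (r - p) (s - p) \<bullet> (q - p))"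
      by (simp add: cross3_simps)
    then show ?thesis
      using tetrahedron.normal_opposite(3)[OF Tq, unfolded Kq] by (simp add: inner_diff_right algebra_simps)
  qed
  have n3: "normal K (convex hull {p, q, s}) \<bullet> (q - p) = 0"
    using tetrahedron.normal_opposite(1)[OF Tr] unfolding Kr .
  have n4: "normal K (convex hull {p, q, r}) \<bullet> (q - p) = 0"
    using tetrahedron.normal_opposite(1)[OF Ts] unfolding Ks .
  have i1: "(LINT x:convex hull {q, r, s}|surface_measure (convex hull {q, r, s}). f x) =
      norm (cross3 (r - q) (s - q)) * ?I q r s"
    using distinct by (intro surface_integral_triangle indep_opposite cf) auto
  have i2: "(LINT x:convex hull {p, r, s}|surface_measure (convex hull {p, r, s}). f x) =
      norm (cross3 (r - p) (s - p)) * ?I p r s"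
    using distinct by (intro surface_integral_triangle tetrahedron.indep_opposite[OF Tq] cf) auto
  have int: "set_integrable lborel ref_triangle (\<lambda>z. f (tri_param a b c z))" for a b c
  proof -
    have "compact ref_triangle"
    proof -
      have "ref_triangle \<subseteq> cbox (0, 0) (1, 1)" by (auto simp: ref_triangle_def)
      then have "bounded ref_triangle" by (rule bounded_subset[OF bounded_cbox])
      then show ?thesis using closed_ref_triangle by (simp add: compact_eq_bounded_closed)
    qed
    moreover have "continuous_on ref_triangle (\<lambda>z. f (tri_param a b c z))"
      by (rule continuous_on_compose2[OF cf]) (auto simp: tri_param_def case_prod_unfold intro!: continuous_intros)
    ultimately show ?thesis unfolding set_integrable_def by (rule borel_integrable_compact)
  qed
  have "(LINT x:K|lebesgue. D x (q - p)) = ?d * (?I q r s - ?I p r s)"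
    unfolding integral_edge_derivative[OF f D] by (simp add: set_integral_diff int)
  also have "\<dots> = (norm (cross3 (r - q) (s - q)) * ?I q r s) * (normal K (convex hull {q, r, s}) \<bullet> (q - p))
      + (norm (cross3 (r - p) (s - p)) * ?I p r s) * (normal K (convex hull {p, r, s}) \<bullet> (q - p))"
    using arg_cong[OF n1, of "\<lambda>z. z * ?I q r s"] arg_cong[OF n2, of "\<lambda>z. z * ?I p r s"]
    by (simp add: algebra_simps)
  also have "\<dots> = (\<Sum>F\<in>elt_faces K. (LINT x:F|surface_measure F. f x) * (normal K F \<bullet> (q - p)))"
    unfolding sum_elt_faces by (simp add: i1 i2 n3 n4)
  finally show ?thesis .
qed

end

lemma simplex3_tetrahedron:
  fixes K :: "(real^3) set"
  assumes "3 simplex K"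
  obtains p q r s where "tetrahedron p q r s" "K = convex hull {p, q, r, s}"
proof -
  obtain C where C: "\<not> affine_dependent C" "int (card C) = 3 + 1" "K = convex hull C"
    using assms unfolding simplex_def by blast
  then have "card C = 4" by simp
  then obtain p q r s where "C = {p, q, r, s}" "distinct [p, q, r, s]"
    by (auto simp: numeral_eq_Suc card_Suc_eq)
  with C that show ?thesis unfolding tetrahedron_def by blast
qed

text \<open>Both sides are linear in the direction, and the three edges at one vertex span the space.\<close>

theorem gauss_simplex:
  fixes f :: "real^3 \<Rightarrow> real"
  assumes K: "3 simplex K"
    and f: "\<And>x. (f has_derivative D x) (at x)" and D: "\<And>v. continuous_on UNIV (\<lambda>x. D x v)"
  shows "(LINT x:K|lebesgue. D x d) = (\<Sum>F\<in>elt_faces K. (LINT x:F|surface_measure F. f x) * (normal K F \<bullet> d))"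
proof -
  obtain p q r s where T: "tetrahedron p q r s" and K: "K = convex hull {p, q, r, s}"
    using simplex3_tetrahedron[OF K] by blast
  define I where "I d = (LINT x:K|lebesgue. D x d)" for d
  define J where "J d = (\<Sum>F\<in>elt_faces K. (LINT x:F|surface_measure F. f x) * (normal K F \<bullet> d))" for d
  have cK: "compact K" by (simp add: K finite_imp_compact_convex_hull)
  have int: "set_integrable lebesgue K (\<lambda>x. D x d)" for d
  proof -
    have "integrable lborel (\<lambda>x. indicator K x *\<^sub>R D x d)"
      using borel_integrable_compact[OF cK continuous_on_subset[OF D]] by simp
    then show ?thesis
      unfolding set_integrable_def by (subst integrable_completion) auto
  qed
  have lin: "linear (D x)" for x using f by (rule has_derivative_linear)
  have I: "linear I" unfolding I_def
    by (intro linearI) (simp_all add: linear_add[OF lin] linear_scale[OF lin] set_integral_add int)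
  have J: "linear J" unfolding J_def
    by (intro linearI) (simp_all add: inner_add_right inner_scaleR_right algebra_simps sum.distrib sum_distrib_left)
  have 1: "I (q - p) = J (q - p)"
    unfolding I_def J_def K using T f D by (rule tetrahedron.gauss_edge)
  have K2: "K = convex hull {p, r, q, s}" by (simp add: K insert_commute)
  have 2: "I (r - p) = J (r - p)"
    unfolding I_def J_def K2 by (rule tetrahedron.gauss_edge[OF tetrahedron_swap12[OF T] f D])
  have K3: "K = convex hull {p, s, q, r}" by (simp add: K insert_commute)
  have 3: "I (s - p) = J (s - p)"
    unfolding I_def J_def K3
    by (rule tetrahedron.gauss_edge[OF tetrahedron_swap12[OF tetrahedron_swap23[OF T]] f D])
  have "surj (tet_linear p q r s)"
    using linear_injective_imp_surjective[OF linear_tet_linear tetrahedron.inj_tet_linear[OF T]] by simp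
  then obtain x where "d = tet_linear p q r s x" by blast
  then have "I d = J d"
    by (simp add: tet_linear_def linear_add[OF I] linear_add[OF J] linear_scale[OF I] linear_scale[OF J] 1 2 3)
  then show ?thesis by (simp add: I_def J_def)
qed

section \<open>Brackets on faces and the projection onto face polynomials\<close>

definition surf_inner :: "(real^3) set \<Rightarrow> (real^3) set \<Rightarrow> (real^3 \<Rightarrow> real^3) \<Rightarrow> (real^3 \<Rightarrow> real^3) \<Rightarrow> real" where
  "surf_inner F S u v = (LINT x:S|surface_measure F. u x \<bullet> v x)"

lemma surf_inner_commute: "surf_inner F S u v = surf_inner F S v u"
  by (simp add: surf_inner_def inner_commute)

lemma surf_inner_cong:
  "(\<And>x. x \<in> S \<Longrightarrow> u x = u' x) \<Longrightarrow> (\<And>x. x \<in> S \<Longrightarrow> v x = v' x) \<Longrightarrow> surf_inner F S u v = surf_inner F S u' v'"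
  unfolding surf_inner_def set_lebesgue_integral_def
  by (intro Bochner_Integration.integral_cong) (auto split: split_indicator)

lemma surf_inner_integrable:
  assumes "compact F" "S \<in> sets borel" "S \<subseteq> F" "continuous_on F u" "continuous_on F v"
  shows "set_integrable (surface_measure F') S (\<lambda>x. u x \<bullet> v x)"
  using assms by (intro set_integrable_surface_measure[of F] continuous_on_inner) auto

lemma surf_inner_lincomb:
  assumes "compact F" "S \<in> sets borel" "S \<subseteq> F" "continuous_on F u" "continuous_on F u'" "continuous_on F v"
  shows "surf_inner F S (\<lambda>x. a *\<^sub>R u x + b *\<^sub>R u' x) v = a * surf_inner F S u v + b * surf_inner F S u' v"
  using assms unfolding surf_inner_def
  by (simp add: inner_add_left set_integral_add surf_inner_integrable[of F])

lemma surf_inner_sum: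
  assumes "compact F" "S \<in> sets borel" "S \<subseteq> F" "\<And>i. i \<in> I \<Longrightarrow> continuous_on F (u i)" "continuous_on F v" "finite I"
  shows "surf_inner F S (\<lambda>x. \<Sum>i\<in>I. c i *\<^sub>R u i x) v = (\<Sum>i\<in>I. c i * surf_inner F S (u i) v)"
  using assms(6,4)
proof induction
  case empty
  show ?case by (simp add: surf_inner_def)
next
  case (insert i I)
  have "continuous_on F (\<lambda>x. \<Sum>i\<in>I. c i *\<^sub>R u i x)"
    using insert.prems by (intro continuous_intros) auto
  then have "surf_inner F S (\<lambda>x. c i *\<^sub>R u i x + 1 *\<^sub>R (\<Sum>i\<in>I. c i *\<^sub>R u i x)) v =
    c i * surf_inner F S (u i) v + 1 * surf_inner F S (\<lambda>x. \<Sum>i\<in>I. c i *\<^sub>R u i x) v"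
    using assms(1-3,5) insert.prems by (intro surf_inner_lincomb) auto
  with insert show ?case by simp
qed

lemma surf_inner_nonneg: "0 \<le> surf_inner F S u u"
  unfolding surf_inner_def set_lebesgue_integral_def by (intro integral_nonneg_AE) simp

lemma surf_inner_eq_0_AE:
  assumes "compact F" "S \<in> sets borel" "S \<subseteq> F" "continuous_on F u" "surf_inner F S u u = 0"
  shows "AE x in surface_measure F. x \<in> S \<longrightarrow> u x = 0"
proof -
  have "AE x in surface_measure F. indicator S x *\<^sub>R (u x \<bullet> u x) = 0"
    using assms surf_inner_integrable[OF assms(1-4,4), of F]
    unfolding surf_inner_def set_lebesgue_integral_def set_integrable_def
    by (subst (asm) integral_nonneg_eq_0_iff_AE) auto
  then show ?thesis by eventually_elim (auto split: split_indicator)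
qed

lemma surf_inner_AE_0:
  assumes "AE x in surface_measure F. x \<in> S \<longrightarrow> u x = 0"
  shows "surf_inner F S u v = 0"
  unfolding surf_inner_def set_lebesgue_integral_def
proof (rule integral_eq_zero_AE)
  show "AE x in surface_measure F. indicator S x *\<^sub>R (u x \<bullet> v x) = 0"
    using assms by eventually_elim auto
qed

lemma surf_inner_AE_cong:
  assumes "compact F" "S \<in> sets borel" "S \<subseteq> F" "continuous_on F u" "continuous_on F u'" "continuous_on F v"
    and "AE x in surface_measure F. x \<in> S \<longrightarrow> u x = u' x"
  shows "surf_inner F S u v = surf_inner F S u' v"
proof -
  have "surf_inner F S (\<lambda>x. 1 *\<^sub>R u x + (-1) *\<^sub>R u' x) v = 0"
    using assms(7) by (intro surf_inner_AE_0) (auto elim: eventually_mono)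
  then show ?thesis using surf_inner_lincomb[OF assms(1-6), where a=1 and b="-1"] by simp
qed

text \<open>
  Gram--Schmidt for a form that may be degenerate on the span of the \<open>\<phi> i\<close>. If the orthogonal
  part of a new vector has norm zero, it vanishes almost everywhere and is orthogonal to everything.
\<close>

lemma surf_orthogonal_part:
  assumes F: "compact F" "closed F" and I: "finite I" and \<phi>: "\<And>i. i \<in> I \<Longrightarrow> continuous_on F (\<phi> i)"
    and v: "continuous_on F v"
  shows "\<exists>c. \<forall>j\<in>I. surf_inner F F (\<lambda>x. v x - (\<Sum>i\<in>I. c i *\<^sub>R \<phi> i x)) (\<phi> j) = 0"
  using I \<phi> v
proof (induction I arbitrary: v)
  case empty
  show ?case by simp
next
  case (insert n I)
  have FF: "F \<in> sets borel" "F \<subseteq> F" using F(2) by auto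
  have cI: "\<And>i. i \<in> I \<Longrightarrow> continuous_on F (\<phi> i)" and cn: "continuous_on F (\<phi> n)" using insert.prems by auto
  obtain d where d: "\<forall>j\<in>I. surf_inner F F (\<lambda>x. \<phi> n x - (\<Sum>i\<in>I. d i *\<^sub>R \<phi> i x)) (\<phi> j) = 0"
    using insert.IH[OF cI cn] by blast
  obtain c where c: "\<forall>j\<in>I. surf_inner F F (\<lambda>x. v x - (\<Sum>i\<in>I. c i *\<^sub>R \<phi> i x)) (\<phi> j) = 0"
    using insert.IH[OF cI insert.prems(2)] by blast
  define \<psi> where "\<psi> x = \<phi> n x - (\<Sum>i\<in>I. d i *\<^sub>R \<phi> i x)" for x
  define r where "r x = v x - (\<Sum>i\<in>I. c i *\<^sub>R \<phi> i x)" for x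
  have c\<psi>: "continuous_on F \<psi>" and cr: "continuous_on F r"
    unfolding \<psi>_def r_def using cI cn insert.prems(2) by (auto intro!: continuous_intros)
  define e where "e = surf_inner F F r \<psi> / surf_inner F F \<psi> \<psi>"
  have split_n: "surf_inner F F w (\<phi> n) = surf_inner F F w \<psi> + (\<Sum>i\<in>I. d i * surf_inner F F w (\<phi> i))"
    if w: "continuous_on F w" for w
  proof -
    have cs: "continuous_on F (\<lambda>x. \<Sum>i\<in>I. d i *\<^sub>R \<phi> i x)" using cI by (auto intro!: continuous_intros)
    have "surf_inner F F (\<phi> n) w = surf_inner F F (\<lambda>x. 1 *\<^sub>R \<psi> x + 1 *\<^sub>R (\<Sum>i\<in>I. d i *\<^sub>R \<phi> i x)) w"
      by (rule surf_inner_cong) (auto simp: \<psi>_def)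
    also have "\<dots> = surf_inner F F \<psi> w + (\<Sum>i\<in>I. d i * surf_inner F F (\<phi> i) w)"
      using surf_inner_lincomb[OF F(1) FF c\<psi> cs w, where a=1 and b=1] surf_inner_sum[OF F(1) FF cI w insert.hyps(1), where c=d] by simp
    finally show ?thesis by (simp add: surf_inner_commute)
  qed
  define w where "w x = 1 *\<^sub>R r x + (- e) *\<^sub>R \<psi> x" for x
  have cw: "continuous_on F w" unfolding w_def using c\<psi> cr by (auto intro!: continuous_intros)
  have w_eq: "surf_inner F F w g = surf_inner F F r g - e * surf_inner F F \<psi> g" if "continuous_on F g" for g
    unfolding w_def using surf_inner_lincomb[OF F(1) FF cr c\<psi> that, where a=1 and b="- e"] by simp
  have wI: "surf_inner F F w (\<phi> j) = 0" if "j \<in> I" for j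
    using w_eq[OF cI[OF that]] c d that by (simp add: r_def[abs_def] \<psi>_def[abs_def])
  have "surf_inner F F w \<psi> = 0"
  proof (cases "surf_inner F F \<psi> \<psi> = 0")
    case True
    then have "surf_inner F F \<psi> r = 0"
      using surf_inner_AE_0[OF surf_inner_eq_0_AE[OF F(1) FF c\<psi>]] by simp
    with True show ?thesis using w_eq[OF c\<psi>] by (simp add: surf_inner_commute)
  next
    case False
    then show ?thesis using w_eq[OF c\<psi>] by (simp add: e_def)
  qed
  then have wn: "surf_inner F F w (\<phi> n) = 0" using split_n[OF cw] wI by simp
  have w_sum: "w x = v x - (\<Sum>i\<in>insert n I. ((\<lambda>i. c i - e * d i)(n := e)) i *\<^sub>R \<phi> i x)" for x
  proof -
    have "(\<Sum>i\<in>I. ((\<lambda>i. c i - e * d i)(n := e)) i *\<^sub>R \<phi> i x) = (\<Sum>i\<in>I. (c i - e * d i) *\<^sub>R \<phi> i x)"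
      using insert.hyps by (intro sum.cong) auto
    then show ?thesis using insert.hyps
      by (simp add: w_def r_def \<psi>_def scaleR_left_diff_distrib sum_subtractf scaleR_diff_right scaleR_sum_right sum_negf)
  qed
  then have "w = (\<lambda>x. v x - (\<Sum>i\<in>insert n I. ((\<lambda>i. c i - e * d i)(n := e)) i *\<^sub>R \<phi> i x))" ..
  with wI wn show ?case by (intro exI[of _ "(\<lambda>i. c i - e * d i)(n := e)"]) auto
qed

lemma face_projection_exists:
  assumes F: "compact F" and v: "continuous_on F v"
  shows "\<exists>w. w \<in> Pk k F (UNIV :: (real^3) set) \<and>
    (\<forall>\<mu>\<in>Pk k F UNIV. surf_inner F F w \<mu> = surf_inner F F v \<mu>)"
proof -
  have cF: "closed F" and FF: "F \<in> sets borel" "F \<subseteq> F" using F by (auto simp: compact_imp_closed borel_closed)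
  from Pk_coordinates[OF subspace_UNIV, of F k] obtain I :: "((real^3) \<times> (real^3)) set" and \<phi>
    where I: "finite I" and \<phi>_all: "\<forall>i\<in>I. \<phi> i \<in> Pk k F UNIV"
    and repr: "\<forall>p\<in>Pk k F UNIV. \<forall>x\<in>F. p x = (\<Sum>i\<in>I. (p (fst i) \<bullet> snd i) *\<^sub>R \<phi> i x)"
    by (elim exE conjE)
  note \<phi> = \<phi>_all[rule_format]
  have c\<phi>: "continuous_on F (\<phi> i)" if "i \<in> I" for i using Pk_continuous_on[OF \<phi>[OF that]] .
  obtain c where c: "\<forall>j\<in>I. surf_inner F F (\<lambda>x. v x - (\<Sum>i\<in>I. c i *\<^sub>R \<phi> i x)) (\<phi> j) = 0"
    using surf_orthogonal_part[where \<phi>=\<phi>, OF F cF I c\<phi> v] by blast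
  define w where "w x = (\<Sum>i\<in>I. c i *\<^sub>R \<phi> i x)" for x
  have w: "w \<in> Pk k F UNIV" unfolding w_def by (rule Pk_sum[where p=\<phi>, OF subspace_UNIV \<phi>])
  have cw: "continuous_on F w" using Pk_continuous_on[OF w] .
  have "surf_inner F F w \<mu> = surf_inner F F v \<mu>" if \<mu>: "\<mu> \<in> Pk k F UNIV" for \<mu>
  proof -
    have \<mu>_eq: "surf_inner F F g \<mu> = (\<Sum>i\<in>I. (\<mu> (fst i) \<bullet> snd i) * surf_inner F F g (\<phi> i))"
      if g: "continuous_on F g" for g
    proof -
      have "surf_inner F F \<mu> g = surf_inner F F (\<lambda>x. \<Sum>i\<in>I. (\<mu> (fst i) \<bullet> snd i) *\<^sub>R \<phi> i x) g"
        using repr \<mu> by (intro surf_inner_cong) blast+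
      also have "\<dots> = (\<Sum>i\<in>I. (\<mu> (fst i) \<bullet> snd i) * surf_inner F F (\<phi> i) g)"
        by (rule surf_inner_sum[where u=\<phi>, OF F FF c\<phi> g I])
      finally show ?thesis by (simp add: surf_inner_commute)
    qed
    have "surf_inner F F w (\<phi> i) = surf_inner F F v (\<phi> i)" if i: "i \<in> I" for i
    proof -
      have "surf_inner F F (\<lambda>x. 1 *\<^sub>R v x + (-1) *\<^sub>R w x) (\<phi> i) = 0"
        using c i by (simp add: w_def)
      then show ?thesis using surf_inner_lincomb[OF F FF v cw c\<phi>[OF i], where a=1 and b="-1"] by simp
    qed
    then show ?thesis using \<mu>_eq[OF cw] \<mu>_eq[OF v] by simp
  qed
  with w show ?thesis by blast
qed

lemma bdK_inner_surf: "bdK_inner K S u v = (\<Sum>F\<in>elt_faces K. surf_inner F (F - S) (u F) (v F))"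
  by (simp add: bdK_inner_def surf_inner_def)

text \<open>
  The orthogonality over the boundary of \<open>K\<close> decouples into the faces, by testing with functions
  that vanish on all faces but one.
\<close>

lemma PM_properties:
  assumes fin: "finite (elt_faces K)" and comp: "\<And>F. F \<in> elt_faces K \<Longrightarrow> compact F"
    and v: "\<And>F. F \<in> elt_faces K \<Longrightarrow> continuous_on F (v F)" and F: "F \<in> elt_faces K"
  shows "PM k K v F \<in> Pk k F UNIV"
    and "\<mu> \<in> Pk k F UNIV \<Longrightarrow> surf_inner F F (PM k K v F) \<mu> = surf_inner F F (v F) \<mu>"
proof -
  define P where "P w \<longleftrightarrow> (\<forall>F\<in>elt_faces K. w F \<in> Pk k F UNIV) \<and>
     (\<forall>\<mu>. (\<forall>F\<in>elt_faces K. \<mu> F \<in> Pk k F UNIV) \<longrightarrow> bdK_inner K {} w \<mu> = bdK_inner K {} v \<mu>)" for w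
  have "\<forall>F\<in>elt_faces K. \<exists>w. w \<in> Pk k F UNIV \<and> (\<forall>\<mu>\<in>Pk k F UNIV. surf_inner F F w \<mu> = surf_inner F F (v F) \<mu>)"
    using face_projection_exists comp v by blast
  from bchoice[OF this] obtain w where w: "\<forall>F\<in>elt_faces K. w F \<in> Pk k F UNIV \<and>
      (\<forall>\<mu>\<in>Pk k F UNIV. surf_inner F F (w F) \<mu> = surf_inner F F (v F) \<mu>)" by blast
  have "P w" unfolding P_def bdK_inner_surf using w by (auto intro!: sum.cong)
  then have PM: "P (PM k K v)" unfolding PM_def P_def[symmetric] by (rule someI[of P w])
  then show "PM k K v F \<in> Pk k F UNIV" using F by (simp add: P_def)
  assume \<mu>: "\<mu> \<in> Pk k F UNIV"
  define \<nu> where "\<nu> G = (if G = F then \<mu> else (\<lambda>x. 0))" for G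
  have "\<forall>G\<in>elt_faces K. \<nu> G \<in> Pk k G UNIV" using \<mu> by (simp add: \<nu>_def Pk_zero)
  then have "bdK_inner K {} (PM k K v) \<nu> = bdK_inner K {} v \<nu>" using PM by (simp add: P_def)
  moreover have "bdK_inner K {} g \<nu> = surf_inner F F (g F) \<mu>" for g
  proof -
    have "bdK_inner K {} g \<nu> = (\<Sum>G\<in>elt_faces K. if G = F then surf_inner F F (g F) \<mu> else 0)"
      unfolding bdK_inner_surf by (intro sum.cong) (auto simp: \<nu>_def surf_inner_def)
    then show ?thesis using fin F by simp
  qed
  ultimately show "surf_inner F F (PM k K v F) \<mu> = surf_inner F F (v F) \<mu>" by simp
qed

text \<open>
  The projection of a curve of polynomials is represented by a curve \<open>P\<close> that is differentiable at
  every point of space: project the coordinate functions once and for all. The two curves have the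
  same brackets with face polynomials, hence they agree up to a null set, which is all that
  integrals see.
\<close>

lemma projected_curve:
  assumes fin: "finite (elt_faces K)" and comp: "\<And>F. F \<in> elt_faces K \<Longrightarrow> compact F \<and> F \<subseteq> K"
    and F: "F \<in> elt_faces K" and t: "t \<ge> 0"
    and u: "\<And>r. r \<ge> 0 \<Longrightarrow> u r \<in> Pk m K (UNIV :: (real^3) set)"
    and u': "\<And>x. x \<in> K \<Longrightarrow> ((\<lambda>r. u r x) has_vector_derivative u' x) (at t within {0..})"
  shows "\<exists>P P'. (\<forall>r\<ge>0. P r \<in> Pk k F UNIV \<and>
       (AE x in surface_measure F. x \<in> F \<longrightarrow> PM k K (\<lambda>F. u r) F x = P r x)) \<and>
     (\<forall>x. ((\<lambda>r. P r x) has_vector_derivative P' x) (at t within {0..})) \<and>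
     (\<forall>\<mu>\<in>Pk k F UNIV. surf_inner F F P' \<mu> = surf_inner F F u' \<mu>)"
proof -
  have cF: "compact F" and FK: "F \<subseteq> K" and FF: "F \<in> sets borel" "F \<subseteq> F"
    using comp[OF F] by (auto simp: compact_imp_closed borel_closed)
  from Pk_coordinates[OF subspace_UNIV, of K m] obtain I :: "((real^3) \<times> (real^3)) set" and \<phi>
    where I: "finite I" and node: "\<forall>i\<in>I. fst i \<in> K" and \<phi>_all: "\<forall>i\<in>I. \<phi> i \<in> Pk m K UNIV"
    and repr: "\<forall>p\<in>Pk m K UNIV. \<forall>x\<in>K. p x = (\<Sum>i\<in>I. (p (fst i) \<bullet> snd i) *\<^sub>R \<phi> i x)"
    by (elim exE conjE)
  note \<phi> = \<phi>_all[rule_format]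
  have cont: "continuous_on G p" if "G \<in> elt_faces K" "p \<in> Pk m K UNIV" for G and p :: "real^3 \<Rightarrow> real^3"
    using continuous_on_subset[OF Pk_continuous_on[OF that(2)]] comp[OF that(1)] by blast
  define \<pi> where "\<pi> i = PM k K (\<lambda>F. \<phi> i) F" for i
  have \<pi>: "\<pi> i \<in> Pk k F UNIV" if "i \<in> I" for i
    unfolding \<pi>_def using comp cont \<phi>[OF that] by (intro PM_properties(1) fin F) auto
  have \<pi>_eq: "surf_inner F F (\<pi> i) \<mu> = surf_inner F F (\<phi> i) \<mu>" if "i \<in> I" "\<mu> \<in> Pk k F UNIV" for i \<mu>
    unfolding \<pi>_def using comp cont \<phi>[OF that(1)] that(2) by (intro PM_properties(2) fin F) auto
  define proj where "proj p x = (\<Sum>i\<in>I. (p (fst i) \<bullet> snd i) *\<^sub>R \<pi> i x)" for p x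
  have proj: "proj p \<in> Pk k F UNIV" for p unfolding proj_def by (rule Pk_sum[where p=\<pi>, OF subspace_UNIV \<pi>])
  have proj_eq: "surf_inner F F (proj p) \<mu> = surf_inner F F p \<mu>"
    if p: "p \<in> Pk m K UNIV" and \<mu>: "\<mu> \<in> Pk k F UNIV" for p \<mu>
  proof -
    note c\<mu> = Pk_continuous_on[OF \<mu>]
    have "surf_inner F F (proj p) \<mu> = (\<Sum>i\<in>I. (p (fst i) \<bullet> snd i) * surf_inner F F (\<pi> i) \<mu>)"
      unfolding proj_def by (rule surf_inner_sum[where u=\<pi>, OF cF FF Pk_continuous_on[OF \<pi>] c\<mu> I])
    also have "\<dots> = (\<Sum>i\<in>I. (p (fst i) \<bullet> snd i) * surf_inner F F (\<phi> i) \<mu>)"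
      using \<pi>_eq[OF _ \<mu>] by (intro sum.cong) auto
    also have "\<dots> = surf_inner F F (\<lambda>x. \<Sum>i\<in>I. (p (fst i) \<bullet> snd i) *\<^sub>R \<phi> i x) \<mu>"
      by (rule surf_inner_sum[where u=\<phi>, OF cF FF cont[OF F \<phi>] c\<mu> I, symmetric])
    also have "\<dots> = surf_inner F F p \<mu>"
      by (rule surf_inner_cong) (rule repr[rule_format, OF p subsetD[OF FK], symmetric], assumption, rule refl)
    finally show ?thesis .
  qed
  have AE: "AE x in surface_measure F. x \<in> F \<longrightarrow> PM k K (\<lambda>F. p) F x = proj p x"
    if p: "p \<in> Pk m K UNIV" for p
  proof -
    have PMp: "PM k K (\<lambda>F. p) F \<in> Pk k F UNIV"
      using comp cont p by (intro PM_properties(1) fin F) auto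
    define w where "w x = 1 *\<^sub>R PM k K (\<lambda>F. p) F x + (-1) *\<^sub>R proj p x" for x
    have w: "w \<in> Pk k F UNIV" unfolding w_def by (intro Pk_lincomb subspace_UNIV PMp proj)
    note cw = Pk_continuous_on[OF w]
    have "surf_inner F F w w = surf_inner F F (PM k K (\<lambda>F. p) F) w - surf_inner F F (proj p) w"
      using surf_inner_lincomb[OF cF FF Pk_continuous_on[OF PMp] Pk_continuous_on[OF proj[of p]] cw,
          where a=1 and b="-1", folded w_def] by simp
    also have "surf_inner F F (PM k K (\<lambda>F. p) F) w = surf_inner F F p w"
      using comp cont p w by (intro PM_properties(2) fin F) auto
    also have "surf_inner F F (proj p) w = surf_inner F F p w" by (rule proj_eq[OF p w])
    finally have "AE x in surface_measure F. x \<in> F \<longrightarrow> w x = 0"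
      by (intro surf_inner_eq_0_AE cF FF cw) simp
    then show ?thesis by eventually_elim (simp add: w_def)
  qed
  have u'_Pk: "u' \<in> Pk m K UNIV" using Pk_curve_derivative(1)[OF subspace_UNIV u t u'] .
  have coord: "((\<lambda>r. u r (fst i) \<bullet> snd i) has_real_derivative u' (fst i) \<bullet> snd i) (at t within {0..})"
    if "i \<in> I" for i
    using bounded_linear.has_vector_derivative[OF bounded_linear_inner_left u'] node that
    by (simp add: has_real_derivative_iff_has_vector_derivative)
  have "((\<lambda>r. proj (u r) x) has_vector_derivative proj u' x) (at t within {0..})" for x
    unfolding proj_def
  proof (rule has_vector_derivative_sum)
    fix i assume "i \<in> I"
    then show "((\<lambda>r. (u r (fst i) \<bullet> snd i) *\<^sub>R \<pi> i x) has_vector_derivative (u' (fst i) \<bullet> snd i) *\<^sub>R \<pi> i x) (at t within {0..})"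
      using has_vector_derivative_scaleR[OF coord has_vector_derivative_const, of i "\<pi> i x"] by simp
  qed
  with proj AE u proj_eq[OF u'_Pk] show ?thesis
    by (intro exI[of _ "\<lambda>r. proj (u r)"] exI[of _ "proj u'"]) blast
qed

section \<open>Null boundary and inversion of the stiffness\<close>

text \<open>
  Near each of its points the frontier lies in the graph of \<open>\<phi>\<close>, which is the image of a plane under
  the Lipschitz map \<open>y \<mapsto> y + \<phi> y d\<close>. Elements of the mesh are closed and reach the frontier, whereas
  the coefficients are only controlled inside the domain.
\<close>

lemma negligible_lipschitz_boundary:
  assumes "open \<Omega>" and lip: "lipschitz_boundary \<Omega>"
  shows "negligible (frontier \<Omega>)"
proof (subst locally_negligible_alt, rule ballI)
  fix x assume "x \<in> frontier \<Omega>"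
  with lip have "\<exists>r>0. \<exists>d L. \<exists>\<phi> :: real^3 \<Rightarrow> real. norm d = 1 \<and> L-lipschitz_on {y. d \<bullet> y = 0} \<phi> \<and>
        \<Omega> \<inter> ball x r = {y \<in> ball x r. \<phi> (y - (d \<bullet> y) *\<^sub>R d) < d \<bullet> y}"
    unfolding lipschitz_boundary_def by (rule bspec)
  then obtain r d L \<phi> where r: "r > 0" and d: "norm d = 1" and \<phi>: "L-lipschitz_on {y. d \<bullet> y = 0} (\<phi> :: real^3 \<Rightarrow> real)"
    and graph: "\<Omega> \<inter> ball x r = {y \<in> ball x r. \<phi> (y - (d \<bullet> y) *\<^sub>R d) < d \<bullet> y}"
    by (elim exE conjE)
  define \<pi> where "\<pi> y = y - (d \<bullet> y) *\<^sub>R d" for y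
  have \<pi>: "d \<bullet> \<pi> y = 0" for y using d by (simp add: \<pi>_def inner_diff_right norm_eq_1)
  have c\<phi>: "continuous_on {y. d \<bullet> y = 0} \<phi>" using \<phi> by (rule lipschitz_on_continuous_on)
  have on_graph: "\<phi> (\<pi> y) = d \<bullet> y" if y: "y \<in> frontier \<Omega>" "y \<in> ball x r" for y
  proof (rule antisym)
    have "y \<notin> \<Omega>" using y(1) \<open>open \<Omega>\<close> by (simp add: frontier_def interior_open)
    then show "d \<bullet> y \<le> \<phi> (\<pi> y)" using graph y(2) by (force simp: \<pi>_def)
    have "y \<in> closure \<Omega>" using y(1) by (simp add: frontier_def)
    then obtain z where z: "\<And>n. z n \<in> \<Omega>" "z \<longlonglongrightarrow> y" unfolding closure_sequential by blast
    have "\<forall>\<^sub>F n in sequentially. z n \<in> ball x r"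
      using topological_tendstoD[OF z(2) open_ball y(2)] .
    then have "\<forall>\<^sub>F n in sequentially. \<phi> (\<pi> (z n)) \<le> d \<bullet> z n"
    proof eventually_elim
      case (elim n)
      then have "z n \<in> \<Omega> \<inter> ball x r" using z(1) by blast
      then show ?case unfolding graph by (simp add: \<pi>_def)
    qed
    moreover have "(\<lambda>n. \<phi> (\<pi> (z n))) \<longlonglongrightarrow> \<phi> (\<pi> y)"
    proof (rule continuous_on_tendsto_compose[OF c\<phi>])
      show "(\<lambda>n. \<pi> (z n)) \<longlonglongrightarrow> \<pi> y" unfolding \<pi>_def using z(2) by (intro tendsto_intros)
    qed (use \<pi> in auto)
    moreover have "(\<lambda>n. d \<bullet> z n) \<longlonglongrightarrow> d \<bullet> y" using z(2) by (intro tendsto_intros)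
    ultimately show "\<phi> (\<pi> y) \<le> d \<bullet> y" by (intro tendsto_le[OF sequentially_bot])
  qed
  have neg: "negligible ((\<lambda>y. y + \<phi> y *\<^sub>R d) ` {y. d \<bullet> y = 0})"
  proof (rule negligible_locally_Lipschitz_image)
    show "negligible {y. d \<bullet> y = 0}" using d by (intro negligible_hyperplane) auto
    fix y assume y: "y \<in> {y. d \<bullet> y = 0}"
    have "norm ((z + \<phi> z *\<^sub>R d) - (y + \<phi> y *\<^sub>R d)) \<le> (1 + L) * norm (z - y)" if z: "d \<bullet> z = 0" for z
    proof -
      have "norm ((z + \<phi> z *\<^sub>R d) - (y + \<phi> y *\<^sub>R d)) = norm ((z - y) + (\<phi> z - \<phi> y) *\<^sub>R d)"
        by (simp add: algebra_simps)
      also have "\<dots> \<le> norm (z - y) + \<bar>\<phi> z - \<phi> y\<bar>" using norm_triangle_ineq[of "z - y" "(\<phi> z - \<phi> y) *\<^sub>R d"] d by simp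
      also have "\<bar>\<phi> z - \<phi> y\<bar> \<le> L * norm (z - y)"
        using lipschitz_onD[OF \<phi>, of z y] y z by (simp add: dist_norm)
      finally show ?thesis by (simp add: algebra_simps)
    qed
    then show "\<exists>T B. open T \<and> y \<in> T \<and> (\<forall>z\<in>{y. d \<bullet> y = 0} \<inter> T. norm ((z + \<phi> z *\<^sub>R d) - (y + \<phi> y *\<^sub>R d)) \<le> B * norm (z - y))"
      by (intro exI[of _ UNIV] exI[of _ "1 + L"]) auto
  qed simp
  have "y \<in> (\<lambda>y. y + \<phi> y *\<^sub>R d) ` {y. d \<bullet> y = 0}" if "y \<in> frontier \<Omega> \<inter> ball x r" for y
  proof (rule image_eqI[of _ _ "\<pi> y"])
    show "y = \<pi> y + \<phi> (\<pi> y) *\<^sub>R d" using on_graph that by (simp add: \<pi>_def)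
  qed (simp add: \<pi>)
  then have "negligible (frontier \<Omega> \<inter> ball x r)" using negligible_subset[OF neg] by blast
  then show "\<exists>U. openin (top_of_set (frontier \<Omega>)) U \<and> x \<in> U \<and> negligible U"
    using \<open>x \<in> frontier \<Omega>\<close> r by (intro exI[of _ "frontier \<Omega> \<inter> ball x r"]) auto
qed

lemma measurable_AE_eq_complete:
  assumes M: "complete_measure M" and f: "f \<in> borel_measurable M" and eq: "AE x in M. g x = f x"
  shows "g \<in> borel_measurable M"
proof (rule measurableI)
  fix A :: "'b set" assume A: "A \<in> sets borel"
  have "f -` A \<inter> space M \<in> sets M" using f A by (rule measurable_sets)
  then show "g -` A \<inter> space M \<in> sets M"
    by (rule complete_measure.in_sets_AE[OF M, rotated]) (use eq in \<open>auto elim: eventually_mono\<close>)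
qed simp

lemma bounded_times_continuous_integrable:
  fixes m m' g :: "real^3 \<Rightarrow> real"
  assumes K: "compact K" and g: "continuous_on K g" and m': "m' \<in> borel_measurable lebesgue"
    and eq: "AE x in lebesgue. x \<in> K \<longrightarrow> m x = m' x" and bd: "AE x in lebesgue. x \<in> K \<longrightarrow> \<bar>m x\<bar> \<le> B"
  shows "set_integrable lebesgue K (\<lambda>x. m x * g x)"
proof -
  have Kb: "K \<in> sets borel" using K by (simp add: compact_imp_closed borel_closed)
  obtain G where G: "\<And>x. x \<in> K \<Longrightarrow> \<bar>g x\<bar> \<le> G"
    using compact_imp_bounded[OF compact_continuous_image[OF g K]] unfolding bounded_iff by auto
  have gm: "(\<lambda>x. indicator K x *\<^sub>R g x) \<in> borel_measurable lebesgue"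
    using borel_measurable_continuous_on_indicator[OF Kb g] by (intro measurable_completion) simp
  have "(\<lambda>x. m' x * (indicator K x *\<^sub>R g x)) \<in> borel_measurable lebesgue"
    using m' gm by (rule borel_measurable_times)
  moreover have "AE x in lebesgue. indicator K x *\<^sub>R (m x * g x) = m' x * (indicator K x *\<^sub>R g x)"
    using eq by eventually_elim (auto split: split_indicator)
  ultimately have meas: "(\<lambda>x. indicator K x *\<^sub>R (m x * g x)) \<in> borel_measurable lebesgue"
    by (rule measurable_AE_eq_complete[OF completion.complete_measure_axioms])
  have "emeasure lborel K < \<infinity>" using K by (intro emeasure_bounded_finite compact_imp_bounded)
  then have "integrable lebesgue (\<lambda>x. indicator K x *\<^sub>R (\<bar>B\<bar> * \<bar>G\<bar>))"
    using Kb by (intro integrable_scaleR_left integrable_real_indicator) auto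
  then show ?thesis unfolding set_integrable_def
  proof (rule Bochner_Integration.integrable_bound[OF _ meas])
    show "AE x in lebesgue. norm (indicator K x *\<^sub>R (m x * g x)) \<le> norm (indicator K x *\<^sub>R (\<bar>B\<bar> * \<bar>G\<bar>))"
      using bd
    proof eventually_elim
      case (elim x)
      show ?case
      proof (cases "x \<in> K")
        case True
        have "\<bar>m x\<bar> * \<bar>g x\<bar> \<le> \<bar>B\<bar> * \<bar>G\<bar>"
          using elim True G[OF True] by (intro mult_mono) auto
        then show ?thesis using True by (simp add: abs_mult)
      qed simp
    qed
  qed
qed

lemma frob_eq_inner: "frob \<xi> \<eta> = \<xi> \<bullet> \<eta>"
  by (simp add: frob_def trace_def matrix_matrix_mult_def transpose_def inner_vec_def sum_3 algebra_simps)

lemma subspace_Sym: "subspace Sym"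
proof -
  have "transpose (0 :: real^3^3) = 0" "\<And>x y :: real^3^3. transpose (x + y) = transpose x + transpose y"
    "\<And>c (x :: real^3^3). transpose (c *\<^sub>R x) = c *\<^sub>R transpose x"
    by (simp_all add: transpose_def vec_eq_iff)
  then show ?thesis unfolding subspace_def Sym_def by simp
qed

text \<open>
  The hypotheses on the stiffness hold at almost every point. At one such point the inverse is a
  matter of linear algebra on the symmetric matrices; \<open>inv_into Sym C\<close> is the compliance there.
\<close>

locale stiffness_point =
  fixes C :: "real^3^3 \<Rightarrow> real^3^3" and c :: real
  assumes C_Sym: "\<And>\<xi>. \<xi> \<in> Sym \<Longrightarrow> C \<xi> \<in> Sym"
    and C_add: "\<And>\<xi> \<eta>. \<xi> \<in> Sym \<Longrightarrow> \<eta> \<in> Sym \<Longrightarrow> C (\<xi> + \<eta>) = C \<xi> + C \<eta>"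
    and C_scale: "\<And>a \<xi>. \<xi> \<in> Sym \<Longrightarrow> C (a *\<^sub>R \<xi>) = a *\<^sub>R C \<xi>"
    and C_sym: "\<And>\<xi> \<eta>. \<xi> \<in> Sym \<Longrightarrow> \<eta> \<in> Sym \<Longrightarrow> C \<xi> \<bullet> \<eta> = \<xi> \<bullet> C \<eta>"
    and c: "c > 0"
    and coercive: "\<And>\<xi>. \<xi> \<in> Sym \<Longrightarrow> c * (norm \<xi>)\<^sup>2 \<le> C \<xi> \<bullet> \<xi>"
begin

abbreviation "A \<equiv> inv_into Sym C"

lemma C_diff: "\<xi> \<in> Sym \<Longrightarrow> \<eta> \<in> Sym \<Longrightarrow> C (\<xi> - \<eta>) = C \<xi> - C \<eta>"
  using C_add[of \<xi> "(-1) *\<^sub>R \<eta>"] C_scale[of \<eta> "-1"] subspace_scale[OF subspace_Sym, of \<eta> "-1"] by simp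

lemma C_eq_0: "\<xi> \<in> Sym \<Longrightarrow> C \<xi> = 0 \<Longrightarrow> \<xi> = 0"
  using coercive[of \<xi>] c by (simp add: mult_le_0_iff)

lemma inj_C: "inj_on C Sym"
proof (rule inj_onI)
  fix \<xi> \<eta> assume S: "\<xi> \<in> Sym" "\<eta> \<in> Sym" and "C \<xi> = C \<eta>"
  then have "C (\<xi> - \<eta>) = 0" by (simp add: C_diff)
  with S have "\<xi> - \<eta> = 0" by (intro C_eq_0[of "\<xi> - \<eta>"] subspace_diff[OF subspace_Sym])
  then show "\<xi> = \<eta>" by simp
qed

text \<open>Extending \<open>C\<close> by the identity on skew matrices reduces surjectivity to injectivity.\<close>

lemma surj_C: "\<zeta> \<in> Sym \<Longrightarrow> \<exists>\<xi>\<in>Sym. C \<xi> = \<zeta>"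
proof -
  assume \<zeta>: "\<zeta> \<in> Sym"
  define sy where "sy M = (1/2) *\<^sub>R (M + transpose M)" for M :: "real^3^3"
  have sy_Sym: "sy M \<in> Sym" for M by (simp add: sy_def Sym_def transpose_def vec_eq_iff add.commute)
  have sy_id: "sy M = M" if "M \<in> Sym" for M
    using that by (simp add: sy_def Sym_def flip: scaleR_2)
  have sy_lin: "linear sy" by (rule linearI) (simp_all add: sy_def transpose_def vec_eq_iff algebra_simps)
  define L where "L M = C (sy M) + (M - sy M)" for M
  have sy_skew: "sy (M - sy M) = 0" for M
    using sy_id[OF sy_Sym] by (simp add: linear_diff[OF sy_lin])
  have L_Sym: "M = sy M \<and> C (sy M) = L M" if "L M \<in> Sym" for M
  proof -
    have "sy (L M) = C (sy M)"
      unfolding L_def using sy_skew by (simp add: linear_add[OF sy_lin] sy_id C_Sym sy_Sym)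
    then have "C (sy M) = L M" using sy_id[OF that] by simp
    then show ?thesis by (simp add: L_def)
  qed
  have "linear L"
    by (rule linearI)
      (simp_all add: L_def linear_add[OF sy_lin] linear_scale[OF sy_lin] C_add C_scale sy_Sym algebra_simps)
  moreover have "inj L"
  proof (subst linear_injective_0[OF \<open>linear L\<close>], intro allI impI)
    fix M assume 0: "L M = 0"
    then have "L M \<in> Sym" by (simp add: subspace_0[OF subspace_Sym])
    note * = L_Sym[OF this]
    have "C (sy M) = 0" using conjunct2[OF *] 0 by (rule trans)
    then have "sy M = 0" by (rule C_eq_0[OF sy_Sym])
    then show "M = 0" by (rule trans[OF conjunct1[OF *]])
  qed
  ultimately have "surj L" by (simp add: linear_injective_imp_surjective)
  then obtain M where M: "L M = \<zeta>" by (metis surjD)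
  then have "C (sy M) = \<zeta>" using L_Sym \<zeta> by blast
  then show ?thesis using sy_Sym by blast
qed

lemma A_Sym: "\<xi> \<in> Sym \<Longrightarrow> A \<xi> \<in> Sym" and C_A: "\<xi> \<in> Sym \<Longrightarrow> C (A \<xi>) = \<xi>"
proof -
  assume "\<xi> \<in> Sym"
  then have "\<xi> \<in> C ` Sym" using surj_C by blast
  then show "A \<xi> \<in> Sym" "C (A \<xi>) = \<xi>" by (rule inv_into_into, rule f_inv_into_f)
qed

lemma A_eqI: "\<eta> \<in> Sym \<Longrightarrow> C \<eta> = \<xi> \<Longrightarrow> A \<xi> = \<eta>"
  using inv_into_f_f[OF inj_C] by blast

lemma A_lincomb: "\<xi> \<in> Sym \<Longrightarrow> \<eta> \<in> Sym \<Longrightarrow> A (a *\<^sub>R \<xi> + b *\<^sub>R \<eta>) = a *\<^sub>R A \<xi> + b *\<^sub>R A \<eta>"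
  by (intro A_eqI subspace_add subspace_scale subspace_Sym)
    (auto simp: C_add C_scale C_A A_Sym subspace_scale subspace_Sym)

lemma A_sym: "\<xi> \<in> Sym \<Longrightarrow> \<eta> \<in> Sym \<Longrightarrow> A \<xi> \<bullet> \<eta> = \<xi> \<bullet> A \<eta>"
  using C_sym[OF A_Sym[of \<xi>] A_Sym[of \<eta>]] by (simp add: C_A)

lemma A_bound: "\<xi> \<in> Sym \<Longrightarrow> norm (A \<xi>) \<le> norm \<xi> / c"
proof -
  assume \<xi>: "\<xi> \<in> Sym"
  have "c * (norm (A \<xi>))\<^sup>2 \<le> \<xi> \<bullet> A \<xi>" using coercive[OF A_Sym[OF \<xi>]] by (simp add: C_A \<xi>)
  also have "\<dots> \<le> norm \<xi> * norm (A \<xi>)" by (rule norm_cauchy_schwarz)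
  finally have "(c * norm (A \<xi>)) * norm (A \<xi>) \<le> norm \<xi> * norm (A \<xi>)" by (simp add: power2_eq_square)
  then have "c * norm (A \<xi>) \<le> norm \<xi>"
    by (cases "norm (A \<xi>) = 0") (auto simp: mult_le_cancel_right)
  then show ?thesis using c by (simp add: field_simps)
qed

lemma A_nonneg: "\<xi> \<in> Sym \<Longrightarrow> 0 \<le> A \<xi> \<bullet> \<xi>"
proof -
  assume \<xi>: "\<xi> \<in> Sym"
  have "0 \<le> c * (norm (A \<xi>))\<^sup>2" using c by simp
  also have "\<dots> \<le> C (A \<xi>) \<bullet> A \<xi>" using A_Sym[OF \<xi>] by (rule coercive)
  finally show ?thesis by (simp add: C_A \<xi> inner_commute)
qed

lemma C_sum:
  assumes "finite E" "E \<subseteq> Sym"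
  shows "C (\<Sum>e\<in>E. a e *\<^sub>R e) = (\<Sum>e\<in>E. a e *\<^sub>R C e)"
  using assms
proof induction
  case empty
  show ?case using C_scale[of 0 0] by (simp add: subspace_0[OF subspace_Sym])
next
  case (insert e E)
  then have "(\<Sum>e\<in>E. a e *\<^sub>R e) \<in> Sym" by (intro subspace_sum subspace_scale subspace_Sym) auto
  with insert show ?case by (simp add: C_add C_scale subspace_scale[OF subspace_Sym])
qed

lemma A_sum:
  assumes "finite E" "E \<subseteq> Sym"
  shows "A (\<Sum>e\<in>E. a e *\<^sub>R e) = (\<Sum>e\<in>E. a e *\<^sub>R A e)"
  using assms
proof induction
  case empty
  show ?case using A_lincomb[of 0 0 0 0] by (simp add: subspace_0[OF subspace_Sym])
next
  case (insert e E)
  then have "(\<Sum>e\<in>E. a e *\<^sub>R e) \<in> Sym" by (intro subspace_sum subspace_scale subspace_Sym) auto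
  with insert show ?case using A_lincomb[of e "\<Sum>e\<in>E. a e *\<^sub>R e" "a e" 1] by simp
qed

text \<open>
  Richardson's iteration \<open>y \<mapsto> y + \<omega> (\<xi> - C y)\<close> exhibits the inverse as a limit of polynomials
  in \<open>C\<close>; with \<open>\<omega> = c / B\<^sup>2\<close> each step contracts the error by the factor \<open>sqrt (1 - c\<^sup>2 / B\<^sup>2)\<close>.
\<close>

lemma richardson_limit:
  assumes B: "B > 0" "\<And>\<xi>. \<xi> \<in> Sym \<Longrightarrow> norm (C \<xi>) \<le> B * norm \<xi>" and \<xi>: "\<xi> \<in> Sym"
    and y0: "y 0 = 0" and ySuc: "\<And>n. y n \<in> Sym \<Longrightarrow> y (Suc n) = y n + (c / B\<^sup>2) *\<^sub>R (\<xi> - C (y n))"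
  shows "y \<longlonglongrightarrow> A \<xi>"
proof -
  define \<omega> where "\<omega> = c / B\<^sup>2"
  \<comment> \<open>The maximum makes \<open>\<theta>\<close> nonnegative without comparing \<open>c\<close> and \<open>B\<close>.\<close>
  define \<theta> where "\<theta> = max 0 (1 - c\<^sup>2 / B\<^sup>2)"
  have y: "y n \<in> Sym" for n
  proof (induction n)
    case 0
    show ?case by (simp add: y0 subspace_0[OF subspace_Sym])
  next
    case (Suc n)
    then show ?case unfolding ySuc[OF Suc]
      by (intro subspace_add subspace_scale subspace_diff subspace_Sym \<xi> C_Sym)
  qed
  define e where "e n = A \<xi> - y n" for n
  have e: "e n \<in> Sym" for n unfolding e_def by (intro subspace_diff subspace_Sym y A_Sym \<xi>)
  have eSuc: "e (Suc n) = e n - \<omega> *\<^sub>R C (e n)" for n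
    unfolding e_def C_diff[OF A_Sym[OF \<xi>] y] C_A[OF \<xi>] ySuc[OF y] by (simp add: \<omega>_def algebra_simps)
  have step: "(norm (e (Suc n)))\<^sup>2 \<le> \<theta> * (norm (e n))\<^sup>2" for n
  proof -
    have "(norm (e (Suc n)))\<^sup>2 = (norm (e n))\<^sup>2 - 2 * \<omega> * (C (e n) \<bullet> e n) + \<omega>\<^sup>2 * (norm (C (e n)))\<^sup>2"
      unfolding eSuc power2_norm_eq_inner
      by (simp add: inner_diff_left inner_diff_right inner_commute power2_eq_square algebra_simps)
    also have "\<dots> \<le> (norm (e n))\<^sup>2 - 2 * \<omega> * (c * (norm (e n))\<^sup>2) + \<omega>\<^sup>2 * (B * norm (e n))\<^sup>2"
    proof -
      have "0 \<le> \<omega>" using c by (simp add: \<omega>_def)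
      then have "2 * \<omega> * (c * (norm (e n))\<^sup>2) \<le> 2 * \<omega> * (C (e n) \<bullet> e n)"
        using coercive[OF e] by (intro mult_left_mono) auto
      moreover have "(norm (C (e n)))\<^sup>2 \<le> (B * norm (e n))\<^sup>2"
        using B(2)[OF e] by (intro power_mono) auto
      then have "\<omega>\<^sup>2 * (norm (C (e n)))\<^sup>2 \<le> \<omega>\<^sup>2 * (B * norm (e n))\<^sup>2" by (intro mult_left_mono) auto
      ultimately show ?thesis by linarith
    qed
    also have "\<dots> = (1 - c\<^sup>2 / B\<^sup>2) * (norm (e n))\<^sup>2"
      using B(1) by (simp add: \<omega>_def field_simps power2_eq_square)
    also have "\<dots> \<le> \<theta> * (norm (e n))\<^sup>2" by (intro mult_right_mono) (auto simp: \<theta>_def)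
    finally show ?thesis .
  qed
  have geo: "(norm (e n))\<^sup>2 \<le> \<theta> ^ n * (norm (e 0))\<^sup>2" for n
  proof (induction n)
    case (Suc n)
    have "\<theta> * (norm (e n))\<^sup>2 \<le> \<theta> * (\<theta> ^ n * (norm (e 0))\<^sup>2)"
      using Suc by (intro mult_left_mono) (auto simp: \<theta>_def)
    then show ?case using step[of n] by simp
  qed simp
  have "0 \<le> \<theta>" "\<theta> < 1" using c B(1) by (auto simp: \<theta>_def)
  then have lim: "(\<lambda>n. \<theta> ^ n * (norm (e 0))\<^sup>2) \<longlonglongrightarrow> 0"
    by (intro tendsto_mult_left_zero LIMSEQ_power_zero) simp
  have "(\<lambda>n. (norm (e n))\<^sup>2) \<longlonglongrightarrow> 0"
    by (rule tendsto_sandwich[OF always_eventually always_eventually tendsto_const lim])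
      (simp, rule allI, rule geo)
  then have "(\<lambda>n. sqrt ((norm (e n))\<^sup>2)) \<longlonglongrightarrow> sqrt 0" by (intro tendsto_real_sqrt)
  then have "e \<longlonglongrightarrow> 0" by (simp add: tendsto_norm_zero_iff)
  then have "(\<lambda>n. A \<xi> - e n) \<longlonglongrightarrow> A \<xi> - 0" by (intro tendsto_intros)
  then show ?thesis by (simp add: e_def)
qed

end

section \<open>Integration by parts on an element\<close>

lemma set_integrable_AE_eq:
  fixes f g :: "'a \<Rightarrow> real"
  assumes M: "complete_measure M" and f: "set_integrable M S f" and eq: "AE x in M. x \<in> S \<longrightarrow> g x = f x"
  shows "set_integrable M S g" and "(LINT x:S|M. g x) = (LINT x:S|M. f x)"
proof -
  have fm: "(\<lambda>x. indicator S x *\<^sub>R f x) \<in> borel_measurable M"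
    using f unfolding set_integrable_def by (rule borel_measurable_integrable)
  have ae: "AE x in M. indicator S x *\<^sub>R g x = indicator S x *\<^sub>R f x"
    using eq by eventually_elim (auto split: split_indicator)
  have gm: "(\<lambda>x. indicator S x *\<^sub>R g x) \<in> borel_measurable M"
    by (rule measurable_AE_eq_complete[OF M fm ae])
  show "set_integrable M S g"
    using f unfolding set_integrable_def
    by (rule integrable_cong_AE_imp[OF _ gm]) (rule eventually_mono[OF ae], erule sym)
  show "(LINT x:S|M. g x) = (LINT x:S|M. f x)"
    unfolding set_lebesgue_integral_def by (rule integral_cong_AE[OF gm fm ae])
qed

lemma fun_linear_integral:
  assumes M: "complete_measure M" and RS: "R \<subseteq> S"
    and int: "\<And>p. p \<in> P \<Longrightarrow> set_integrable M R (B p)"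
    and lin: "\<And>p q r a b. p \<in> P \<Longrightarrow> q \<in> P \<Longrightarrow> r \<in> P \<Longrightarrow> (\<And>x. x \<in> S \<Longrightarrow> r x = a *\<^sub>R p x + b *\<^sub>R q x) \<Longrightarrow>
      AE x in M. x \<in> R \<longrightarrow> B r x = a * B p x + b * B q x"
  shows "fun_linear P S (\<lambda>p. LINT x:R|M. B p x)"
  unfolding fun_linear_def
proof (intro allI ballI impI)
  fix a b p q r assume p: "p \<in> P" and q: "q \<in> P" and r: "r \<in> P" and eq: "\<forall>x\<in>S. r x = a *\<^sub>R p x + b *\<^sub>R q x"
  have ip: "set_integrable M R (\<lambda>x. a * B p x)" and iq: "set_integrable M R (\<lambda>x. b * B q x)"
    using int[OF p] int[OF q] by simp_all
  have "(LINT x:R|M. B r x) = (LINT x:R|M. a * B p x + b * B q x)"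
    using eq by (intro set_integrable_AE_eq(2)[OF M] set_integral_add(1) ip iq lin p q r) auto
  also have "\<dots> = a * (LINT x:R|M. B p x) + b * (LINT x:R|M. B q x)"
    by (simp add: set_integral_add(2)[OF ip iq])
  finally show "(LINT x:R|M. B r x) = a * (LINT x:R|M. B p x) + b * (LINT x:R|M. B q x)" .
qed

lemma complete_lebesgue: "complete_measure (lebesgue :: 'a::euclidean_space measure)"
  by (rule completion.complete_measure_axioms)

lemma continuous_set_integrable_lebesgue:
  fixes f :: "'a::euclidean_space \<Rightarrow> real"
  assumes K: "compact K" and f: "continuous_on K f"
  shows "set_integrable lebesgue K f"
proof -
  have "integrable lborel (\<lambda>x. indicator K x *\<^sub>R f x)" using K f by (rule borel_integrable_compact)
  then show ?thesis unfolding set_integrable_def by (subst integrable_completion) auto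
qed

lemma set_integral_double_sum:
  fixes g :: "'i \<Rightarrow> 'j \<Rightarrow> 'a \<Rightarrow> real"
  assumes g: "\<And>i j. set_integrable M S (g i j)"
  shows "(LINT x:S|M. \<Sum>i\<in>A. \<Sum>j\<in>B. g i j x) = (\<Sum>i\<in>A. \<Sum>j\<in>B. LINT x:S|M. g i j x)"
proof -
  have int: "integrable M (\<lambda>x. indicator S x *\<^sub>R g i j x)" for i j
    using g unfolding set_integrable_def .
  have "(LINT x:S|M. \<Sum>i\<in>A. \<Sum>j\<in>B. g i j x) = integral\<^sup>L M (\<lambda>x. \<Sum>i\<in>A. \<Sum>j\<in>B. indicator S x *\<^sub>R g i j x)"
    unfolding set_lebesgue_integral_def by (simp only: scaleR_sum_right)
  also have "\<dots> = (\<Sum>i\<in>A. integral\<^sup>L M (\<lambda>x. \<Sum>j\<in>B. indicator S x *\<^sub>R g i j x))"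
    by (rule Bochner_Integration.integral_sum) (rule Bochner_Integration.integrable_sum[OF int])
  also have "\<dots> = (\<Sum>i\<in>A. \<Sum>j\<in>B. integral\<^sup>L M (\<lambda>x. indicator S x *\<^sub>R g i j x))"
    by (rule sum.cong[OF refl], rule Bochner_Integration.integral_sum, rule int)
  finally show ?thesis unfolding set_lebesgue_integral_def .
qed

lemma jacobian_nth:
  assumes "(w has_derivative D) (at x)"
  shows "jacobian w (at x) $ i $ j = D (axis j 1) $ i"
  using frechet_derivative_at[OF assms] by (simp add: jacobian_def matrix_def)

text \<open>
  The divergence theorem for the products \<open>\<sigma>\<^sub>i\<^sub>j w\<^sub>i\<close> in the coordinate directions \<open>e\<^sub>j\<close>, summed over
  \<open>i\<close> and \<open>j\<close>. The derivatives of \<open>\<sigma>\<close> and \<open>w\<close> are those of polynomials in the interior of \<open>K\<close> only, as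
  both functions are arbitrary off \<open>K\<close>; the boundary of \<open>K\<close> is a null set. The second conclusion
  makes the divergence an admissible weight under integrals.
\<close>

lemma element_integration_by_parts:
  fixes \<sigma> :: "real^3 \<Rightarrow> real^3^3" and w :: "real^3 \<Rightarrow> real^3"
  assumes K: "3 simplex K" and \<sigma>: "\<sigma> \<in> Pk k K V" and w: "w \<in> Pk m K W"
  shows "(LINT x:K|lebesgue. w x \<bullet> row_div \<sigma> x) + (LINT x:K|lebesgue. frob (\<sigma> x) (jacobian w (at x))) =
      (\<Sum>F\<in>elt_faces K. surf_inner F F (\<lambda>x. \<sigma> x *v normal K F) w)"
    and "\<exists>g. continuous_on UNIV g \<and> (AE x in lebesgue. x \<in> K \<longrightarrow> row_div \<sigma> x = g x)"
proof -
  obtain S DS where S: "\<And>x. x \<in> K \<Longrightarrow> \<sigma> x = S x" "\<And>x. (S has_derivative DS x) (at x)"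
    "\<And>v. continuous_on UNIV (\<lambda>x. DS x v)" using Pk_smooth_extension[OF \<sigma>] by blast
  obtain W' DW where W: "\<And>x. x \<in> K \<Longrightarrow> w x = W' x" "\<And>x. (W' has_derivative DW x) (at x)"
    "\<And>v. continuous_on UNIV (\<lambda>x. DW x v)" using Pk_smooth_extension[OF w] by blast
  obtain p q r s where "K = convex hull {p, q, r, s}" using simplex3_tetrahedron[OF K] by blast
  then have cK: "compact K" and convK: "convex K" by (simp_all add: finite_imp_compact_convex_hull)
  have cS: "continuous_on UNIV S" and cW: "continuous_on UNIV W'"
    using S(2) W(2) by (intro continuous_at_imp_continuous_on ballI has_derivative_continuous; blast)+
  have cS': "continuous_on U (\<lambda>x. S x $ i $ j)" and cW': "continuous_on U (\<lambda>x. W' x $ i)"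
    and cDS: "continuous_on U (\<lambda>x. DS x v $ i $ j)" and cDW: "continuous_on U (\<lambda>x. DW x v $ i)" for U i j v
    using continuous_on_subset[OF cS] continuous_on_subset[OF cW] continuous_on_subset[OF S(3)]
      continuous_on_subset[OF W(3)] by (auto intro!: continuous_intros)
  have AE_int: "AE x in lebesgue. x \<in> K \<longrightarrow> x \<in> interior K"
  proof -
    have "negligible (frontier K)" by (rule negligible_convex_frontier[OF convK])
    then have "AE x in lebesgue. x \<notin> frontier K"
      by (simp add: negligible_iff_null_sets AE_not_in)
    then show ?thesis
      by eventually_elim (use closure_subset[of K] in \<open>auto simp: frontier_def\<close>)
  qed
  have jac: "jacobian w (at x) $ i $ j = DW x (axis j 1) $ i" if "x \<in> interior K" for x i j
  proof (rule jacobian_nth)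
    show "(w has_derivative DW x) (at x)"
      using W(1) that interior_subset[of K]
      by (intro has_derivative_transform_within_open[OF W(2) open_interior that]) auto
  qed
  have div: "row_div \<sigma> x $ i = (\<Sum>j\<in>UNIV. DS x (axis j 1) $ i $ j)" if "x \<in> interior K" for x i
  proof -
    have "(\<sigma> has_derivative DS x) (at x)"
      using S(1) that interior_subset[of K]
      by (intro has_derivative_transform_within_open[OF S(2) open_interior that]) auto
    then have "((\<lambda>y. \<sigma> y $ i) has_derivative (\<lambda>v. DS x v $ i)) (at x)"
      by (rule bounded_linear.has_derivative[OF bounded_linear_vec_nth])
    from jacobian_nth[OF this] show ?thesis by (simp add: row_div_def trace_def)
  qed
  define g where "g x = (\<chi> i. \<Sum>j\<in>UNIV. DS x (axis j 1) $ i $ j)" for x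
  have g: "continuous_on UNIV g" unfolding g_def by (intro continuous_on_vec_lambda continuous_on_sum cDS)
  have g_AE: "AE x in lebesgue. x \<in> K \<longrightarrow> row_div \<sigma> x = g x"
    using AE_int by eventually_elim (auto simp: vec_eq_iff g_def div)
  from g g_AE show "\<exists>g. continuous_on UNIV g \<and> (AE x in lebesgue. x \<in> K \<longrightarrow> row_div \<sigma> x = g x)" by blast
  define R where "R x = (\<Sum>i\<in>UNIV. \<Sum>j\<in>UNIV. DS x (axis j 1) $ i $ j * W' x $ i)" for x
  define J where "J x = (\<Sum>i\<in>UNIV. \<Sum>j\<in>UNIV. S x $ i $ j * DW x (axis j 1) $ i)" for x
  define f where "f i j x = S x $ i $ j * W' x $ i" for i j x
  define Df where "Df i j x v = S x $ i $ j * DW x v $ i + DS x v $ i $ j * W' x $ i" for i j x v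
  have f: "(f i j has_derivative Df i j x) (at x)" for i j x
    unfolding f_def Df_def
    by (intro has_derivative_mult bounded_linear.has_derivative[OF bounded_linear_vec_nth] S(2) W(2))
  have Df: "continuous_on UNIV (\<lambda>x. Df i j x v)" for i j v
    unfolding Df_def by (intro continuous_intros cS' cW' cDS cDW)
  have iR: "set_integrable lebesgue K R" and iJ: "set_integrable lebesgue K J"
    unfolding R_def J_def
    by (intro continuous_set_integrable_lebesgue cK continuous_on_sum continuous_on_mult cS' cW' cDS cDW)+
  have "(LINT x:K|lebesgue. w x \<bullet> row_div \<sigma> x) = (LINT x:K|lebesgue. R x)"
  proof (rule set_integrable_AE_eq(2)[OF complete_lebesgue iR])
    show "AE x in lebesgue. x \<in> K \<longrightarrow> w x \<bullet> row_div \<sigma> x = R x"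
      using g_AE by eventually_elim (auto simp: R_def g_def W(1) inner_vec_def sum_distrib_left mult.commute)
  qed
  moreover have "(LINT x:K|lebesgue. frob (\<sigma> x) (jacobian w (at x))) = (LINT x:K|lebesgue. J x)"
  proof (rule set_integrable_AE_eq(2)[OF complete_lebesgue iJ])
    show "AE x in lebesgue. x \<in> K \<longrightarrow> frob (\<sigma> x) (jacobian w (at x)) = J x"
      using AE_int by eventually_elim (auto simp: J_def frob_eq_inner inner_vec_def jac S(1))
  qed
  ultimately have "(LINT x:K|lebesgue. w x \<bullet> row_div \<sigma> x) + (LINT x:K|lebesgue. frob (\<sigma> x) (jacobian w (at x))) =
      (LINT x:K|lebesgue. R x + J x)" by (simp add: set_integral_add(2)[OF iR iJ])
  also have "\<dots> = (LINT x:K|lebesgue. \<Sum>i\<in>UNIV. \<Sum>j\<in>UNIV. Df i j x (axis j 1))"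
    unfolding R_def J_def Df_def by (simp add: sum.distrib add.commute)
  also have "\<dots> = (\<Sum>i\<in>UNIV. \<Sum>j\<in>UNIV. LINT x:K|lebesgue. Df i j x (axis j 1))"
    by (rule set_integral_double_sum, rule continuous_set_integrable_lebesgue[OF cK continuous_on_subset[OF Df]]) simp
  also have "\<dots> = (\<Sum>i\<in>UNIV. \<Sum>j\<in>UNIV. \<Sum>F\<in>elt_faces K. (LINT x:F|surface_measure F. f i j x) * (normal K F \<bullet> axis j 1))"
    by (intro sum.cong refl gauss_simplex[OF K f Df])
  also have "\<dots> = (\<Sum>i\<in>UNIV. \<Sum>F\<in>elt_faces K. \<Sum>j\<in>UNIV. (LINT x:F|surface_measure F. f i j x) * (normal K F \<bullet> axis j 1))"
    by (rule sum.cong[OF refl], rule sum.swap)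
  also have "\<dots> = (\<Sum>F\<in>elt_faces K. \<Sum>i\<in>UNIV. \<Sum>j\<in>UNIV. (LINT x:F|surface_measure F. f i j x) * (normal K F \<bullet> axis j 1))"
    by (rule sum.swap)
  also have "\<dots> = (\<Sum>F\<in>elt_faces K. surf_inner F F (\<lambda>x. \<sigma> x *v normal K F) w)"
  proof (rule sum.cong[OF refl])
    fix F assume F: "F \<in> elt_faces K"
    then have Ff: "F face_of K" by (simp add: elt_faces_def facet_of_imp_face_of)
    have FK: "F \<subseteq> K" and cF: "compact F"
      using face_of_imp_subset[OF Ff] face_of_imp_compact[OF convK cK Ff] by auto
    have fF: "set_integrable (surface_measure F) F (\<lambda>x. f i j x * normal K F $ j)" for i j
    proof (rule set_integrable_surface_measure[OF cF])
      show "continuous_on F (\<lambda>x. f i j x * normal K F $ j)"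
        unfolding f_def by (intro continuous_on_mult cS' cW' continuous_on_const)
    qed (use cF in \<open>auto simp: compact_imp_closed borel_closed\<close>)
    have "(\<Sum>i\<in>UNIV. \<Sum>j\<in>UNIV. (LINT x:F|surface_measure F. f i j x) * (normal K F \<bullet> axis j 1)) =
      (\<Sum>i\<in>UNIV. \<Sum>j\<in>UNIV. (LINT x:F|surface_measure F. f i j x * normal K F $ j))"
      by (simp add: inner_axis)
    also have "\<dots> = (LINT x:F|surface_measure F. \<Sum>i\<in>UNIV. \<Sum>j\<in>UNIV. f i j x * normal K F $ j)"
      by (rule set_integral_double_sum[symmetric], rule fF)
    also have "\<dots> = surf_inner F F (\<lambda>x. S x *v normal K F) W'"
    proof -
      have "(\<Sum>i\<in>UNIV. \<Sum>j\<in>UNIV. f i j x * normal K F $ j) = (S x *v normal K F) \<bullet> W' x" for x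
        by (simp add: f_def inner_vec_def matrix_vector_mult_def sum_distrib_right) (simp add: mult_ac)
      then show ?thesis by (simp add: surf_inner_def)
    qed
    also have "\<dots> = surf_inner F F (\<lambda>x. \<sigma> x *v normal K F) w"
      by (rule surf_inner_cong) (simp_all add: S(1) W(1) subsetD[OF FK])
    finally show "(\<Sum>i\<in>UNIV. \<Sum>j\<in>UNIV. (LINT x:F|surface_measure F. f i j x) * (normal K F \<bullet> axis j 1)) =
      surf_inner F F (\<lambda>x. \<sigma> x *v normal K F) w" .
  qed
  finally show "(LINT x:K|lebesgue. w x \<bullet> row_div \<sigma> x) + (LINT x:K|lebesgue. frob (\<sigma> x) (jacobian w (at x))) =
      (\<Sum>F\<in>elt_faces K. surf_inner F F (\<lambda>x. \<sigma> x *v normal K F) w)" .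
qed

section \<open>The compliance form and the mass form\<close>

lemma stiffness_point_AE:
  assumes st: "stiffness \<Omega> \<C>" and \<Omega>: "open \<Omega>"
  obtains c where "c > 0" "AE x in lebesgue. x \<in> \<Omega> \<longrightarrow> stiffness_point (\<C> x) c"
proof -
  have \<Omega>': "\<Omega> \<inter> space lebesgue \<in> sets lebesgue" using \<Omega> by simp
  note AE_\<Omega> = AE_restrict_space_iff[OF \<Omega>']
  obtain c where c: "c > 0" "AE x in lebesgue_on \<Omega>. \<forall>\<xi>\<in>Sym. c * frob \<xi> \<xi> \<le> frob (\<C> x \<xi>) \<xi>"
    using st unfolding stiffness_def by (elim exE conjE)
  have 1: "AE x in lebesgue_on \<Omega>. (\<forall>\<xi>\<in>Sym. \<C> x \<xi> \<in> Sym) \<and>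
        (\<forall>\<xi>\<in>Sym. \<forall>\<eta>\<in>Sym. \<C> x (\<xi> + \<eta>) = \<C> x \<xi> + \<C> x \<eta>) \<and>
        (\<forall>a. \<forall>\<xi>\<in>Sym. \<C> x (a *\<^sub>R \<xi>) = a *\<^sub>R \<C> x \<xi>) \<and>
        (\<forall>\<xi>\<in>Sym. \<forall>\<eta>\<in>Sym. frob (\<C> x \<xi>) \<eta> = frob \<xi> (\<C> x \<eta>))"
    using st unfolding stiffness_def by (elim exE conjE)
  have "AE x in lebesgue_on \<Omega>. stiffness_point (\<C> x) c"
    using 1 c(2)
  proof eventually_elim
    case (elim x)
    then show ?case using c(1)
      by unfold_locales (auto simp: frob_eq_inner power2_norm_eq_inner)
  qed
  then have "AE x in lebesgue. x \<in> \<Omega> \<longrightarrow> stiffness_point (\<C> x) c" by (simp add: AE_\<Omega>)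
  with c(1) show ?thesis by (rule that)
qed

text \<open>
  Measurability of the compliance in space cannot be read off the choice operator that defines it.
  The Richardson iterates are polynomials in the measurable components \<open>m e f\<close> of the stiffness with
  respect to a basis of the symmetric matrices, and they converge to the compliance almost
  everywhere in \<open>\<Omega>\<close>.
\<close>

lemma compliance_measurable:
  assumes st: "stiffness \<Omega> \<C>" and \<Omega>: "open \<Omega>" and \<xi>: "\<xi> \<in> Sym"
  shows "\<exists>m\<in>borel_measurable lebesgue. AE x in lebesgue. x \<in> \<Omega> \<longrightarrow> compliance \<C> x \<xi> \<bullet> \<eta> = m x"
proof -
  have \<Omega>': "\<Omega> \<inter> space lebesgue \<in> sets lebesgue" using \<Omega> by simp
  note AE_\<Omega> = AE_restrict_space_iff[OF \<Omega>']
  obtain c where c: "c > 0" and point: "AE x in lebesgue. x \<in> \<Omega> \<longrightarrow> stiffness_point (\<C> x) c"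
    using stiffness_point_AE[OF st \<Omega>] .
  obtain E where E: "finite E" "E \<subseteq> Sym"
    and expand: "\<And>v. v \<in> Sym \<Longrightarrow> v = (\<Sum>e\<in>E. (v \<bullet> e) *\<^sub>R e)"
    using orthonormal_expansion[OF subspace_Sym] by blast
  have Linf_Sym: "\<forall>\<xi>\<in>Sym. \<forall>\<eta>\<in>Sym. (\<lambda>x. frob (\<C> x \<xi>) \<eta>) \<in> Linfty \<Omega>"
    using st unfolding stiffness_def by (elim conjE)
  have Linf: "(\<lambda>x. frob (\<C> x e) f) \<in> Linfty \<Omega>" if "e \<in> E" "f \<in> E" for e f
    by (rule Linf_Sym[rule_format, OF subsetD[OF E(2) that(1)] subsetD[OF E(2) that(2)]])
  have ex_b: "\<exists>b. AE x in lebesgue. x \<in> \<Omega> \<longrightarrow> \<bar>\<C> x e \<bullet> f\<bar> \<le> b" if "e \<in> E" "f \<in> E" for e f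
    using Linf[OF that] by (simp add: Linfty_def frob_eq_inner AE_\<Omega>)
  define b where "b e f = (SOME b. AE x in lebesgue. x \<in> \<Omega> \<longrightarrow> \<bar>\<C> x e \<bullet> f\<bar> \<le> b)" for e f
  have b: "AE x in lebesgue. x \<in> \<Omega> \<longrightarrow> \<bar>\<C> x e \<bullet> f\<bar> \<le> b e f" if "e \<in> E" "f \<in> E" for e f
    unfolding b_def by (rule someI_ex[OF ex_b[OF that]])
  have bd: "AE x in lebesgue. \<forall>e\<in>E. \<forall>f\<in>E. x \<in> \<Omega> \<longrightarrow> \<bar>\<C> x e \<bullet> f\<bar> \<le> b e f"
    using b by (intro AE_finite_allI E(1)) auto
  define m where "m e f x = indicator \<Omega> x *\<^sub>R (\<C> x e \<bullet> f)" for e f x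
  have m [measurable]: "m e f \<in> borel_measurable lebesgue" if "e \<in> E" "f \<in> E" for e f
    using Linf[OF that] borel_measurable_restrict_space_iff[OF \<Omega>', of "\<lambda>x. \<C> x e \<bullet> f"]
    unfolding m_def by (simp add: Linfty_def frob_eq_inner)
  \<comment> \<open>The summand 1 only makes this bound for the stiffness positive.\<close>
  define B where "B = 1 + (\<Sum>e\<in>E. norm e * (\<Sum>f\<in>E. \<bar>b e f\<bar> * norm f))"
  have B: "B > 0" unfolding B_def by (intro add_pos_nonneg sum_nonneg mult_nonneg_nonneg) auto
  define y where "y n x = rec_nat (0::real^3^3) (\<lambda>_ v. v + (c / B\<^sup>2) *\<^sub>R (\<xi> - (\<Sum>e\<in>E. \<Sum>f\<in>E. ((v \<bullet> e) * m e f x) *\<^sub>R f))) n" for n x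
  have y0: "y 0 x = 0" and ySuc: "y (Suc n) x = y n x + (c / B\<^sup>2) *\<^sub>R (\<xi> - (\<Sum>e\<in>E. \<Sum>f\<in>E. ((y n x \<bullet> e) * m e f x) *\<^sub>R f))" for n x
    by (simp_all add: y_def)
  have ym: "y n \<in> borel_measurable lebesgue" for n
  proof (induction n)
    case 0
    then show ?case by (simp add: y_def)
  next
    case (Suc n)
    have "(\<lambda>x. y n x + (c / B\<^sup>2) *\<^sub>R (\<xi> - (\<Sum>e\<in>E. \<Sum>f\<in>E. ((y n x \<bullet> e) * m e f x) *\<^sub>R f))) \<in> borel_measurable lebesgue"
      by (intro borel_measurable_add borel_measurable_scaleR borel_measurable_diff borel_measurable_sum
          borel_measurable_times borel_measurable_inner borel_measurable_const Suc m)
    then show ?case by (simp add: ySuc[abs_def])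
  qed
  have "(\<lambda>x. lim (\<lambda>n. y n x \<bullet> \<eta>)) \<in> borel_measurable lebesgue"
    by (intro borel_measurable_lim_metric borel_measurable_inner ym borel_measurable_const)
  moreover have "AE x in lebesgue. x \<in> \<Omega> \<longrightarrow> compliance \<C> x \<xi> \<bullet> \<eta> = lim (\<lambda>n. y n x \<bullet> \<eta>)"
    using point bd
  proof (eventually_elim, intro impI)
    fix x assume x: "x \<in> \<Omega>" and "x \<in> \<Omega> \<longrightarrow> stiffness_point (\<C> x) c"
      and bd: "\<forall>e\<in>E. \<forall>f\<in>E. x \<in> \<Omega> \<longrightarrow> \<bar>\<C> x e \<bullet> f\<bar> \<le> b e f"
    then interpret stiffness_point "\<C> x" c by blast
    have Ce: "\<C> x e = (\<Sum>f\<in>E. m e f x *\<^sub>R f)" if "e \<in> E" for e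
      using expand[OF C_Sym[of e]] that E(2) x by (simp add: m_def subset_iff)
    have Cv: "\<C> x v = (\<Sum>e\<in>E. \<Sum>f\<in>E. ((v \<bullet> e) * m e f x) *\<^sub>R f)" if "v \<in> Sym" for v
    proof -
      have "\<C> x v = \<C> x (\<Sum>e\<in>E. (v \<bullet> e) *\<^sub>R e)" by (rule arg_cong[OF expand[OF that]])
      also have "\<dots> = (\<Sum>e\<in>E. (v \<bullet> e) *\<^sub>R \<C> x e)" by (rule C_sum[OF E])
      also have "\<dots> = (\<Sum>e\<in>E. \<Sum>f\<in>E. ((v \<bullet> e) * m e f x) *\<^sub>R f)"
        by (rule sum.cong[OF refl]) (simp only: Ce scaleR_sum_right scaleR_scaleR)
      finally show ?thesis .
    qed
    have "norm (\<C> x v) \<le> B * norm v" if v: "v \<in> Sym" for v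
    proof -
      have "norm (\<C> x v) \<le> (\<Sum>e\<in>E. \<Sum>f\<in>E. norm (((v \<bullet> e) * m e f x) *\<^sub>R f))"
        unfolding Cv[OF v] by (intro order_trans[OF norm_sum] sum_mono norm_sum)
      also have "\<dots> \<le> (\<Sum>e\<in>E. \<Sum>f\<in>E. ((norm v * norm e) * \<bar>b e f\<bar>) * norm f)"
      proof (intro sum_mono)
        fix e f assume ef: "e \<in> E" "f \<in> E"
        have "\<bar>m e f x\<bar> \<le> \<bar>b e f\<bar>" using bd ef x by (force simp: m_def)
        then have "\<bar>v \<bullet> e\<bar> * \<bar>m e f x\<bar> \<le> (norm v * norm e) * \<bar>b e f\<bar>"
          by (intro mult_mono Cauchy_Schwarz_ineq2) auto
        then show "norm (((v \<bullet> e) * m e f x) *\<^sub>R f) \<le> ((norm v * norm e) * \<bar>b e f\<bar>) * norm f"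
          by (simp add: abs_mult mult_right_mono)
      qed
      also have "\<dots> = (\<Sum>e\<in>E. norm e * (\<Sum>f\<in>E. \<bar>b e f\<bar> * norm f)) * norm v"
        by (simp add: sum_distrib_left sum_distrib_right mult_ac)
      also have "\<dots> \<le> B * norm v" by (intro mult_right_mono) (auto simp: B_def)
      finally show ?thesis .
    qed
    then have "(\<lambda>n. y n x) \<longlonglongrightarrow> A \<xi>"
      by (intro richardson_limit[OF B _ \<xi>]) (simp_all only: y0 ySuc Cv)
    then have "(\<lambda>n. y n x \<bullet> \<eta>) \<longlonglongrightarrow> A \<xi> \<bullet> \<eta>" by (intro tendsto_inner tendsto_const)
    then show "compliance \<C> x \<xi> \<bullet> \<eta> = lim (\<lambda>n. y n x \<bullet> \<eta>)"
      by (simp add: compliance_def limI)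
  qed
  ultimately show ?thesis by (intro bexI[of _ "\<lambda>x. lim (\<lambda>n. y n x \<bullet> \<eta>)"])
qed

lemma compliance_form_integrable:
  assumes st: "stiffness \<Omega> \<C>" and \<Omega>: "open \<Omega>"
    and K: "compact K" "AE x in lebesgue. x \<in> K \<longrightarrow> x \<in> \<Omega>"
    and p: "p \<in> Pk k K Sym" and q: "q \<in> Pk m K Sym"
  shows "set_integrable lebesgue K (\<lambda>x. frob (compliance \<C> x (p x)) (q x))"
proof -
  obtain c where c: "c > 0" and point: "AE x in lebesgue. x \<in> \<Omega> \<longrightarrow> stiffness_point (\<C> x) c"
    using stiffness_point_AE[OF st \<Omega>] .
  obtain E where E: "finite E" "E \<subseteq> Sym"
    and expand: "\<And>v. v \<in> Sym \<Longrightarrow> v = (\<Sum>e\<in>E. (v \<bullet> e) *\<^sub>R e)"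
    using orthonormal_expansion[OF subspace_Sym] by blast
  have int: "set_integrable lebesgue K (\<lambda>x. (compliance \<C> x e \<bullet> f) * ((p x \<bullet> e) * (q x \<bullet> f)))"
    if e: "e \<in> E" and f: "f \<in> E" for e f
  proof -
    have "e \<in> Sym" using e E(2) by blast
    then obtain m where m: "m \<in> borel_measurable lebesgue"
      "AE x in lebesgue. x \<in> \<Omega> \<longrightarrow> compliance \<C> x e \<bullet> f = m x"
      using compliance_measurable[OF st \<Omega>] by blast
    show ?thesis
    proof (rule bounded_times_continuous_integrable[OF K(1) _ m(1)])
      show "continuous_on K (\<lambda>x. (p x \<bullet> e) * (q x \<bullet> f))"
        using Pk_continuous_on[OF p] Pk_continuous_on[OF q] by (intro continuous_intros)
      show "AE x in lebesgue. x \<in> K \<longrightarrow> compliance \<C> x e \<bullet> f = m x"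
        using m(2) K(2) by eventually_elim blast
      show "AE x in lebesgue. x \<in> K \<longrightarrow> \<bar>compliance \<C> x e \<bullet> f\<bar> \<le> (norm e / c) * norm f"
        using point K(2)
      proof (eventually_elim, intro impI)
        fix x assume "x \<in> \<Omega> \<longrightarrow> stiffness_point (\<C> x) c" "x \<in> K \<longrightarrow> x \<in> \<Omega>" "x \<in> K"
        then interpret stiffness_point "\<C> x" c by blast
        have "\<bar>A e \<bullet> f\<bar> \<le> norm (A e) * norm f" by (rule Cauchy_Schwarz_ineq2)
        also have "\<dots> \<le> (norm e / c) * norm f" using A_bound[OF \<open>e \<in> Sym\<close>] by (rule mult_right_mono) simp
        finally show "\<bar>compliance \<C> x e \<bullet> f\<bar> \<le> (norm e / c) * norm f" by (simp add: compliance_def)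
      qed
    qed
  qed
  have "set_integrable lebesgue K (\<lambda>x. \<Sum>e\<in>E. \<Sum>f\<in>E. (compliance \<C> x e \<bullet> f) * ((p x \<bullet> e) * (q x \<bullet> f)))"
    using int unfolding set_integrable_def
    by (simp only: scaleR_sum_right) (intro Bochner_Integration.integrable_sum)
  then show ?thesis
  proof (rule set_integrable_AE_eq(1)[OF complete_lebesgue])
    show "AE x in lebesgue. x \<in> K \<longrightarrow> frob (compliance \<C> x (p x)) (q x) =
        (\<Sum>e\<in>E. \<Sum>f\<in>E. (compliance \<C> x e \<bullet> f) * ((p x \<bullet> e) * (q x \<bullet> f)))"
      using point K(2)
    proof (eventually_elim, intro impI)
      fix x assume x: "x \<in> \<Omega> \<longrightarrow> stiffness_point (\<C> x) c" "x \<in> K \<longrightarrow> x \<in> \<Omega>" "x \<in> K"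
      then interpret stiffness_point "\<C> x" c by blast
      have px: "p x \<in> Sym" and qx: "q x \<in> Sym" using Pk_values[OF subspace_Sym _ x(3)] p q by auto
      have "A (p x) = A (\<Sum>e\<in>E. (p x \<bullet> e) *\<^sub>R e)" by (rule arg_cong[OF expand[OF px]])
      also have "\<dots> = (\<Sum>e\<in>E. (p x \<bullet> e) *\<^sub>R A e)" by (rule A_sum[OF E])
      finally have Ap: "A (p x) = (\<Sum>e\<in>E. (p x \<bullet> e) *\<^sub>R A e)" .
      have "A (p x) \<bullet> q x = A (p x) \<bullet> (\<Sum>f\<in>E. (q x \<bullet> f) *\<^sub>R f)" by (rule arg_cong[OF expand[OF qx]])
      also have "\<dots> = (\<Sum>e\<in>E. \<Sum>f\<in>E. (A e \<bullet> f) * ((p x \<bullet> e) * (q x \<bullet> f)))"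
        unfolding Ap
        by (simp only: inner_sum_left inner_sum_right inner_scaleR_left inner_scaleR_right sum_distrib_left,
            subst sum.swap, intro sum.cong refl, simp only: mult_ac)
      finally show "frob (compliance \<C> x (p x)) (q x) =
        (\<Sum>e\<in>E. \<Sum>f\<in>E. (compliance \<C> x e \<bullet> f) * ((p x \<bullet> e) * (q x \<bullet> f)))"
        by (simp add: frob_eq_inner compliance_def)
    qed
  qed
qed

lemma compliance_form:
  assumes st: "stiffness \<Omega> \<C>" and \<Omega>: "open \<Omega>"
    and K: "compact K" "AE x in lebesgue. x \<in> K \<longrightarrow> x \<in> \<Omega>"
  shows "q \<in> Pk k K Sym \<Longrightarrow>
      fun_linear (Pk k K Sym) K (\<lambda>p. LINT x:K|lebesgue. frob (compliance \<C> x (p x)) (q x))"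
    and "p \<in> Pk k K Sym \<Longrightarrow> q \<in> Pk k K Sym \<Longrightarrow>
      (LINT x:K|lebesgue. frob (compliance \<C> x (p x)) (q x)) = (LINT x:K|lebesgue. frob (compliance \<C> x (q x)) (p x))"
    and "p \<in> Pk k K Sym \<Longrightarrow> 0 \<le> (LINT x:K|lebesgue. frob (compliance \<C> x (p x)) (p x))"
proof -
  obtain c where c: "c > 0" and point: "AE x in lebesgue. x \<in> \<Omega> \<longrightarrow> stiffness_point (\<C> x) c"
    using stiffness_point_AE[OF st \<Omega>] .
  have pointK: "AE x in lebesgue. x \<in> K \<longrightarrow> stiffness_point (\<C> x) c"
    using point K(2) by eventually_elim blast
  note val = Pk_values[OF subspace_Sym]
  show "fun_linear (Pk k K Sym) K (\<lambda>p. LINT x:K|lebesgue. frob (compliance \<C> x (p x)) (q x))"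
    if q: "q \<in> Pk k K Sym"
  proof (rule fun_linear_integral[OF complete_lebesgue order_refl])
    show "set_integrable lebesgue K (\<lambda>x. frob (compliance \<C> x (p x)) (q x))" if "p \<in> Pk k K Sym" for p
      by (rule compliance_form_integrable[OF st \<Omega> K that q])
    fix p p' r a b assume p: "p \<in> Pk k K Sym" "p' \<in> Pk k K Sym"
      and r: "\<And>x. x \<in> K \<Longrightarrow> r x = a *\<^sub>R p x + b *\<^sub>R p' x"
    show "AE x in lebesgue. x \<in> K \<longrightarrow> frob (compliance \<C> x (r x)) (q x) =
        a * frob (compliance \<C> x (p x)) (q x) + b * frob (compliance \<C> x (p' x)) (q x)"
      using pointK
      by eventually_elim
        (auto simp: r frob_eq_inner compliance_def stiffness_point.A_lincomb val[OF p(1)] val[OF p(2)] inner_add_left)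
  qed
  show "(LINT x:K|lebesgue. frob (compliance \<C> x (p x)) (q x)) = (LINT x:K|lebesgue. frob (compliance \<C> x (q x)) (p x))"
    if p: "p \<in> Pk k K Sym" and q: "q \<in> Pk k K Sym"
  proof (rule set_integrable_AE_eq(2)[OF complete_lebesgue compliance_form_integrable[OF st \<Omega> K q p]])
    show "AE x in lebesgue. x \<in> K \<longrightarrow> frob (compliance \<C> x (p x)) (q x) = frob (compliance \<C> x (q x)) (p x)"
      using pointK
    proof (eventually_elim, intro impI)
      fix x assume "x \<in> K \<longrightarrow> stiffness_point (\<C> x) c" "x \<in> K"
      then show "frob (compliance \<C> x (p x)) (q x) = frob (compliance \<C> x (q x)) (p x)"
        using stiffness_point.A_sym[of "\<C> x" c "p x" "q x"] val[OF p] val[OF q]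
        by (simp add: frob_eq_inner compliance_def inner_commute)
    qed
  qed
  show "0 \<le> (LINT x:K|lebesgue. frob (compliance \<C> x (p x)) (p x))" if p: "p \<in> Pk k K Sym"
    unfolding set_lebesgue_integral_def
  proof (rule integral_nonneg_AE)
    show "AE x in lebesgue. 0 \<le> indicator K x *\<^sub>R frob (compliance \<C> x (p x)) (p x)"
      using pointK
      by eventually_elim
        (auto simp: frob_eq_inner compliance_def stiffness_point.A_nonneg val[OF p] split: split_indicator)
  qed
qed

lemma mass_form:
  assumes md: "mass_density \<Omega> \<rho>" and \<Omega>: "open \<Omega>"
    and K: "compact K" "AE x in lebesgue. x \<in> K \<longrightarrow> x \<in> \<Omega>"
  shows "continuous_on K v \<Longrightarrow> continuous_on K w \<Longrightarrow> set_integrable lebesgue K (\<lambda>x. (\<rho> x *\<^sub>R v x) \<bullet> w x)"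
    and "0 \<le> (LINT x:K|lebesgue. (\<rho> x *\<^sub>R v x) \<bullet> v x)"
proof -
  have \<Omega>': "\<Omega> \<inter> space lebesgue \<in> sets lebesgue" using \<Omega> by simp
  obtain r0 r1 where r: "r0 > 0" "\<forall>x\<in>\<Omega>. r0 \<le> \<rho> x \<and> \<rho> x \<le> r1" and m: "\<rho> \<in> borel_measurable (lebesgue_on \<Omega>)"
    using md unfolding mass_density_def by blast
  have m': "(\<lambda>x. indicator \<Omega> x *\<^sub>R \<rho> x) \<in> borel_measurable lebesgue"
    using m borel_measurable_restrict_space_iff[OF \<Omega>', of \<rho>] by simp
  show "set_integrable lebesgue K (\<lambda>x. (\<rho> x *\<^sub>R v x) \<bullet> w x)" if "continuous_on K v" "continuous_on K w"
  proof -
    have "set_integrable lebesgue K (\<lambda>x. \<rho> x * (v x \<bullet> w x))"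
    proof (rule bounded_times_continuous_integrable[OF K(1) _ m'])
      show "continuous_on K (\<lambda>x. v x \<bullet> w x)" using that by (intro continuous_intros)
      show "AE x in lebesgue. x \<in> K \<longrightarrow> \<rho> x = indicator \<Omega> x *\<^sub>R \<rho> x" using K(2) by eventually_elim auto
      show "AE x in lebesgue. x \<in> K \<longrightarrow> \<bar>\<rho> x\<bar> \<le> r1" using K(2) by eventually_elim (use r in force)
    qed
    then show ?thesis by simp
  qed
  show "0 \<le> (LINT x:K|lebesgue. (\<rho> x *\<^sub>R v x) \<bullet> v x)" unfolding set_lebesgue_integral_def
  proof (rule integral_nonneg_AE)
    show "AE x in lebesgue. 0 \<le> indicator K x *\<^sub>R ((\<rho> x *\<^sub>R v x) \<bullet> v x)"
      using K(2) by eventually_elim (use r in \<open>force split: split_indicator\<close>)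
  qed
qed

section \<open>Dirichlet data\<close>

text \<open>
  Near a flat point the surface is a plane disc, which is connected and consists of flat points.
\<close>

lemma flat_component_open:
  assumes "C \<in> components (flat_points \<Gamma>)"
  shows "openin (top_of_set (flat_points \<Gamma>)) C"
proof (subst openin_subopen, rule ballI)
  fix x assume x: "x \<in> C"
  have CS: "C \<subseteq> flat_points \<Gamma>" using assms by (rule in_components_subset)
  then have "x \<in> flat_points \<Gamma>" using x by blast
  then obtain r a b where r: "r > 0" and ab: "a \<noteq> 0"
    and flat: "\<Gamma> \<inter> ball x r = {y. a \<bullet> y = b} \<inter> ball x r" and x\<Gamma>: "x \<in> \<Gamma>"
    unfolding flat_points_def by (simp, elim conjE exE)
  have sub: "\<Gamma> \<inter> ball x r \<subseteq> flat_points \<Gamma>"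
  proof
    fix y assume y: "y \<in> \<Gamma> \<inter> ball x r"
    then have "y \<in> ball x r" by blast
    then obtain e where e: "e > 0" "ball y e \<subseteq> ball x r"
      using openE[OF open_ball] by blast
    have "\<Gamma> \<inter> ball y e = {z. a \<bullet> z = b} \<inter> ball y e" using flat e(2) by blast
    then show "y \<in> flat_points \<Gamma>" unfolding flat_points_def using y e(1) ab by blast
  qed
  have "connected (\<Gamma> \<inter> ball x r)"
    unfolding flat by (intro convex_connected convex_Int convex_hyperplane convex_ball)
  moreover have "C \<inter> (\<Gamma> \<inter> ball x r) \<noteq> {}" using x x\<Gamma> r by auto
  ultimately have "\<Gamma> \<inter> ball x r \<subseteq> C"
    using components_maximal[OF assms _ sub] by blast
  then have "flat_points \<Gamma> \<inter> ball x r \<subseteq> C" by (auto simp: flat_points_def)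
  then show "\<exists>U. openin (top_of_set (flat_points \<Gamma>)) U \<and> x \<in> U \<and> U \<subseteq> C"
    using \<open>x \<in> flat_points \<Gamma>\<close> r
    by (intro exI[of _ "flat_points \<Gamma> \<inter> ball x r"]) (simp add: openin_open_Int)
qed

text \<open>
  The components of the flat part are pairwise disjoint and relatively open, so a countable subcover
  of them contains them all.
\<close>

lemma countable_surface_faces: "countable (surface_faces \<Gamma>)"
proof -
  obtain \<F> where \<F>: "\<F> \<subseteq> components (flat_points \<Gamma>)" "countable \<F>" "\<Union>\<F> = \<Union>(components (flat_points \<Gamma>))"
    using Lindelof_openin[of "components (flat_points \<Gamma>)" "flat_points \<Gamma>"] flat_component_open by metis
  have "C \<in> \<F>" if C: "C \<in> components (flat_points \<Gamma>)" for C
  proof -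
    obtain x where x: "x \<in> C" using in_components_nonempty[OF C] by blast
    then have "x \<in> \<Union>\<F>" using \<F>(3) C by blast
    then obtain D where D: "D \<in> \<F>" "x \<in> D" by blast
    then have "D = C" using components_eq[of D "flat_points \<Gamma>" C] C \<F>(1) x by blast
    with D show ?thesis by simp
  qed
  then have "components (flat_points \<Gamma>) \<subseteq> \<F>" by blast
  then show ?thesis unfolding surface_faces_def using \<F>(2) countable_subset by blast
qed

lemma face_splitting_borel:
  assumes "face_splitting \<Gamma> \<Gamma>D \<Gamma>N" and "closed \<Gamma>"
  shows "\<Gamma>D \<in> sets borel" and "\<Gamma>D \<subseteq> \<Gamma>"
proof -
  obtain \<F> where \<F>: "\<F> \<subseteq> surface_faces \<Gamma>" "\<Gamma>D = \<Union>\<F>"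
    using assms(1) unfolding face_splitting_def by blast
  have closed: "closed F \<and> F \<subseteq> \<Gamma>" if F: "F \<in> \<F>" for F
  proof -
    obtain C where C: "C \<in> components (flat_points \<Gamma>)" "F = closure C"
      using F \<F>(1) unfolding surface_faces_def by blast
    have "C \<subseteq> \<Gamma>" using in_components_subset[OF C(1)] by (auto simp: flat_points_def)
    then show ?thesis using C(2) closure_minimal[OF _ assms(2)] by simp
  qed
  show "\<Gamma>D \<in> sets borel" unfolding \<F>(2)
    using countable_subset[OF \<F>(1) countable_surface_faces] closed
    by (intro sets.countable_Union) auto
  show "\<Gamma>D \<subseteq> \<Gamma>" unfolding \<F>(2) using closed by blast
qed

text \<open>
  The \<open>L\<^sup>2\<close> part of the norm of a suitable extension \<open>G\<close> controls \<open>h\<close>. The bound is Young's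
  inequality \<open>a b \<le> a\<^sup>2 / (2 \<epsilon>) + \<epsilon> b\<^sup>2 / 2\<close>, weighted so that both terms are of order \<open>\<epsilon>\<close>.
\<close>

lemma H12_pairing_bound:
  assumes fin: "finite (mesh_faces T)" and F: "F \<in> mesh_faces T" and cF: "compact F"
    and D: "\<Gamma>D \<in> sets borel" "\<Gamma>D \<subseteq> \<Gamma>"
    and \<mu>: "continuous_on F \<mu>" and \<epsilon>: "\<epsilon> > 0" and h: "H12_norm_sq T \<Gamma> \<Gamma>D h < ennreal (\<epsilon>\<^sup>2)"
  shows "set_integrable (surface_measure F) (F \<inter> \<Gamma>D) (\<lambda>x. h x \<bullet> \<mu> x)"
    and "\<bar>surf_inner F (F \<inter> \<Gamma>D) h \<mu>\<bar> \<le> \<epsilon> / 2 * (1 + surf_inner F F \<mu> \<mu>)"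
proof -
  let ?M = "surface_measure F"
  have Fb: "F \<in> sets borel" using cF by (simp add: compact_imp_closed borel_closed)
  have S: "F \<inter> \<Gamma>D \<in> sets ?M" "F \<in> sets ?M"
    using Fb D borel_subset_surface_measure by (blast intro: sets.Int)+
  obtain G where G: "\<forall>F\<in>mesh_faces T. G \<in> borel_measurable (surface_measure F) \<and>
      (AE x in surface_measure F. x \<in> \<Gamma>D \<longrightarrow> G x = h x)"
    and Gs: "slobodeckij_sq T \<Gamma> G < ennreal (\<epsilon>\<^sup>2)"
    using h unfolding H12_norm_sq_def INF_less_iff by blast
  have Gm: "G \<in> borel_measurable ?M" and Gh: "AE x in ?M. x \<in> \<Gamma>D \<longrightarrow> G x = h x" using G F by auto
  define g where "g x = indicator (F \<inter> \<Gamma>D) x *\<^sub>R G x" for x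
  have gm: "g \<in> borel_measurable ?M"
    unfolding g_def using S(1) Gm by (intro borel_measurable_scaleR borel_measurable_indicator)
  have "(\<integral>\<^sup>+x. ennreal ((norm (g x))\<^sup>2) \<partial>?M) \<le> (\<integral>\<^sup>+x\<in>\<Gamma>. ennreal ((norm (G x))\<^sup>2) \<partial>?M)"
    by (intro nn_integral_mono) (use D(2) in \<open>auto simp: g_def split: split_indicator\<close>)
  also have "\<dots> \<le> (\<Sum>F\<in>mesh_faces T. \<integral>\<^sup>+x\<in>\<Gamma>. ennreal ((norm (G x))\<^sup>2) \<partial>surface_measure F)"
    by (rule member_le_sum[OF F _ fin]) simp
  also have "\<dots> \<le> slobodeckij_sq T \<Gamma> G" unfolding slobodeckij_sq_def by simp
  finally have nn: "(\<integral>\<^sup>+x. ennreal ((norm (g x))\<^sup>2) \<partial>?M) < ennreal (\<epsilon>\<^sup>2)" using Gs by (rule le_less_trans)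
  have nm: "(\<lambda>x. (norm (g x))\<^sup>2) \<in> borel_measurable ?M"
    using gm by measurable
  have gi: "integrable ?M (\<lambda>x. (norm (g x))\<^sup>2)"
    using nn by (intro integrableI_nonneg nm) (auto simp: less_top[symmetric] dest: order_less_trans)
  have gint: "(LINT x|?M. (norm (g x))\<^sup>2) \<le> \<epsilon>\<^sup>2"
  proof -
    have "ennreal (LINT x|?M. (norm (g x))\<^sup>2) < ennreal (\<epsilon>\<^sup>2)"
      using nn_integral_eq_integral[OF gi] nn by simp
    then show ?thesis using ennreal_less_iff[of "LINT x|?M. (norm (g x))\<^sup>2" "\<epsilon>\<^sup>2"] by (simp add: integral_nonneg_AE)
  qed
  define m where "m x = indicator F x *\<^sub>R \<mu> x" for x
  have mi: "integrable ?M (\<lambda>x. (norm (m x))\<^sup>2)" and mint: "(LINT x|?M. (norm (m x))\<^sup>2) = surf_inner F F \<mu> \<mu>"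
  proof -
    have eq: "(norm (m x))\<^sup>2 = indicator F x *\<^sub>R (\<mu> x \<bullet> \<mu> x)" for x
      by (simp add: m_def dot_square_norm split: split_indicator)
    show "integrable ?M (\<lambda>x. (norm (m x))\<^sup>2)"
      unfolding eq using surf_inner_integrable[OF cF Fb order_refl \<mu> \<mu>] by (simp add: set_integrable_def)
    show "(LINT x|?M. (norm (m x))\<^sup>2) = surf_inner F F \<mu> \<mu>"
      unfolding eq by (simp add: surf_inner_def set_lebesgue_integral_def)
  qed
  have mm: "m \<in> borel_measurable ?M"
    unfolding m_def
    using borel_measurable_continuous_on_indicator[OF Fb \<mu>] by (rule borel_measurable_surface_measure)
  have am: "norm (g x \<bullet> m x) \<le> (1 / (2 * \<epsilon>)) * (norm (g x))\<^sup>2 + (\<epsilon> / 2) * (norm (m x))\<^sup>2" for x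
  proof -
    have "0 \<le> (norm (g x) / \<epsilon> - norm (m x))\<^sup>2" by simp
    then have "2 * (norm (g x) / \<epsilon>) * norm (m x) \<le> (norm (g x) / \<epsilon>)\<^sup>2 + (norm (m x))\<^sup>2"
      by (simp add: power2_diff)
    then have "(\<epsilon> / 2) * (2 * (norm (g x) / \<epsilon>) * norm (m x)) \<le> (\<epsilon> / 2) * ((norm (g x) / \<epsilon>)\<^sup>2 + (norm (m x))\<^sup>2)"
      using \<epsilon> by (intro mult_left_mono) auto
    moreover have "(\<epsilon> / 2) * (2 * (norm (g x) / \<epsilon>) * norm (m x)) = norm (g x) * norm (m x)"
      using \<epsilon> by simp
    moreover have "(\<epsilon> / 2) * ((norm (g x) / \<epsilon>)\<^sup>2 + (norm (m x))\<^sup>2) =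
        (1 / (2 * \<epsilon>)) * (norm (g x))\<^sup>2 + (\<epsilon> / 2) * (norm (m x))\<^sup>2"
      using \<epsilon> by (simp add: field_simps power2_eq_square)
    ultimately have "norm (g x) * norm (m x) \<le> (1 / (2 * \<epsilon>)) * (norm (g x))\<^sup>2 + (\<epsilon> / 2) * (norm (m x))\<^sup>2"
      by (simp only:)
    then show ?thesis using Cauchy_Schwarz_ineq2[of "g x" "m x"] by simp
  qed
  have bi: "integrable ?M (\<lambda>x. (1 / (2 * \<epsilon>)) * (norm (g x))\<^sup>2 + (\<epsilon> / 2) * (norm (m x))\<^sup>2)"
    using gi mi by (intro Bochner_Integration.integrable_add integrable_mult_right)
  have gmi: "integrable ?M (\<lambda>x. g x \<bullet> m x)"
  proof (rule Bochner_Integration.integrable_bound[OF bi])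
    show "(\<lambda>x. g x \<bullet> m x) \<in> borel_measurable ?M" using gm mm by (rule borel_measurable_inner)
    show "AE x in ?M. norm (g x \<bullet> m x) \<le> norm ((1 / (2 * \<epsilon>)) * (norm (g x))\<^sup>2 + (\<epsilon> / 2) * (norm (m x))\<^sup>2)"
      by (rule AE_I2) (rule order_trans[OF am], simp)
  qed
  have i: "set_integrable ?M (F \<inter> \<Gamma>D) (\<lambda>x. g x \<bullet> m x)"
    unfolding set_integrable_def using S(1) gmi by (rule integrable_mult_indicator)
  have ae: "AE x in ?M. x \<in> F \<inter> \<Gamma>D \<longrightarrow> h x \<bullet> \<mu> x = g x \<bullet> m x"
    using Gh by eventually_elim (auto simp: g_def m_def)
  have hg: "set_integrable ?M (F \<inter> \<Gamma>D) (\<lambda>x. h x \<bullet> \<mu> x)"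
    "surf_inner F (F \<inter> \<Gamma>D) h \<mu> = (LINT x:F \<inter> \<Gamma>D|?M. g x \<bullet> m x)"
    using set_integrable_AE_eq[OF complete_surface_measure i ae] by (simp_all only: surf_inner_def)
  show "set_integrable ?M (F \<inter> \<Gamma>D) (\<lambda>x. h x \<bullet> \<mu> x)" by (rule hg(1))
  have "(LINT x:F \<inter> \<Gamma>D|?M. g x \<bullet> m x) = (LINT x|?M. g x \<bullet> m x)"
    unfolding set_lebesgue_integral_def
    by (intro Bochner_Integration.integral_cong) (auto simp: g_def split: split_indicator)
  then have "\<bar>surf_inner F (F \<inter> \<Gamma>D) h \<mu>\<bar> \<le> (LINT x|?M. norm (g x \<bullet> m x))"
    using integral_norm_bound[of ?M "\<lambda>x. g x \<bullet> m x"] hg(2) by simp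
  also have "\<dots> \<le> (LINT x|?M. (1 / (2 * \<epsilon>)) * (norm (g x))\<^sup>2 + (\<epsilon> / 2) * (norm (m x))\<^sup>2)"
    using am by (intro integral_mono bi integrable_norm gmi) auto
  also have "\<dots> = (1 / (2 * \<epsilon>)) * (LINT x|?M. (norm (g x))\<^sup>2) + (\<epsilon> / 2) * surf_inner F F \<mu> \<mu>"
    using gi mi mint by simp
  also have "\<dots> \<le> (1 / (2 * \<epsilon>)) * \<epsilon>\<^sup>2 + (\<epsilon> / 2) * surf_inner F F \<mu> \<mu>"
    using gint \<epsilon> by (intro add_right_mono mult_left_mono) auto
  also have "\<dots> = \<epsilon> / 2 * (1 + surf_inner F F \<mu> \<mu>)"
    using \<epsilon> by (simp add: field_simps power2_eq_square)
  finally show "\<bar>surf_inner F (F \<inter> \<Gamma>D) h \<mu>\<bar> \<le> \<epsilon> / 2 * (1 + surf_inner F F \<mu> \<mu>)" .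
qed

lemma H12_static_pairing_derivative:
  assumes fin: "finite (mesh_faces T)" and F: "F \<in> mesh_faces T" and cF: "compact F"
    and D: "\<Gamma>D \<in> sets borel" "\<Gamma>D \<subseteq> \<Gamma>" and \<mu>: "continuous_on F \<mu>"
    and g: "\<And>t. t \<ge> 0 \<Longrightarrow> g t \<in> H12 T \<Gamma> \<Gamma>D" and static: "H12_static T \<Gamma> \<Gamma>D g" and t: "t \<ge> 0"
  shows "((\<lambda>r. surf_inner F (F \<inter> \<Gamma>D) (g r) \<mu>) has_real_derivative 0) (at t within {0..})"
proof -
  let ?M = "surface_measure F" and ?b = "1 + surf_inner F F \<mu> \<mu>"
  have b: "?b > 0" using surf_inner_nonneg[of F F \<mu>] by simp
  have int: "set_integrable ?M (F \<inter> \<Gamma>D) (\<lambda>x. g r x \<bullet> \<mu> x)" if r: "r \<ge> 0" for r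
  proof -
    have "H12_norm_sq T \<Gamma> \<Gamma>D (g r) < \<infinity>" using g[OF r] by (simp add: H12_def)
    then obtain e where e: "e \<ge> 0" "H12_norm_sq T \<Gamma> \<Gamma>D (g r) = ennreal e"
      by (cases "H12_norm_sq T \<Gamma> \<Gamma>D (g r)") auto
    \<comment> \<open>A positive number whose square exceeds the norm.\<close>
    have "e < (e + 1)\<^sup>2" using e(1) by (simp add: power2_eq_square algebra_simps add_pos_nonneg)
    then have "H12_norm_sq T \<Gamma> \<Gamma>D (g r) < ennreal ((e + 1)\<^sup>2)" using e by (simp add: ennreal_less_iff)
    then show ?thesis using e(1) by (intro H12_pairing_bound(1)[OF fin F cF D \<mu>, of "e + 1"]) auto
  qed
  have quot: "surf_inner F (F \<inter> \<Gamma>D) (\<lambda>x. (g s x - g t x) /\<^sub>R (s - t)) \<mu> =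
      (surf_inner F (F \<inter> \<Gamma>D) (g s) \<mu> - surf_inner F (F \<inter> \<Gamma>D) (g t) \<mu>) / (s - t)" if s: "s \<ge> 0" for s
  proof -
    have "surf_inner F (F \<inter> \<Gamma>D) (\<lambda>x. (g s x - g t x) /\<^sub>R (s - t)) \<mu> =
      inverse (s - t) * (LINT x:F \<inter> \<Gamma>D|?M. g s x \<bullet> \<mu> x - g t x \<bullet> \<mu> x)"
      by (simp add: surf_inner_def inner_diff_left)
    also have "(LINT x:F \<inter> \<Gamma>D|?M. g s x \<bullet> \<mu> x - g t x \<bullet> \<mu> x) =
      surf_inner F (F \<inter> \<Gamma>D) (g s) \<mu> - surf_inner F (F \<inter> \<Gamma>D) (g t) \<mu>"
      unfolding surf_inner_def by (rule set_integral_diff(2)[OF int[OF s] int[OF t]])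
    finally show ?thesis by (simp add: field_simps)
  qed
  have lim: "((\<lambda>s. H12_norm_sq T \<Gamma> \<Gamma>D (\<lambda>x. (g s x - g t x) /\<^sub>R (s - t))) \<longlongrightarrow> 0) (at t within {0..})"
    using static t unfolding H12_static_def by blast
  show ?thesis unfolding has_field_derivative_iff
  proof (rule tendstoI)
    fix e :: real assume e: "e > 0"
    define \<epsilon> where "\<epsilon> = e / ?b"
    have \<epsilon>: "\<epsilon> > 0" using e b by (simp add: \<epsilon>_def)
    have "\<forall>\<^sub>F s in at t within {0..}. H12_norm_sq T \<Gamma> \<Gamma>D (\<lambda>x. (g s x - g t x) /\<^sub>R (s - t)) < ennreal (\<epsilon>\<^sup>2)"
      using order_tendstoD(2)[OF lim] \<epsilon> by simp
    moreover have "\<forall>\<^sub>F s in at t within {0..}. s \<ge> 0" by (simp add: eventually_at_filter)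
    ultimately show "\<forall>\<^sub>F s in at t within {0..}.
        dist ((surf_inner F (F \<inter> \<Gamma>D) (g s) \<mu> - surf_inner F (F \<inter> \<Gamma>D) (g t) \<mu>) / (s - t)) 0 < e"
    proof eventually_elim
      case (elim s)
      have "\<bar>surf_inner F (F \<inter> \<Gamma>D) (\<lambda>x. (g s x - g t x) /\<^sub>R (s - t)) \<mu>\<bar> \<le> \<epsilon> / 2 * ?b"
        by (rule H12_pairing_bound(2)[OF fin F cF D \<mu> \<epsilon> elim(1)])
      also have "\<epsilon> / 2 * ?b = (\<epsilon> * ?b) / 2" by (rule times_divide_eq_left)
      also have "\<epsilon> * ?b = e" unfolding \<epsilon>_def using b by (intro nonzero_eq_divide_eq[THEN iffD1]) auto
      also have "e / 2 < e" using e by simp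
      finally show ?case using quot[OF elim(2)] by simp
    qed
  qed
qed

section \<open>The energy identity\<close>

lemma has_real_derivative_Ici_cong:
  assumes "(f has_real_derivative D) (at t within {0..})" and "t \<ge> 0" and "\<And>r. r \<ge> 0 \<Longrightarrow> g r = f r"
  shows "(g has_real_derivative D) (at t within {0..})"
  using assms by (intro has_field_derivative_transform_within[OF assms(1), of 1]) auto

lemma has_real_derivative_Ici_unique:
  assumes "(f has_real_derivative D) (at t within {0..})" "(f has_real_derivative E) (at t within {0..})" "t \<ge> 0"
  shows "D = E"
  using assms vector_derivative_unique_within[OF at_within_Ici_nontrivial]
  unfolding has_real_derivative_iff_has_vector_derivative by blast

lemma time_deriv_works:
  assumes "time_differentiable S u" "t \<ge> 0" "K \<in> S" "x \<in> K"
  shows "((\<lambda>r. u r K x) has_vector_derivative time_deriv u t K x) (at t within {0..})"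
  using assms unfolding time_differentiable_def time_deriv_def
  by (simp add: vector_derivative_works[symmetric])

lemma surf_linear:
  assumes F: "compact F" and S: "S \<in> sets borel" "S \<subseteq> F" and v: "continuous_on F v" and M: "linear M"
  shows "fun_linear (Pk k F (UNIV :: (real^3) set)) F (\<lambda>u. surf_inner F S (\<lambda>x. M (u x)) v)"
  unfolding fun_linear_def
proof (intro allI ballI impI)
  fix a b p q r assume p: "p \<in> Pk k F (UNIV :: (real^3) set)" and q: "q \<in> Pk k F UNIV"
    and eq: "\<forall>x\<in>F. r x = a *\<^sub>R p x + b *\<^sub>R q x"
  have c: "continuous_on F (\<lambda>x. M (f x))" if "continuous_on F f" for f
    using linear_continuous_on_compose[OF that M] .
  have "surf_inner F S (\<lambda>x. M (r x)) v = surf_inner F S (\<lambda>x. a *\<^sub>R M (p x) + b *\<^sub>R M (q x)) v"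
    using eq S(2) by (intro surf_inner_cong) (auto simp: linear_add[OF M] linear_scale[OF M] subset_iff)
  also have "\<dots> = a * surf_inner F S (\<lambda>x. M (p x)) v + b * surf_inner F S (\<lambda>x. M (q x)) v"
    by (intro surf_inner_lincomb F S v c Pk_continuous_on[OF p] Pk_continuous_on[OF q])
  finally show "surf_inner F S (\<lambda>x. M (r x)) v = a * surf_inner F S (\<lambda>x. M (p x)) v + b * surf_inner F S (\<lambda>x. M (q x)) v" .
qed

lemma surf_linear_id:
  assumes "compact F" "S \<in> sets borel" "S \<subseteq> F" "continuous_on F v"
  shows "fun_linear (Pk k F (UNIV :: (real^3) set)) F (\<lambda>u. surf_inner F S u v)"
  using surf_linear[OF assms linear_id] by simp

lemma volume_linear:
  assumes K: "compact K" and h: "continuous_on UNIV h" and eq: "AE x in lebesgue. x \<in> K \<longrightarrow> g x = h x"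
  shows "fun_linear (Pk m K (UNIV :: (real^3) set)) K (\<lambda>u. LINT x:K|lebesgue. u x \<bullet> g x)"
proof (rule fun_linear_integral[OF complete_lebesgue order_refl])
  fix p assume p: "p \<in> Pk m K (UNIV :: (real^3) set)"
  have "set_integrable lebesgue K (\<lambda>x. p x \<bullet> h x)"
    using Pk_continuous_on[OF p] continuous_on_subset[OF h, of K]
    by (intro continuous_set_integrable_lebesgue K continuous_on_inner) auto
  moreover have "AE x in lebesgue. x \<in> K \<longrightarrow> p x \<bullet> g x = p x \<bullet> h x" using eq by eventually_elim simp
  ultimately show "set_integrable lebesgue K (\<lambda>x. p x \<bullet> g x)"
    by (rule set_integrable_AE_eq(1)[OF complete_lebesgue])
qed (simp add: inner_add_left)

locale unforced_hdg =
  fixes \<Omega> \<Gamma>D \<Gamma>N :: "(real^3) set" and T :: "(real^3) set set" and k :: nat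
    and \<C> :: "real^3 \<Rightarrow> real^3^3 \<Rightarrow> real^3^3" and \<rho> :: "real^3 \<Rightarrow> real"
    and \<tau> :: stab and c c' :: real
    and f gD gN :: "real \<Rightarrow> real^3 \<Rightarrow> real^3"
  assumes poly: "lipschitz_polyhedron \<Omega>"
    and split: "face_splitting (frontier \<Omega>) \<Gamma>D \<Gamma>N"
    and mesh: "conforming_tetrahedrization T \<Omega>"
    and stiff: "stiffness \<Omega> \<C>"
    and mass: "mass_density \<Omega> \<rho>"
    and c: "c > 0" and stab: "stabilization T \<tau> c c'"
    and gD: "\<And>t. t \<ge> 0 \<Longrightarrow> gD t \<in> H12 T (frontier \<Omega>) \<Gamma>D"
    and f_zero: "\<And>t. t \<ge> 0 \<Longrightarrow> AE x in lebesgue_on \<Omega>. f t x = 0"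
    and gN_zero: "\<And>t F. t \<ge> 0 \<Longrightarrow> F \<in> mesh_faces T \<Longrightarrow>
      AE x in surface_measure F. x \<in> \<Gamma>N \<longrightarrow> gN t x = 0"
    and gD_static: "H12_static T (frontier \<Omega>) \<Gamma>D gD"
begin

lemma open_\<Omega>: "open \<Omega>" using poly by (simp add: lipschitz_polyhedron_def)

lemma finite_T: "finite T"
  using mesh unfolding conforming_tetrahedrization_def triangulation_def by blast

lemma simplex_elt: "K \<in> T \<Longrightarrow> 3 simplex K"
  using mesh unfolding conforming_tetrahedrization_def by blast

lemma elt_polytope: "K \<in> T \<Longrightarrow> polytope K"
  using simplex_elt[of K] unfolding simplex polytope_def by blast

lemma compact_elt: "K \<in> T \<Longrightarrow> compact K" using elt_polytope polytope_imp_compact by blast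

lemma convex_elt: "K \<in> T \<Longrightarrow> convex K" using elt_polytope polytope_imp_convex by blast

lemma AE_elt_inside: "K \<in> T \<Longrightarrow> AE x in lebesgue. x \<in> K \<longrightarrow> x \<in> \<Omega>"
proof -
  assume K: "K \<in> T"
  have "\<Union>T = closure \<Omega>" using mesh unfolding conforming_tetrahedrization_def by blast
  then have sub: "K \<subseteq> closure \<Omega>" using K by blast
  have "negligible (frontier \<Omega>)"
    using poly unfolding lipschitz_polyhedron_def by (intro negligible_lipschitz_boundary) auto
  then have "AE x in lebesgue. x \<notin> frontier \<Omega>" by (simp add: negligible_iff_null_sets AE_not_in)
  then show ?thesis
    by eventually_elim (use sub open_\<Omega> in \<open>auto simp: frontier_def interior_open\<close>)
qed

lemma finite_elt_faces: "K \<in> T \<Longrightarrow> finite (elt_faces K)"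
  unfolding elt_faces_def using elt_polytope by (intro finite_polytope_facets)

lemma elt_face: "K \<in> T \<Longrightarrow> F \<in> elt_faces K \<Longrightarrow> compact F \<and> F \<subseteq> K"
  unfolding elt_faces_def
  using facet_of_imp_face_of[of F K] face_of_imp_subset[of F K] face_of_imp_compact[of K F] compact_elt convex_elt
  by auto

lemma elt_face_mesh: "K \<in> T \<Longrightarrow> F \<in> elt_faces K \<Longrightarrow> F \<in> mesh_faces T"
  unfolding mesh_faces_def by blast

lemma compact_face: "F \<in> mesh_faces T \<Longrightarrow> compact F"
  unfolding mesh_faces_def using elt_face by blast

lemma borel_face: "F \<in> mesh_faces T \<Longrightarrow> F \<in> sets borel"
  using compact_face by (simp add: compact_imp_closed borel_closed)

lemma finite_mesh_faces: "finite (mesh_faces T)"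
  unfolding mesh_faces_def using finite_T finite_elt_faces by blast

lemma \<Gamma>D_borel: "\<Gamma>D \<in> sets borel" and \<Gamma>D_sub: "\<Gamma>D \<subseteq> frontier \<Omega>"
  using face_splitting_borel[OF split frontier_closed] by auto

lemma bd_inner_surf: "bd_inner T S u v = (\<Sum>K\<in>T. \<Sum>F\<in>elt_faces K. surf_inner F (F - S) (u K F) (v K F))"
  by (simp add: bd_inner_def bdK_inner_surf)

lemma part_inner_surf: "part_inner T S u v = (\<Sum>F\<in>mesh_faces T. surf_inner F (F \<inter> S) (u F) (v F))"
  by (simp add: part_inner_def surf_inner_def)

lemma Vh_Pk: "\<xi> \<in> Vh T k \<Longrightarrow> K \<in> T \<Longrightarrow> \<xi> K \<in> Pk k K Sym" by (simp add: Vh_def)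
lemma Wh_Pk: "w \<in> Wh T k \<Longrightarrow> K \<in> T \<Longrightarrow> w K \<in> Pk (k + 1) K UNIV" by (simp add: Wh_def)
lemma Mh_Pk: "\<mu> \<in> Mh T k \<Longrightarrow> F \<in> mesh_faces T \<Longrightarrow> \<mu> F \<in> Pk k F UNIV" by (simp add: Mh_def)

lemma Vh_continuous: "\<xi> \<in> Vh T k \<Longrightarrow> K \<in> T \<Longrightarrow> F \<in> elt_faces K \<Longrightarrow> continuous_on F (\<xi> K)"
  by (rule continuous_on_subset[OF Pk_continuous_on[OF Vh_Pk]], assumption, assumption)
    (rule conjunct2[OF elt_face])

lemma Wh_continuous: "w \<in> Wh T k \<Longrightarrow> K \<in> T \<Longrightarrow> F \<in> elt_faces K \<Longrightarrow> continuous_on F (w K)"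
  by (rule continuous_on_subset[OF Pk_continuous_on[OF Wh_Pk]], assumption, assumption)
    (rule conjunct2[OF elt_face])

lemma Mh_continuous: "\<mu> \<in> Mh T k \<Longrightarrow> F \<in> mesh_faces T \<Longrightarrow> continuous_on F (\<mu> F)"
  by (rule Pk_continuous_on[OF Mh_Pk])

lemma time_deriv_Vh:
  assumes "\<And>r. r \<ge> 0 \<Longrightarrow> \<sigma> r \<in> Vh T k" "time_differentiable T \<sigma>" "t \<ge> 0"
  shows "time_deriv \<sigma> t \<in> Vh T k"
  unfolding Vh_def mem_Collect_eq
proof
  fix K assume K: "K \<in> T"
  show "time_deriv \<sigma> t K \<in> Pk k K Sym"
    by (rule Pk_curve_derivative(1)[OF subspace_Sym Vh_Pk[OF assms(1) K] assms(3) time_deriv_works[OF assms(2,3) K]])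
qed

lemma time_deriv_Wh:
  assumes "\<And>r. r \<ge> 0 \<Longrightarrow> u r \<in> Wh T k" "time_differentiable T u" "t \<ge> 0"
  shows "time_deriv u t \<in> Wh T k"
  unfolding Wh_def mem_Collect_eq
proof
  fix K assume K: "K \<in> T"
  show "time_deriv u t K \<in> Pk (k + 1) K UNIV"
    by (rule Pk_curve_derivative(1)[OF subspace_UNIV Wh_Pk[OF assms(1) K] assms(3) time_deriv_works[OF assms(2,3) K]])
qed

lemma time_deriv_Mh:
  assumes "\<And>r. r \<ge> 0 \<Longrightarrow> \<mu> r \<in> Mh T k" "time_differentiable (mesh_faces T) \<mu>" "t \<ge> 0"
  shows "time_deriv \<mu> t \<in> Mh T k"
  unfolding Mh_def mem_Collect_eq
proof
  fix F assume F: "F \<in> mesh_faces T"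
  show "time_deriv \<mu> t F \<in> Pk k F UNIV"
    by (rule Pk_curve_derivative(1)[OF subspace_UNIV Mh_Pk[OF assms(1) F] assms(3) time_deriv_works[OF assms(2,3) F]])
qed

lemma jump_Pk:
  assumes v: "v \<in> Wh T k" and vhat: "vhat \<in> Mh T k" and K: "K \<in> T" and F: "F \<in> elt_faces K"
  shows "PM_jump k v vhat K F \<in> Pk k F UNIV"
proof -
  have "PM k K (\<lambda>F. v K) F \<in> Pk k F UNIV"
    by (rule PM_properties(1)[OF finite_elt_faces[OF K] conjunct1[OF elt_face[OF K]] Wh_continuous[OF v K] F])
  from Pk_lincomb[OF subspace_UNIV this Mh_Pk[OF vhat elt_face_mesh[OF K F]], where a=1 and b="-1"]
  show ?thesis by (simp add: PM_jump_def)
qed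

lemma norm_A_sq:
  "\<xi> \<in> Vh T k \<Longrightarrow> (norm_A T (compliance \<C>) \<xi>)\<^sup>2 =
    (\<Sum>K\<in>T. LINT x:K|lebesgue. frob (compliance \<C> x (\<xi> K x)) (\<xi> K x))"
  unfolding norm_A_def mat_inner_def
  by (intro real_sqrt_pow2 sum_nonneg compliance_form(3)[where k=k, OF stiff open_\<Omega>] compact_elt AE_elt_inside Vh_Pk)

lemma norm_rho_sq:
  "(norm_rho T \<rho> v)\<^sup>2 = (\<Sum>K\<in>T. LINT x:K|lebesgue. (\<rho> x *\<^sub>R v K x) \<bullet> v K x)"
  unfolding norm_rho_def vec_inner_def
  by (intro real_sqrt_pow2 sum_nonneg mass_form(2)[OF mass open_\<Omega>] compact_elt AE_elt_inside)

text \<open>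
  The norm is a square root, so its square is the form only because the form is nonnegative. The
  coercivity of the stabilization is applied to \<open>J\<close> extended by zero, since members of \<^const>\<open>L2\<close>
  have to be measurable on the whole space.
\<close>

lemma norm_tau_sq:
  assumes J: "\<And>K F. K \<in> T \<Longrightarrow> F \<in> elt_faces K \<Longrightarrow> continuous_on F (J K F)"
  shows "(norm_tau T \<tau> J)\<^sup>2 = (\<Sum>K\<in>T. \<Sum>F\<in>elt_faces K. surf_inner F F (\<lambda>x. \<tau> K F *v J K F x) (J K F))"
proof -
  have "0 \<le> bdK_inner K {} (\<lambda>F x. \<tau> K F *v J K F x) (J K)" if K: "K \<in> T" for K
  proof -
    define \<mu> where "\<mu> F x = indicator F x *\<^sub>R J K F x" for F x
    have "\<mu> F \<in> L2 (surface_measure F)" if F: "F \<in> elt_faces K" for F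
    proof -
      note cF = compact_face[OF elt_face_mesh[OF K F]] and bF = borel_face[OF elt_face_mesh[OF K F]]
      have "\<mu> F \<in> borel_measurable (surface_measure F)"
        unfolding \<mu>_def
        using borel_measurable_continuous_on_indicator[OF bF J[OF K F]] by (rule borel_measurable_surface_measure)
      moreover have "(norm (\<mu> F x))\<^sup>2 = indicator F x *\<^sub>R (J K F x \<bullet> J K F x)" for x
        by (simp add: \<mu>_def dot_square_norm split: split_indicator)
      then have "integrable (surface_measure F) (\<lambda>x. (norm (\<mu> F x))\<^sup>2)"
        using surf_inner_integrable[OF cF bF order_refl J[OF K F] J[OF K F]] by (simp add: set_integrable_def)
      ultimately show ?thesis by (simp add: L2_def)
    qed
    then have "c / diameter K * bdK_inner K {} \<mu> \<mu> \<le> bdK_inner K {} (\<lambda>F x. \<tau> K F *v \<mu> F x) \<mu>"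
      using stab K unfolding stabilization_def by blast
    moreover have "0 \<le> c / diameter K * bdK_inner K {} \<mu> \<mu>"
      using c compact_imp_bounded[OF compact_elt[OF K]] unfolding bdK_inner_surf
      by (intro mult_nonneg_nonneg divide_nonneg_nonneg sum_nonneg diameter_ge_0) (auto intro: surf_inner_nonneg)
    moreover have "bdK_inner K {} (\<lambda>F x. \<tau> K F *v \<mu> F x) \<mu> = bdK_inner K {} (\<lambda>F x. \<tau> K F *v J K F x) (J K)"
      unfolding bdK_inner_surf by (intro sum.cong refl surf_inner_cong) (auto simp: \<mu>_def)
    ultimately show ?thesis by simp
  qed
  then have "0 \<le> bd_inner T {} (\<lambda>K F x. \<tau> K F *v J K F x) J" unfolding bd_inner_def by (rule sum_nonneg)
  then show ?thesis unfolding norm_tau_def by (simp add: bd_inner_surf)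
qed

lemma norm_A_derivative:
  assumes \<sigma>: "\<And>r. r \<ge> 0 \<Longrightarrow> \<sigma> r \<in> Vh T k" "time_differentiable T \<sigma>" and t: "t \<ge> 0"
  shows "((\<lambda>r. (norm_A T (compliance \<C>) (\<sigma> r))\<^sup>2) has_real_derivative
    2 * mat_inner T (\<lambda>K x. compliance \<C> x (time_deriv \<sigma> t K x)) (\<sigma> t)) (at t within {0..})"
proof (rule has_real_derivative_Ici_cong[OF _ t norm_A_sq[OF \<sigma>(1)]])
  let ?b = "\<lambda>K p q. LINT x:K|lebesgue. frob (compliance \<C> x (p x)) (q x)"
  have "((\<lambda>r. ?b K (\<sigma> r K) (\<sigma> r K)) has_real_derivative 2 * ?b K (time_deriv \<sigma> t K) (\<sigma> t K)) (at t within {0..})"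
    if K: "K \<in> T" for K
  proof -
    note form = compliance_form[OF stiff open_\<Omega> compact_elt[OF K] AE_elt_inside[OF K], of _ k]
    show ?thesis
      by (rule Pk_curve_quadratic_derivative[where b="?b K", OF subspace_Sym Vh_Pk[OF \<sigma>(1) K] t
            time_deriv_works[OF \<sigma>(2) t K] form(1) form(2)])
  qed
  then show "((\<lambda>r. \<Sum>K\<in>T. ?b K (\<sigma> r K) (\<sigma> r K)) has_real_derivative
      2 * mat_inner T (\<lambda>K x. compliance \<C> x (time_deriv \<sigma> t K x)) (\<sigma> t)) (at t within {0..})"
    unfolding mat_inner_def sum_distrib_left by (rule DERIV_sum)
qed

lemma norm_rho_derivative:
  assumes v: "\<And>r. r \<ge> 0 \<Longrightarrow> v r \<in> Wh T k" "time_differentiable T v" and t: "t \<ge> 0"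
  shows "((\<lambda>r. (norm_rho T \<rho> (v r))\<^sup>2) has_real_derivative
    2 * vec_inner T (\<lambda>K x. \<rho> x *\<^sub>R time_deriv v t K x) (v t)) (at t within {0..})"
proof (rule has_real_derivative_Ici_cong[OF _ t norm_rho_sq])
  let ?b = "\<lambda>K p q. LINT x:K|lebesgue. (\<rho> x *\<^sub>R p x) \<bullet> q x"
  have "((\<lambda>r. ?b K (v r K) (v r K)) has_real_derivative 2 * ?b K (time_deriv v t K) (v t K)) (at t within {0..})"
    if K: "K \<in> T" for K
  proof -
    note int = mass_form(1)[OF mass open_\<Omega> compact_elt[OF K] AE_elt_inside[OF K] Pk_continuous_on Pk_continuous_on]
    have left: "fun_linear (Pk (k + 1) K UNIV) K (\<lambda>p. ?b K p q)" if q: "q \<in> Pk (k + 1) K UNIV" for q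
      by (rule fun_linear_integral[OF complete_lebesgue order_refl], rule int[OF _ q], assumption)
        (simp add: algebra_simps inner_add_left)
    have sym: "?b K p q = ?b K q p" for p q by (simp add: inner_commute)
    show ?thesis
      by (rule Pk_curve_quadratic_derivative[where b="?b K", OF subspace_UNIV Wh_Pk[OF v(1) K] t
            time_deriv_works[OF v(2) t K] left sym])
  qed
  then show "((\<lambda>r. \<Sum>K\<in>T. ?b K (v r K) (v r K)) has_real_derivative
      2 * vec_inner T (\<lambda>K x. \<rho> x *\<^sub>R time_deriv v t K x) (v t)) (at t within {0..})"
    unfolding vec_inner_def sum_distrib_left by (rule DERIV_sum)
qed

end

lemma normal_trace_continuous:
  fixes \<xi> :: "real^3 \<Rightarrow> real^3^3"
  assumes "continuous_on F \<xi>"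
  shows "continuous_on F (\<lambda>x. \<xi> x *v n)"
proof -
  have "linear (\<lambda>M :: real^3^3. M *v n)"
    by (rule linearI) (simp_all add: matrix_vector_mult_add_rdistrib scaleR_matrix_vector_assoc)
  from linear_continuous_on_compose[OF assms this] show ?thesis .
qed

lemma matrix_image_continuous:
  fixes J :: "real^3 \<Rightarrow> real^3" and M :: "real^3^3"
  assumes "continuous_on F J"
  shows "continuous_on F (\<lambda>x. M *v J x)"
  using linear_continuous_on_compose[OF assms matrix_vector_mul_linear] .

lemma Sym_adjoint: "M \<in> Sym \<Longrightarrow> (M *v a) \<bullet> b = a \<bullet> (M *v b)"
  using dot_lmul_matrix[of a M b] by (simp add: Sym_def inner_commute flip: transpose_matrix_vector)

context unforced_hdg begin

text \<open>
  The Dirichlet equation only prescribes brackets with members of \<^const>\<open>Mh\<close>. The boundary velocity is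
  itself such a member, so the differentiated equation may be tested with it, and its square has
  integral zero over the Dirichlet boundary.
\<close>

lemma boundary_velocity_zero:
  assumes uhat: "\<And>r. r \<ge> 0 \<Longrightarrow> uhat r \<in> Mh T k" "time_differentiable (mesh_faces T) uhat"
    and eq: "\<And>r \<mu>. r \<ge> 0 \<Longrightarrow> \<mu> \<in> Mh T k \<Longrightarrow> part_inner T \<Gamma>D (uhat r) \<mu> = part_inner T \<Gamma>D (\<lambda>F. gD r) \<mu>"
    and t: "t \<ge> 0" and F: "F \<in> mesh_faces T"
  shows "AE x in surface_measure F. x \<in> F \<inter> \<Gamma>D \<longrightarrow> time_deriv uhat t F x = 0"
proof -
  define \<mu> where "\<mu> = time_deriv uhat t"
  have \<mu>: "\<mu> \<in> Mh T k" unfolding \<mu>_def by (rule time_deriv_Mh[OF uhat t])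
  have D: "F \<inter> \<Gamma>D \<in> sets borel" "F \<inter> \<Gamma>D \<subseteq> F" if "F \<in> mesh_faces T" for F
    using borel_face[OF that] \<Gamma>D_borel by auto
  have "((\<lambda>r. part_inner T \<Gamma>D (uhat r) \<mu>) has_real_derivative
      (\<Sum>F\<in>mesh_faces T. surf_inner F (F \<inter> \<Gamma>D) (\<mu> F) (\<mu> F))) (at t within {0..})"
    unfolding part_inner_surf
  proof (rule DERIV_sum)
    fix F assume F: "F \<in> mesh_faces T"
    note lin = surf_linear_id[OF compact_face[OF F] D[OF F] Mh_continuous[OF \<mu> F]]
    show "((\<lambda>r. surf_inner F (F \<inter> \<Gamma>D) (uhat r F) (\<mu> F)) has_real_derivative
        surf_inner F (F \<inter> \<Gamma>D) (\<mu> F) (\<mu> F)) (at t within {0..})"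
      using Pk_curve_derivative(2)[OF subspace_UNIV Mh_Pk[OF uhat(1) F] t time_deriv_works[OF uhat(2) t F] lin]
      by (simp add: \<mu>_def)
  qed
  moreover have "((\<lambda>r. part_inner T \<Gamma>D (uhat r) \<mu>) has_real_derivative (\<Sum>F\<in>mesh_faces T. 0)) (at t within {0..})"
  proof (rule has_real_derivative_Ici_cong[OF _ t eq[OF _ \<mu>]])
    show "((\<lambda>r. part_inner T \<Gamma>D (\<lambda>F. gD r) \<mu>) has_real_derivative (\<Sum>F\<in>mesh_faces T. 0)) (at t within {0..})"
      unfolding part_inner_surf
    proof (rule DERIV_sum)
      fix F assume F: "F \<in> mesh_faces T"
      show "((\<lambda>r. surf_inner F (F \<inter> \<Gamma>D) (gD r) (\<mu> F)) has_real_derivative 0) (at t within {0..})"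
        by (rule H12_static_pairing_derivative[OF finite_mesh_faces F compact_face[OF F] \<Gamma>D_borel \<Gamma>D_sub
              Mh_continuous[OF \<mu> F] gD gD_static t])
    qed
  qed
  ultimately have "(\<Sum>F\<in>mesh_faces T. surf_inner F (F \<inter> \<Gamma>D) (\<mu> F) (\<mu> F)) = (\<Sum>F\<in>mesh_faces T. 0)"
    using t by (rule has_real_derivative_Ici_unique)
  then have "\<forall>F\<in>mesh_faces T. surf_inner F (F \<inter> \<Gamma>D) (\<mu> F) (\<mu> F) = 0"
    using sum_nonneg_eq_0_iff[OF finite_mesh_faces, of "\<lambda>F. surf_inner F (F \<inter> \<Gamma>D) (\<mu> F) (\<mu> F)"]
    by (simp add: surf_inner_nonneg)
  then have "surf_inner F (F \<inter> \<Gamma>D) (\<mu> F) (\<mu> F) = 0" using F by blast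
  from surf_inner_eq_0_AE[OF compact_face[OF F] D[OF F] Mh_continuous[OF \<mu> F] this]
  show ?thesis by (simp add: \<mu>_def)
qed

lemma constitutive_equation_derivative:
  assumes \<sigma>: "\<And>r. r \<ge> 0 \<Longrightarrow> \<sigma> r \<in> Vh T k" "time_differentiable T \<sigma>"
    and u: "\<And>r. r \<ge> 0 \<Longrightarrow> u r \<in> Wh T k" "time_differentiable T u"
    and uhat: "\<And>r. r \<ge> 0 \<Longrightarrow> uhat r \<in> Mh T k" "time_differentiable (mesh_faces T) uhat"
    and \<xi>: "\<xi> \<in> Vh T k" and t: "t \<ge> 0"
    and eq: "\<And>r. r \<ge> 0 \<Longrightarrow> mat_inner T (\<lambda>K x. compliance \<C> x (\<sigma> r K x)) \<xi>
          + vec_inner T (u r) (\<lambda>K. row_div (\<xi> K))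
          - bd_inner T {} (\<lambda>K. uhat r) (\<lambda>K F x. \<xi> K x *v normal K F) = 0"
  shows "mat_inner T (\<lambda>K x. compliance \<C> x (time_deriv \<sigma> t K x)) \<xi>
          + vec_inner T (time_deriv u t) (\<lambda>K. row_div (\<xi> K))
          - bd_inner T {} (\<lambda>K. time_deriv uhat t) (\<lambda>K F x. \<xi> K x *v normal K F) = 0"
proof -
  have "((\<lambda>r. mat_inner T (\<lambda>K x. compliance \<C> x (\<sigma> r K x)) \<xi>) has_real_derivative
      mat_inner T (\<lambda>K x. compliance \<C> x (time_deriv \<sigma> t K x)) \<xi>) (at t within {0..})"
    unfolding mat_inner_def
  proof (rule DERIV_sum)
    fix K assume K: "K \<in> T"
    show "((\<lambda>r. LINT x:K|lebesgue. frob (compliance \<C> x (\<sigma> r K x)) (\<xi> K x)) has_real_derivative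
        (LINT x:K|lebesgue. frob (compliance \<C> x (time_deriv \<sigma> t K x)) (\<xi> K x))) (at t within {0..})"
      by (rule Pk_curve_derivative(2)[OF subspace_Sym Vh_Pk[OF \<sigma>(1) K] t time_deriv_works[OF \<sigma>(2) t K]
            compliance_form(1)[OF stiff open_\<Omega> compact_elt[OF K] AE_elt_inside[OF K] Vh_Pk[OF \<xi> K]]])
  qed
  moreover have "((\<lambda>r. vec_inner T (u r) (\<lambda>K. row_div (\<xi> K))) has_real_derivative
      vec_inner T (time_deriv u t) (\<lambda>K. row_div (\<xi> K))) (at t within {0..})"
    unfolding vec_inner_def
  proof (rule DERIV_sum)
    fix K assume K: "K \<in> T"
    obtain g where g: "continuous_on UNIV g" "AE x in lebesgue. x \<in> K \<longrightarrow> row_div (\<xi> K) x = g x"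
      using element_integration_by_parts(2)[OF simplex_elt[OF K] Vh_Pk[OF \<xi> K] Wh_Pk[OF u(1)[OF t] K]]
      by (elim exE conjE)
    show "((\<lambda>r. LINT x:K|lebesgue. u r K x \<bullet> row_div (\<xi> K) x) has_real_derivative
        (LINT x:K|lebesgue. time_deriv u t K x \<bullet> row_div (\<xi> K) x)) (at t within {0..})"
      by (rule Pk_curve_derivative(2)[OF subspace_UNIV Wh_Pk[OF u(1) K] t time_deriv_works[OF u(2) t K]
            volume_linear[OF compact_elt[OF K] g]])
  qed
  moreover have "((\<lambda>r. bd_inner T {} (\<lambda>K. uhat r) (\<lambda>K F x. \<xi> K x *v normal K F)) has_real_derivative
      bd_inner T {} (\<lambda>K. time_deriv uhat t) (\<lambda>K F x. \<xi> K x *v normal K F)) (at t within {0..})"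
    unfolding bd_inner_surf Diff_empty
  proof (intro DERIV_sum)
    fix K F assume K: "K \<in> T" and F: "F \<in> elt_faces K"
    note FM = elt_face_mesh[OF K F]
    show "((\<lambda>r. surf_inner F F (uhat r F) (\<lambda>x. \<xi> K x *v normal K F)) has_real_derivative
        surf_inner F F (time_deriv uhat t F) (\<lambda>x. \<xi> K x *v normal K F)) (at t within {0..})"
      by (rule Pk_curve_derivative(2)[OF subspace_UNIV Mh_Pk[OF uhat(1) FM] t time_deriv_works[OF uhat(2) t FM]
            surf_linear_id[OF compact_face[OF FM] borel_face[OF FM] order_refl
              normal_trace_continuous[OF Vh_continuous[OF \<xi> K F]]]])
  qed
  ultimately have "((\<lambda>r. mat_inner T (\<lambda>K x. compliance \<C> x (\<sigma> r K x)) \<xi>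
          + vec_inner T (u r) (\<lambda>K. row_div (\<xi> K))
          - bd_inner T {} (\<lambda>K. uhat r) (\<lambda>K F x. \<xi> K x *v normal K F)) has_real_derivative
      mat_inner T (\<lambda>K x. compliance \<C> x (time_deriv \<sigma> t K x)) \<xi>
          + vec_inner T (time_deriv u t) (\<lambda>K. row_div (\<xi> K))
          - bd_inner T {} (\<lambda>K. time_deriv uhat t) (\<lambda>K F x. \<xi> K x *v normal K F)) (at t within {0..})"
    by (intro DERIV_add DERIV_diff)
  moreover have "((\<lambda>r. mat_inner T (\<lambda>K x. compliance \<C> x (\<sigma> r K x)) \<xi>
          + vec_inner T (u r) (\<lambda>K. row_div (\<xi> K))
          - bd_inner T {} (\<lambda>K. uhat r) (\<lambda>K F x. \<xi> K x *v normal K F)) has_real_derivative 0) (at t within {0..})"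
    by (rule has_real_derivative_Ici_cong[OF DERIV_const t eq])
  ultimately show ?thesis using t by (rule has_real_derivative_Ici_unique)
qed

lemma body_force_zero: "t \<ge> 0 \<Longrightarrow> vec_inner T (\<lambda>K. f t) w = 0"
proof -
  assume t: "t \<ge> 0"
  have "\<Omega> \<inter> space lebesgue \<in> sets lebesgue" using open_\<Omega> by simp
  from f_zero[OF t] have f0: "AE x in lebesgue. x \<in> \<Omega> \<longrightarrow> f t x = 0"
    unfolding AE_restrict_space_iff[OF \<open>\<Omega> \<inter> space lebesgue \<in> sets lebesgue\<close>] .
  have "(LINT x:K|lebesgue. f t x \<bullet> w K x) = 0" if K: "K \<in> T" for K
    unfolding set_lebesgue_integral_def
  proof (rule integral_eq_zero_AE)
    show "AE x in lebesgue. indicator K x *\<^sub>R (f t x \<bullet> w K x) = 0"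
      using f0 AE_elt_inside[OF K] by eventually_elim (auto split: split_indicator)
  qed
  then show ?thesis by (simp add: vec_inner_def)
qed

lemma traction_zero: "t \<ge> 0 \<Longrightarrow> part_inner T \<Gamma>N (\<lambda>F. gN t) \<mu> = 0"
proof -
  assume t: "t \<ge> 0"
  have "surf_inner F (F \<inter> \<Gamma>N) (gN t) (\<mu> F) = 0" if F: "F \<in> mesh_faces T" for F
    using gN_zero[OF t F] by (intro surf_inner_AE_0) (auto elim: eventually_mono)
  then show ?thesis by (simp add: part_inner_surf)
qed

text \<open>
  The work of the stabilization. The jump in the flux is left general, since it is formed from the
  velocities for one choice of flux and from the displacements for the other.
\<close>

lemma energy_derivative:
  assumes sol: "hdg_solution T k \<Gamma>D \<Gamma>N (compliance \<C>) \<rho> f gD gN (\<lambda>t. flux k \<tau> s (\<sigma> t) (v t) (vhat t)) \<sigma> u uhat"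
    and v: "v t \<in> Wh T k" and vhat: "vhat t \<in> Mh T k" and t: "t \<ge> 0"
  defines "J \<equiv> PM_jump k (v t) (vhat t)"
  shows "((\<lambda>r. 1/2 * (norm_A T (compliance \<C>) (\<sigma> r))\<^sup>2 + 1/2 * (norm_rho T \<rho> (time_deriv u r))\<^sup>2)
    has_real_derivative
      s * (\<Sum>K\<in>T. \<Sum>F\<in>elt_faces K. surf_inner F F (\<lambda>x. \<tau> K F *v J K F x) (time_deriv u t K)
        - surf_inner F F (\<lambda>x. \<tau> K F *v J K F x) (time_deriv uhat t F))) (at t within {0..})"
proof -
  have spaces: "\<forall>t\<ge>0. \<sigma> t \<in> Vh T k \<and> u t \<in> Wh T k \<and> uhat t \<in> Mh T k"
    and d\<sigma>: "time_differentiable T \<sigma>" and du: "time_differentiable T u" and du': "time_differentiable T (time_deriv u)"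
    and duhat: "time_differentiable (mesh_faces T) uhat"
    and eqs: "\<forall>t\<ge>0. \<forall>\<xi>\<in>Vh T k. \<forall>w\<in>Wh T k. \<forall>\<mu>\<in>Mh T k.
        mat_inner T (\<lambda>K x. compliance \<C> x (\<sigma> t K x)) \<xi>
          + vec_inner T (u t) (\<lambda>K. row_div (\<xi> K))
          - bd_inner T {} (\<lambda>K. uhat t) (\<lambda>K F x. \<xi> K x *v normal K F) = 0 \<and>
        mat_inner T (\<sigma> t) (\<lambda>K x. jacobian (w K) (at x))
          - bd_inner T {} (flux k \<tau> s (\<sigma> t) (v t) (vhat t)) (\<lambda>K F. w K)
          + vec_inner T (\<lambda>K x. \<rho> x *\<^sub>R time_deriv (time_deriv u) t K x) w
          = - vec_inner T (\<lambda>K. f t) w \<and>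
        bd_inner T \<Gamma>D (flux k \<tau> s (\<sigma> t) (v t) (vhat t)) (\<lambda>K. \<mu>) = part_inner T \<Gamma>N (\<lambda>F. gN t) \<mu> \<and>
        part_inner T \<Gamma>D (uhat t) \<mu> = part_inner T \<Gamma>D (\<lambda>F. gD t) \<mu>"
    using sol unfolding hdg_solution_def by - (elim conjE, assumption)+
  have \<sigma>: "\<sigma> r \<in> Vh T k" and u: "u r \<in> Wh T k" and uhat: "uhat r \<in> Mh T k" if "r \<ge> 0" for r
    using spaces that by auto
  define u' where "u' = time_deriv u t"
  define uhat' where "uhat' = time_deriv uhat t"
  define q where "q = flux k \<tau> s (\<sigma> t) (v t) (vhat t)"
  define \<tau>J where "\<tau>J K F x = \<tau> K F *v J K F x" for K F x
  define \<sigma>n where "\<sigma>n K F x = \<sigma> t K x *v normal K F" for K F x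
  have u': "u' \<in> Wh T k" unfolding u'_def by (rule time_deriv_Wh[OF u du t])
  have uhat': "uhat' \<in> Mh T k" unfolding uhat'_def by (rule time_deriv_Mh[OF uhat duhat t])
  have c\<tau>J: "continuous_on F (\<tau>J K F)" if "K \<in> T" "F \<in> elt_faces K" for K F
    unfolding \<tau>J_def J_def by (intro matrix_image_continuous Pk_continuous_on[OF jump_Pk[OF v vhat that]])
  have c\<sigma>n: "continuous_on F (\<sigma>n K F)" if "K \<in> T" "F \<in> elt_faces K" for K F
    unfolding \<sigma>n_def by (intro normal_trace_continuous Vh_continuous[OF \<sigma>[OF t] that])
  have q_eq: "q K F = (\<lambda>x. 1 *\<^sub>R \<sigma>n K F x + s *\<^sub>R \<tau>J K F x)" for K F
    by (simp add: q_def flux_def \<sigma>n_def \<tau>J_def J_def)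
  have cq: "continuous_on F (q K F)" if "K \<in> T" "F \<in> elt_faces K" for K F
    unfolding q_eq by (intro continuous_intros c\<sigma>n c\<tau>J that)
  have cu': "continuous_on F (u' K)" if "K \<in> T" "F \<in> elt_faces K" for K F
    by (rule Wh_continuous[OF u' that])
  have cuhat': "continuous_on F (uhat' F)" if "K \<in> T" "F \<in> elt_faces K" for K F
    by (rule Mh_continuous[OF uhat' elt_face_mesh[OF that]])
  have q_split: "surf_inner F F (q K F) w = surf_inner F F (\<sigma>n K F) w + s * surf_inner F F (\<tau>J K F) w"
    if K: "K \<in> T" and F: "F \<in> elt_faces K" and w: "continuous_on F w" for K F w
    unfolding q_eq
    using surf_inner_lincomb[OF compact_face[OF elt_face_mesh[OF K F]] borel_face[OF elt_face_mesh[OF K F]] order_refl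
        c\<sigma>n[OF K F] c\<tau>J[OF K F] w, where a=1 and b=s] by simp

  \<comment> \<open>The differentiated constitutive equation, tested with the stress itself.\<close>
  have "mat_inner T (\<lambda>K x. compliance \<C> x (\<sigma> r K x)) (\<sigma> t)
          + vec_inner T (u r) (\<lambda>K. row_div (\<sigma> t K))
          - bd_inner T {} (\<lambda>K. uhat r) (\<lambda>K F x. \<sigma> t K x *v normal K F) = 0" if r: "r \<ge> 0" for r
    by (rule eqs[rule_format, OF r \<sigma>[OF t] u[OF r] uhat[OF r], THEN conjunct1])
  from constitutive_equation_derivative[OF \<sigma> d\<sigma> u du uhat duhat \<sigma>[OF t] t this]
  have E1: "mat_inner T (\<lambda>K x. compliance \<C> x (time_deriv \<sigma> t K x)) (\<sigma> t) + vec_inner T u' (\<lambda>K. row_div (\<sigma> t K))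
      - bd_inner T {} (\<lambda>K. uhat') \<sigma>n = 0"
    by (simp add: u'_def uhat'_def \<sigma>n_def[abs_def])

  \<comment> \<open>The momentum equation, tested with the velocity.\<close>
  have E2: "mat_inner T (\<sigma> t) (\<lambda>K x. jacobian (u' K) (at x)) - bd_inner T {} q (\<lambda>K F. u' K)
      + vec_inner T (\<lambda>K x. \<rho> x *\<^sub>R time_deriv (time_deriv u) t K x) u' = 0"
    using eqs[rule_format, OF t \<sigma>[OF t] u' uhat', THEN conjunct2, THEN conjunct1] body_force_zero[OF t]
    by (simp add: q_def)

  have E3: "vec_inner T u' (\<lambda>K. row_div (\<sigma> t K)) + mat_inner T (\<sigma> t) (\<lambda>K x. jacobian (u' K) (at x)) =
      (\<Sum>K\<in>T. \<Sum>F\<in>elt_faces K. surf_inner F F (\<sigma>n K F) (u' K))"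
    unfolding vec_inner_def mat_inner_def sum.distrib[symmetric] \<sigma>n_def
    by (rule sum.cong[OF refl])
      (rule element_integration_by_parts(1)[OF simplex_elt Vh_Pk[OF \<sigma>[OF t]] Wh_Pk[OF u']])

  \<comment> \<open>The flux does no work on the boundary velocity: off the Dirichlet boundary by the transmission
    condition, and on it because the boundary velocity vanishes there.\<close>
  have E4: "(\<Sum>K\<in>T. \<Sum>F\<in>elt_faces K. surf_inner F F (q K F) (uhat' F)) = 0"
  proof -
    have "surf_inner F F (q K F) (uhat' F) = surf_inner F (F - \<Gamma>D) (q K F) (uhat' F)"
      if K: "K \<in> T" and F: "F \<in> elt_faces K" for K F
    proof -
      note FM = elt_face_mesh[OF K F]
      have AE0: "AE x in surface_measure F. x \<in> F \<inter> \<Gamma>D \<longrightarrow> uhat' F x = 0"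
        unfolding uhat'_def
      proof (rule boundary_velocity_zero[OF _ duhat _ t FM])
        fix r :: real and \<mu> assume r: "r \<ge> 0" and \<mu>: "\<mu> \<in> Mh T k"
        show "part_inner T \<Gamma>D (uhat r) \<mu> = part_inner T \<Gamma>D (\<lambda>F. gD r) \<mu>"
          by (rule eqs[rule_format, OF r \<sigma>[OF r] u[OF r] \<mu>, THEN conjunct2, THEN conjunct2, THEN conjunct2])
      qed (rule uhat)
      have zero: "surf_inner F (F \<inter> \<Gamma>D) (q K F) (uhat' F) = 0"
        by (rule trans[OF surf_inner_commute surf_inner_AE_0[OF AE0]])
      have b: "F - \<Gamma>D \<in> sets borel" "F - \<Gamma>D \<subseteq> F" "F \<inter> \<Gamma>D \<in> sets borel" "F \<inter> \<Gamma>D \<subseteq> F"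
        using borel_face[OF FM] \<Gamma>D_borel by auto
      have "(LINT x:(F - \<Gamma>D) \<union> (F \<inter> \<Gamma>D)|surface_measure F. q K F x \<bullet> uhat' F x) =
          surf_inner F (F - \<Gamma>D) (q K F) (uhat' F) + surf_inner F (F \<inter> \<Gamma>D) (q K F) (uhat' F)"
        unfolding surf_inner_def
        using surf_inner_integrable[OF compact_face[OF FM] b(1,2) cq[OF K F] cuhat'[OF K F]]
          surf_inner_integrable[OF compact_face[OF FM] b(3,4) cq[OF K F] cuhat'[OF K F]]
        by (intro set_integral_Un) auto
      moreover have "(F - \<Gamma>D) \<union> (F \<inter> \<Gamma>D) = F" by blast
      ultimately show ?thesis using zero by (simp add: surf_inner_def)
    qed
    then have "(\<Sum>K\<in>T. \<Sum>F\<in>elt_faces K. surf_inner F F (q K F) (uhat' F)) = bd_inner T \<Gamma>D q (\<lambda>K. uhat')"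
      unfolding bd_inner_surf by (intro sum.cong refl)
    also have "\<dots> = 0"
      using eqs[rule_format, OF t \<sigma>[OF t] u[OF t] uhat', THEN conjunct2, THEN conjunct2, THEN conjunct1]
        traction_zero[OF t] by (simp add: q_def)
    finally show ?thesis .
  qed
  have E2': "bd_inner T {} q (\<lambda>K F. u' K) =
      (\<Sum>K\<in>T. \<Sum>F\<in>elt_faces K. surf_inner F F (\<sigma>n K F) (u' K)) + s * (\<Sum>K\<in>T. \<Sum>F\<in>elt_faces K. surf_inner F F (\<tau>J K F) (u' K))"
    unfolding bd_inner_surf Diff_empty sum_distrib_left sum.distrib[symmetric]
    by (intro sum.cong refl q_split cu')
  have E4': "(\<Sum>K\<in>T. \<Sum>F\<in>elt_faces K. surf_inner F F (q K F) (uhat' F)) =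
      bd_inner T {} (\<lambda>K. uhat') \<sigma>n + s * (\<Sum>K\<in>T. \<Sum>F\<in>elt_faces K. surf_inner F F (\<tau>J K F) (uhat' F))"
    unfolding bd_inner_surf Diff_empty sum_distrib_left sum.distrib[symmetric]
  proof (intro sum.cong refl)
    fix K F assume K: "K \<in> T" and F: "F \<in> elt_faces K"
    show "surf_inner F F (q K F) (uhat' F) = surf_inner F F (uhat' F) (\<sigma>n K F) + s * surf_inner F F (\<tau>J K F) (uhat' F)"
      unfolding q_split[OF K F cuhat'[OF K F]] by (simp only: surf_inner_commute[of F F "uhat' F"])
  qed
  have total: "mat_inner T (\<lambda>K x. compliance \<C> x (time_deriv \<sigma> t K x)) (\<sigma> t)
      + vec_inner T (\<lambda>K x. \<rho> x *\<^sub>R time_deriv (time_deriv u) t K x) u' =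
      s * (\<Sum>K\<in>T. \<Sum>F\<in>elt_faces K. surf_inner F F (\<tau>J K F) (u' K))
      - s * (\<Sum>K\<in>T. \<Sum>F\<in>elt_faces K. surf_inner F F (\<tau>J K F) (uhat' F))"
    using E1 E2 E3 E4 E2' E4' by linarith
  have "((\<lambda>r. 1/2 * (norm_A T (compliance \<C>) (\<sigma> r))\<^sup>2 + 1/2 * (norm_rho T \<rho> (time_deriv u r))\<^sup>2) has_real_derivative
      1/2 * (2 * mat_inner T (\<lambda>K x. compliance \<C> x (time_deriv \<sigma> t K x)) (\<sigma> t))
      + 1/2 * (2 * vec_inner T (\<lambda>K x. \<rho> x *\<^sub>R time_deriv (time_deriv u) t K x) u')) (at t within {0..})"
    unfolding u'_def
    by (intro DERIV_add DERIV_cmult norm_A_derivative \<sigma> d\<sigma> norm_rho_derivative time_deriv_Wh u du du' t)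
  also have "1/2 * (2 * mat_inner T (\<lambda>K x. compliance \<C> x (time_deriv \<sigma> t K x)) (\<sigma> t))
      + 1/2 * (2 * vec_inner T (\<lambda>K x. \<rho> x *\<^sub>R time_deriv (time_deriv u) t K x) u') =
      s * (\<Sum>K\<in>T. \<Sum>F\<in>elt_faces K. surf_inner F F (\<tau>J K F) (u' K) - surf_inner F F (\<tau>J K F) (uhat' F))"
    using total by (simp add: sum_subtractf right_diff_distrib)
  also have "\<tau>J = (\<lambda>K F x. \<tau> K F *v J K F x)" by (intro ext) (rule \<tau>J_def)
  finally show ?thesis unfolding u'_def uhat'_def .
qed

text \<open>
  As \<open>\<tau> J\<close> is a face polynomial, the velocity in \<open>energy_derivative\<close> may be replaced by its
  projection, which turns the bracket into the squared norm of the jump.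
\<close>

lemma derivative_flux_energy:
  assumes sol: "hdg_solution T k \<Gamma>D \<Gamma>N (compliance \<C>) \<rho> f gD gN
      (\<lambda>t. flux k \<tau> s (\<sigma> t) (time_deriv u t) (time_deriv uhat t)) \<sigma> u uhat" and t: "t \<ge> 0"
  shows "((\<lambda>r. 1/2 * (norm_A T (compliance \<C>) (\<sigma> r))\<^sup>2 + 1/2 * (norm_rho T \<rho> (time_deriv u r))\<^sup>2)
    has_real_derivative s * (norm_tau T \<tau> (PM_jump k (time_deriv u t) (time_deriv uhat t)))\<^sup>2) (at t within {0..})"
proof -
  have spaces: "\<forall>t\<ge>0. \<sigma> t \<in> Vh T k \<and> u t \<in> Wh T k \<and> uhat t \<in> Mh T k"
    and du: "time_differentiable T u" and duhat: "time_differentiable (mesh_faces T) uhat"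
    using sol unfolding hdg_solution_def by - (elim conjE, assumption)+
  define u' where "u' = time_deriv u t"
  define uhat' where "uhat' = time_deriv uhat t"
  have u': "u' \<in> Wh T k" unfolding u'_def using spaces by (intro time_deriv_Wh du t) auto
  have uhat': "uhat' \<in> Mh T k" unfolding uhat'_def using spaces by (intro time_deriv_Mh duhat t) auto
  define J where "J = PM_jump k u' uhat'"
  note JP = jump_Pk[OF u' uhat', folded J_def]
  have "surf_inner F F (\<lambda>x. \<tau> K F *v J K F x) (u' K) - surf_inner F F (\<lambda>x. \<tau> K F *v J K F x) (uhat' F) =
      surf_inner F F (\<lambda>x. \<tau> K F *v J K F x) (J K F)" if K: "K \<in> T" and F: "F \<in> elt_faces K" for K F
  proof -
    note FM = elt_face_mesh[OF K F]
    let ?\<mu> = "\<lambda>x. \<tau> K F *v J K F x" and ?P = "PM k K (\<lambda>F. u' K) F"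
    have \<mu>: "?\<mu> \<in> Pk k F UNIV" by (rule Pk_linear_image[OF matrix_vector_mul_linear JP[OF K F]]) simp
    have PM1: "?P \<in> Pk k F UNIV"
      by (rule PM_properties(1)[OF finite_elt_faces[OF K] conjunct1[OF elt_face[OF K]] Wh_continuous[OF u' K] F])
    have "surf_inner F F (\<lambda>x. 1 *\<^sub>R ?P x + (-1) *\<^sub>R uhat' F x) ?\<mu> =
        1 * surf_inner F F ?P ?\<mu> + (-1) * surf_inner F F (uhat' F) ?\<mu>"
      by (rule surf_inner_lincomb[OF compact_face[OF FM] borel_face[OF FM] order_refl
            Pk_continuous_on[OF PM1] Mh_continuous[OF uhat' FM] Pk_continuous_on[OF \<mu>]])
    also have "surf_inner F F ?P ?\<mu> = surf_inner F F (u' K) ?\<mu>" 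
      by (rule PM_properties(2)[OF finite_elt_faces[OF K] conjunct1[OF elt_face[OF K]] Wh_continuous[OF u' K] F \<mu>])
    finally have "surf_inner F F (J K F) ?\<mu> = surf_inner F F (u' K) ?\<mu> - surf_inner F F (uhat' F) ?\<mu>"
      by (simp add: J_def PM_jump_def)
    then show ?thesis by (simp add: surf_inner_commute)
  qed
  then have "(\<Sum>K\<in>T. \<Sum>F\<in>elt_faces K. surf_inner F F (\<lambda>x. \<tau> K F *v J K F x) (u' K)
      - surf_inner F F (\<lambda>x. \<tau> K F *v J K F x) (uhat' F)) =
      (\<Sum>K\<in>T. \<Sum>F\<in>elt_faces K. surf_inner F F (\<lambda>x. \<tau> K F *v J K F x) (J K F))"
    by (intro sum.cong refl)
  also have "\<dots> = (norm_tau T \<tau> J)\<^sup>2"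
    by (rule norm_tau_sq[OF Pk_continuous_on[OF JP], symmetric])
  finally have "(\<Sum>K\<in>T. \<Sum>F\<in>elt_faces K. surf_inner F F (\<lambda>x. \<tau> K F *v J K F x) (u' K)
      - surf_inner F F (\<lambda>x. \<tau> K F *v J K F x) (uhat' F)) = (norm_tau T \<tau> J)\<^sup>2" .
  with energy_derivative[OF sol _ _ t] u' uhat' show ?thesis
    by (simp add: J_def u'_def uhat'_def)
qed

text \<open>
  The stabilization is symmetric, so half of this derivative is the bracket of \<open>\<tau> J\<close> with the time
  derivative of the jump; the projection is dropped there because \<open>\<tau> J\<close> is a face polynomial. The
  jump itself is replaced by the representative from \<open>projected_curve\<close>, whose values at points can
  be differentiated.
\<close>

lemma norm_tau_jump_derivative:
  assumes u: "\<And>r. r \<ge> 0 \<Longrightarrow> u r \<in> Wh T k" "time_differentiable T u"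
    and uhat: "\<And>r. r \<ge> 0 \<Longrightarrow> uhat r \<in> Mh T k" "time_differentiable (mesh_faces T) uhat" and t: "t \<ge> 0"
  defines "J \<equiv> \<lambda>r. PM_jump k (u r) (uhat r)"
  shows "((\<lambda>r. (norm_tau T \<tau> (J r))\<^sup>2) has_real_derivative
    2 * (\<Sum>K\<in>T. \<Sum>F\<in>elt_faces K. surf_inner F F (\<lambda>x. \<tau> K F *v J t K F x) (time_deriv u t K)
        - surf_inner F F (\<lambda>x. \<tau> K F *v J t K F x) (time_deriv uhat t F))) (at t within {0..})"
proof -
  have JP: "J r K F \<in> Pk k F UNIV" if "r \<ge> 0" "K \<in> T" "F \<in> elt_faces K" for r K F
    unfolding J_def by (rule jump_Pk[OF u(1)[OF that(1)] uhat(1)[OF that(1)] that(2,3)])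
  have sq: "(norm_tau T \<tau> (J r))\<^sup>2 = (\<Sum>K\<in>T. \<Sum>F\<in>elt_faces K. surf_inner F F (\<lambda>x. \<tau> K F *v J r K F x) (J r K F))"
    if "r \<ge> 0" for r
    by (rule norm_tau_sq[OF Pk_continuous_on[OF JP[OF that]]])
  have "((\<lambda>r. surf_inner F F (\<lambda>x. \<tau> K F *v J r K F x) (J r K F)) has_real_derivative
      2 * (surf_inner F F (\<lambda>x. \<tau> K F *v J t K F x) (time_deriv u t K)
        - surf_inner F F (\<lambda>x. \<tau> K F *v J t K F x) (time_deriv uhat t F))) (at t within {0..})"
    if K: "K \<in> T" and F: "F \<in> elt_faces K" for K F
  proof -
    note FM = elt_face_mesh[OF K F]
    note FF = compact_face[OF FM] borel_face[OF FM] order_refl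
    define M where "M = \<tau> K F"
    have M: "M \<in> Sym" using stab K F unfolding stabilization_def M_def by blast
    let ?b = "\<lambda>p q. surf_inner F F (\<lambda>x. M *v p x) q"
    have b_sym: "?b p q = ?b q p" for p q
    proof -
      have "(M *v p x) \<bullet> q x = (M *v q x) \<bullet> p x" for x
        using Sym_adjoint[OF M, of "p x" "q x"] by (simp add: inner_commute)
      then show ?thesis by (simp only: surf_inner_def)
    qed
    have "\<exists>P P'. (\<forall>r\<ge>0. P r \<in> Pk k F UNIV \<and>
         (AE x in surface_measure F. x \<in> F \<longrightarrow> PM k K (\<lambda>F. u r K) F x = P r x)) \<and>
       (\<forall>x. ((\<lambda>r. P r x) has_vector_derivative P' x) (at t within {0..})) \<and>
       (\<forall>\<mu>\<in>Pk k F UNIV. surf_inner F F P' \<mu> = surf_inner F F (time_deriv u t K) \<mu>)"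
      by (rule projected_curve[OF finite_elt_faces[OF K] elt_face[OF K] F t Wh_Pk[OF u(1) K] time_deriv_works[OF u(2) t K]])
    then obtain P P' where P: "\<forall>r\<ge>0. P r \<in> Pk k F UNIV \<and>
         (AE x in surface_measure F. x \<in> F \<longrightarrow> PM k K (\<lambda>F. u r K) F x = P r x)"
      and P': "\<forall>x. ((\<lambda>r. P r x) has_vector_derivative P' x) (at t within {0..})"
      and P'_eq: "\<forall>\<mu>\<in>Pk k F UNIV. surf_inner F F P' \<mu> = surf_inner F F (time_deriv u t K) \<mu>"
      by (elim exE conjE)
    define j where "j r x = 1 *\<^sub>R P r x + (-1) *\<^sub>R uhat r F x" for r x
    define j' where "j' x = 1 *\<^sub>R P' x + (-1) *\<^sub>R time_deriv uhat t F x" for x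
    have Pm: "P r \<in> Pk k F UNIV" if "r \<ge> 0" for r using P that by blast
    have j: "j r \<in> Pk k F UNIV" if "r \<ge> 0" for r
      unfolding j_def by (rule Pk_lincomb[OF subspace_UNIV Pm[OF that] Mh_Pk[OF uhat(1)[OF that] FM]])
    have dj: "((\<lambda>r. j r x) has_vector_derivative j' x) (at t within {0..})" if x: "x \<in> F" for x
      unfolding j_def j'_def
      by (intro has_vector_derivative_add bounded_linear.has_vector_derivative[OF bounded_linear_scaleR_right]
          P'[rule_format] time_deriv_works[OF uhat(2) t FM x])
    have uP': "P' \<in> Pk k F UNIV"
      by (rule Pk_curve_derivative(1)[OF subspace_UNIV Pm t P'[rule_format]])
    have uhat': "time_deriv uhat t F \<in> Pk k F UNIV" by (rule Mh_Pk[OF time_deriv_Mh[OF uhat t] FM])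
    have AE: "AE x in surface_measure F. x \<in> F \<longrightarrow> J r K F x = j r x" if "r \<ge> 0" for r
    proof -
      have "AE x in surface_measure F. x \<in> F \<longrightarrow> PM k K (\<lambda>F. u r K) F x = P r x" using P that by blast
      then show ?thesis by eventually_elim (simp add: J_def PM_jump_def j_def)
    qed
    have cJ: "continuous_on F (J r K F)" and cj: "continuous_on F (j r)" if "r \<ge> 0" for r
      using Pk_continuous_on[OF JP[OF that K F]] Pk_continuous_on[OF j[OF that]] by auto
    have bJ: "?b (J r K F) q = ?b (j r) q" if "r \<ge> 0" "continuous_on F q" for r q
      using AE[OF that(1)]
      by (intro surf_inner_AE_cong FF matrix_image_continuous cJ cj that) (auto elim: eventually_mono)
    have lin: "fun_linear (Pk k F UNIV) F (\<lambda>p. ?b p q)" if "q \<in> Pk k F UNIV" for q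
      by (rule surf_linear[OF FF Pk_continuous_on[OF that] matrix_vector_mul_linear])
    have "((\<lambda>r. ?b (j r) (j r)) has_real_derivative 2 * ?b j' (j t)) (at t within {0..})"
      by (rule Pk_curve_quadratic_derivative[where b="?b", OF subspace_UNIV j t dj lin b_sym])
    moreover have "?b (J r K F) (J r K F) = ?b (j r) (j r)" if "r \<ge> 0" for r
      by (rule trans[OF bJ[OF that cJ[OF that]] trans[OF b_sym bJ[OF that cj[OF that]]]])
    ultimately have D: "((\<lambda>r. ?b (J r K F) (J r K F)) has_real_derivative 2 * ?b j' (j t)) (at t within {0..})"
      by (rule has_real_derivative_Ici_cong[OF _ t])
    have \<mu>: "(\<lambda>x. M *v j t x) \<in> Pk k F UNIV"
      by (rule Pk_linear_image[OF matrix_vector_mul_linear j[OF t]]) simp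
    have "?b (j t) j' = surf_inner F F j' (\<lambda>x. M *v j t x)" by (rule surf_inner_commute)
    also have "\<dots> = 1 * surf_inner F F P' (\<lambda>x. M *v j t x) + (-1) * surf_inner F F (time_deriv uhat t F) (\<lambda>x. M *v j t x)"
      unfolding j'_def
      by (rule surf_inner_lincomb[OF FF Pk_continuous_on[OF uP'] Pk_continuous_on[OF uhat'] Pk_continuous_on[OF \<mu>]])
    also have "surf_inner F F P' (\<lambda>x. M *v j t x) = surf_inner F F (time_deriv u t K) (\<lambda>x. M *v j t x)"
      using P'_eq \<mu> by blast
    finally have "?b (j t) j' = ?b (j t) (time_deriv u t K) - ?b (j t) (time_deriv uhat t F)"
      by (simp add: surf_inner_commute)
    also have "\<dots> = ?b (J t K F) (time_deriv u t K) - ?b (J t K F) (time_deriv uhat t F)"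
      using bJ[OF t Wh_continuous[OF time_deriv_Wh[OF u t] K F]] bJ[OF t Pk_continuous_on[OF uhat']] by simp
    finally show ?thesis using D b_sym[of j' "j t"] by (simp add: M_def)
  qed
  then have "((\<lambda>r. \<Sum>K\<in>T. \<Sum>F\<in>elt_faces K. surf_inner F F (\<lambda>x. \<tau> K F *v J r K F x) (J r K F)) has_real_derivative
    2 * (\<Sum>K\<in>T. \<Sum>F\<in>elt_faces K. surf_inner F F (\<lambda>x. \<tau> K F *v J t K F x) (time_deriv u t K)
        - surf_inner F F (\<lambda>x. \<tau> K F *v J t K F x) (time_deriv uhat t F))) (at t within {0..})"
    unfolding sum_distrib_left by (intro DERIV_sum)
  from has_real_derivative_Ici_cong[OF this t sq] show ?thesis .
qed

text \<open>
  The work of the stabilization is stored in the jump: it cancels against the derivative of the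
  third term.
\<close>

lemma displacement_flux_energy:
  assumes sol: "hdg_solution T k \<Gamma>D \<Gamma>N (compliance \<C>) \<rho> f gD gN
      (\<lambda>t. flux k \<tau> (-1) (\<sigma> t) (u t) (uhat t)) \<sigma> u uhat" and t: "t \<ge> 0"
  shows "((\<lambda>r. 1/2 * (norm_A T (compliance \<C>) (\<sigma> r))\<^sup>2 + 1/2 * (norm_rho T \<rho> (time_deriv u r))\<^sup>2
      + 1/2 * (norm_tau T \<tau> (PM_jump k (u r) (uhat r)))\<^sup>2) has_real_derivative 0) (at t within {0..})"
proof -
  have spaces: "\<forall>t\<ge>0. \<sigma> t \<in> Vh T k \<and> u t \<in> Wh T k \<and> uhat t \<in> Mh T k"
    and du: "time_differentiable T u" and duhat: "time_differentiable (mesh_faces T) uhat"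
    using sol unfolding hdg_solution_def by - (elim conjE, assumption)+
  have u: "u r \<in> Wh T k" and uhat: "uhat r \<in> Mh T k" if "r \<ge> 0" for r using spaces that by auto
  have "((\<lambda>r. (1/2 * (norm_A T (compliance \<C>) (\<sigma> r))\<^sup>2 + 1/2 * (norm_rho T \<rho> (time_deriv u r))\<^sup>2)
      + 1/2 * (norm_tau T \<tau> (PM_jump k (u r) (uhat r)))\<^sup>2) has_real_derivative
      (-1) * (\<Sum>K\<in>T. \<Sum>F\<in>elt_faces K. surf_inner F F (\<lambda>x. \<tau> K F *v PM_jump k (u t) (uhat t) K F x) (time_deriv u t K)
        - surf_inner F F (\<lambda>x. \<tau> K F *v PM_jump k (u t) (uhat t) K F x) (time_deriv uhat t F))
      + 1/2 * (2 * (\<Sum>K\<in>T. \<Sum>F\<in>elt_faces K. surf_inner F F (\<lambda>x. \<tau> K F *v PM_jump k (u t) (uhat t) K F x) (time_deriv u t K)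
        - surf_inner F F (\<lambda>x. \<tau> K F *v PM_jump k (u t) (uhat t) K F x) (time_deriv uhat t F)))) (at t within {0..})"
    by (intro DERIV_add DERIV_cmult energy_derivative[OF sol u[OF t] uhat[OF t] t]
        norm_tau_jump_derivative[OF u du uhat duhat t])
  then show ?thesis by simp
qed

end

theorem proposition6p3:
  fixes \<Omega> \<Gamma>D \<Gamma>N :: "(real^3) set" and T :: "(real^3) set set" and k :: nat
    and \<C> :: "real^3 \<Rightarrow> real^3^3 \<Rightarrow> real^3^3" and \<rho> :: "real^3 \<Rightarrow> real"
    and \<tau> :: stab and c\<^sub>\<tau> c\<^sub>\<tau>' :: real
    and f gD gN :: "real \<Rightarrow> real^3 \<Rightarrow> real^3"
  assumes "lipschitz_polyhedron \<Omega>"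
    and "face_splitting (frontier \<Omega>) \<Gamma>D \<Gamma>N"
    and "conforming_tetrahedrization T \<Omega>"
    and "stiffness \<Omega> \<C>"
    and "mass_density \<Omega> \<rho>"
    and "c\<^sub>\<tau> > 0" and "c\<^sub>\<tau>' > 0" and "stabilization T \<tau> c\<^sub>\<tau> c\<^sub>\<tau>'"
    and "\<And>t. t \<ge> 0 \<Longrightarrow> f t \<in> L2 (lebesgue_on \<Omega>)"
    and "\<And>t. t \<ge> 0 \<Longrightarrow> gD t \<in> H12 T (frontier \<Omega>) \<Gamma>D"
    and "\<And>t. t \<ge> 0 \<Longrightarrow> gN t \<in> L2_part T \<Gamma>N"
    and f_zero: "\<And>t. t \<ge> 0 \<Longrightarrow> AE x in lebesgue_on \<Omega>. f t x = 0"
    and gN_zero: "\<And>t F. t \<ge> 0 \<Longrightarrow> F \<in> mesh_faces T \<Longrightarrow>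
      AE x in surface_measure F. x \<in> \<Gamma>N \<longrightarrow> gN t x = 0"
    and gD_static: "H12_static T (frontier \<Omega>) \<Gamma>D gD"
  shows
   "(\<forall>s\<in>{1, -1}. \<forall>\<sigma> u uhat.
       hdg_solution T k \<Gamma>D \<Gamma>N (compliance \<C>) \<rho> f gD gN
         (\<lambda>t. flux k \<tau> s (\<sigma> t) (time_deriv u t) (time_deriv uhat t)) \<sigma> u uhat \<longrightarrow>
       (\<forall>t\<ge>0. ((\<lambda>r. 1/2 * (norm_A T (compliance \<C>) (\<sigma> r))\<^sup>2
                   + 1/2 * (norm_rho T \<rho> (time_deriv u r))\<^sup>2)
           has_real_derivative
             s * (norm_tau T \<tau> (PM_jump k (time_deriv u t) (time_deriv uhat t)))\<^sup>2)
           (at t within {0..}))) \<and>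
    (\<forall>\<sigma> u uhat.
       hdg_solution T k \<Gamma>D \<Gamma>N (compliance \<C>) \<rho> f gD gN
         (\<lambda>t. flux k \<tau> (-1) (\<sigma> t) (u t) (uhat t)) \<sigma> u uhat \<longrightarrow>
       (\<forall>t\<ge>0. ((\<lambda>r. 1/2 * (norm_A T (compliance \<C>) (\<sigma> r))\<^sup>2
                   + 1/2 * (norm_rho T \<rho> (time_deriv u r))\<^sup>2
                   + 1/2 * (norm_tau T \<tau> (PM_jump k (u r) (uhat r)))\<^sup>2)
           has_real_derivative 0) (at t within {0..})))"
proof -
  interpret unforced_hdg \<Omega> \<Gamma>D \<Gamma>N T k \<C> \<rho> \<tau> c\<^sub>\<tau> c\<^sub>\<tau>' f gD gN
    by unfold_locales (fact assms)+
  show ?thesis using derivative_flux_energy displacement_flux_energy by simp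
qed

end
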